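(* Let $E$ and $F$ be two Banach lattices such that $F$ is $\sigma$-Dedekind complete. Then the following statements are equivalent: (1) Every order bounded weak almost limited operator $T:E\to F$ is almost Dunford-Pettis. (2) Every positive weak almost limited operator $T:E\to F$ is almost Dunford-Pettis. (3) One of the following assertions is valid: (i) $E$ has the positive Schur property. (ii) The norm of $F$ is order continuous.
   Context: All Banach lattices are real; "operator" means bounded linear mapping. A sequence $(x_n)$ in a Banach lattice is disjoint if $|x_n|\wedge|x_m|=0$ for $n\neq m$. A Banach lattice $E$ has the positive Schur property if $\|x_n\|\to 0$ for every weakly null sequence $(x_n)\subset E^+$. An operator $T:E\to X$ from a Banach lattice into a Banach space is almost Dunford-Pettis if $T$ carries every disjoint weakly null sequence to a norm null sequence. A norm bounded subset $A$ of a Banach lattice $F$ is an almost limited set if every disjoint weak* null sequence $(f_n)$ in $F^*$ satisfies $\sup_{y\in A}|f_n(y)|\to 0$. An operator $T:X\to F$ from a Banach space into a Banach lattice is weak almost limited if $T$ carries each relatively weakly compact set in $X$ to an almost limited set in $F$. *)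

theory Defs
  imports
    "HOL-Analysis.Analysis"
    "HOL-Library.Lattice_Algebras"
    "HOL-Library.Lub_Glb"
begin

section \<open>Banach lattices\<close>

class banach_lattice = banach + ordered_real_vector + lattice_ab_group_add_abs +
  assumes norm_mono_abs: "\<bar>x\<bar> \<le> \<bar>y\<bar> \<Longrightarrow> norm x \<le> norm y"

instance real :: banach_lattice
  by standard simp

definition disjoint_seq :: "(nat \<Rightarrow> 'a::banach_lattice) \<Rightarrow> bool" where
  "disjoint_seq x \<longleftrightarrow> (\<forall>n m. n \<noteq> m \<longrightarrow> inf \<bar>x n\<bar> \<bar>x m\<bar> = 0)"

definition sigma_Dedekind_complete :: "'a::banach_lattice itself \<Rightarrow> bool" where
  "sigma_Dedekind_complete _ \<longleftrightarrow>
     (\<forall>A :: 'a set. countable A \<and> A \<noteq> {} \<and> bdd_above A \<longrightarrow> (\<exists>s. isLub UNIV A s))"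

text \<open>
  The norm is order continuous if \<open>x\<^sub>\<alpha> \<down> 0\<close> implies \<open>\<parallel>x\<^sub>\<alpha>\<parallel> \<rightarrow> 0\<close> for every net. The range of a
  decreasing net is a downward directed set, and conversely a downward directed set is a decreasing
  net indexed by itself; so the nets are given here as downward directed sets \<open>D\<close>, and the last
  line is norm convergence to \<open>0\<close> along such a net.
\<close>

definition order_continuous_norm :: "'a::banach_lattice itself \<Rightarrow> bool" where
  "order_continuous_norm _ \<longleftrightarrow>
     (\<forall>D :: 'a set. D \<noteq> {} \<and> (\<forall>x\<in>D. \<forall>y\<in>D. \<exists>z\<in>D. z \<le> x \<and> z \<le> y) \<and> isGlb UNIV D 0 \<longrightarrow>
        (\<forall>e>0. \<exists>x\<in>D. \<forall>y\<in>D. y \<le> x \<longrightarrow> norm y < e))"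


section \<open>Weak and weak* topologies\<close>

definition weak_topology :: "'a::real_normed_vector topology" where
  "weak_topology = pullback_topology UNIV (\<lambda>x (f :: 'a \<Rightarrow>\<^sub>L real). f x) euclidean"

text \<open>For real-valued operators the strong operator topology is the weak* topology.\<close>

abbreviation weak_star_topology :: "('a::real_normed_vector \<Rightarrow>\<^sub>L real) topology" where
  "weak_star_topology \<equiv> strong_operator_topology"

definition weakly_null :: "(nat \<Rightarrow> 'a::real_normed_vector) \<Rightarrow> bool" where
  "weakly_null x \<longleftrightarrow> limitin weak_topology x 0 sequentially"

definition weak_star_null :: "(nat \<Rightarrow> ('a::real_normed_vector \<Rightarrow>\<^sub>L real)) \<Rightarrow> bool" where
  "weak_star_null f \<longleftrightarrow> limitin weak_star_topology f 0 sequentially"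

definition relatively_weakly_compact :: "'a::real_normed_vector set \<Rightarrow> bool" where
  "relatively_weakly_compact A \<longleftrightarrow> compactin weak_topology (weak_topology closure_of A)"

lemma limitin_pullback_UNIV:
  "limitin (pullback_topology UNIV g T) x l F \<longleftrightarrow> limitin T (\<lambda>n. g (x n)) (g l) F"
proof
  assume L: "limitin (pullback_topology UNIV g T) x l F"
  show "limitin T (\<lambda>n. g (x n)) (g l) F"
    unfolding limitin_def
  proof (intro conjI allI impI)
    show "g l \<in> topspace T"
      using limitin_topspace [OF L] by (simp add: topspace_pullback_topology)
    fix U assume U: "openin T U \<and> g l \<in> U"
    then have "openin (pullback_topology UNIV g T) (g -` U)"
      unfolding openin_pullback_topology by blast
    then show "\<forall>\<^sub>F n in F. g (x n) \<in> U"
      using limitinD [OF L, of "g -` U"] U by simp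
  qed
next
  assume L: "limitin T (\<lambda>n. g (x n)) (g l) F"
  show "limitin (pullback_topology UNIV g T) x l F"
    unfolding limitin_def
  proof (intro conjI allI impI)
    show "l \<in> topspace (pullback_topology UNIV g T)"
      using limitin_topspace [OF L] by (simp add: topspace_pullback_topology)
    fix V assume V: "openin (pullback_topology UNIV g T) V \<and> l \<in> V"
    then obtain U where U: "openin T U" "V = g -` U"
      unfolding openin_pullback_topology by auto
    then show "\<forall>\<^sub>F n in F. x n \<in> V"
      using limitinD [OF L, of U] V by simp
  qed
qed

lemma tendsto_fun_iff: "(x \<longlongrightarrow> l) F \<longleftrightarrow> (\<forall>i. ((\<lambda>n. x n i) \<longlongrightarrow> l i) F)"
  for x :: "'n \<Rightarrow> 'i \<Rightarrow> real"
  unfolding limitin_canonical_iff [symmetric] euclidean_product_topology [symmetric]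
    limitin_componentwise
  by simp

lemma weakly_null_iff: "weakly_null x \<longleftrightarrow> (\<forall>f :: _ \<Rightarrow>\<^sub>L real. (\<lambda>n. f (x n)) \<longlonglongrightarrow> 0)"
  unfolding weakly_null_def weak_topology_def limitin_pullback_UNIV limitin_canonical_iff
    tendsto_fun_iff
  by (simp add: blinfun.zero_right)

lemma weak_star_null_iff: "weak_star_null f \<longleftrightarrow> (\<forall>x. (\<lambda>n. blinfun_apply (f n) x) \<longlonglongrightarrow> 0)"
  unfolding weak_star_null_def strong_operator_topology_def limitin_pullback_UNIV
    limitin_canonical_iff tendsto_fun_iff
  by simp


section \<open>The order of the dual\<close>

instantiation blinfun :: (banach_lattice, "{real_normed_vector, order}") order
begin

definition less_eq_blinfun :: "'a \<Rightarrow>\<^sub>L 'b \<Rightarrow> 'a \<Rightarrow>\<^sub>L 'b \<Rightarrow> bool" where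
  "f \<le> g \<longleftrightarrow> (\<forall>x\<ge>0. blinfun_apply f x \<le> blinfun_apply g x)"

definition less_blinfun :: "'a \<Rightarrow>\<^sub>L 'b \<Rightarrow> 'a \<Rightarrow>\<^sub>L 'b \<Rightarrow> bool" where
  "less_blinfun f g \<longleftrightarrow> f \<le> g \<and> \<not> g \<le> f"

instance
proof
  fix f g h :: "'a \<Rightarrow>\<^sub>L 'b"
  show "f < g \<longleftrightarrow> f \<le> g \<and> \<not> g \<le> f"
    by (rule less_blinfun_def)
  show "f \<le> f"
    by (simp add: less_eq_blinfun_def)
  show "f \<le> h" if "f \<le> g" "g \<le> h"
    using that by (meson less_eq_blinfun_def order_trans)
  show "f = g" if "f \<le> g" "g \<le> f"
  proof (rule blinfun_eqI)
    have pos: "blinfun_apply f x = blinfun_apply g x" if "0 \<le> x" for x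
      using \<open>f \<le> g\<close> \<open>g \<le> f\<close> that by (simp add: less_eq_blinfun_def order_antisym)
    fix x :: 'a
    have "x = pprt x - (- nprt x)"
      by (subst prts [of x]) simp
    moreover have "0 \<le> pprt x" "0 \<le> - nprt x"
      by simp_all
    ultimately show "blinfun_apply f x = blinfun_apply g x"
      using pos by (metis blinfun.diff_right)
  qed
qed

end

text \<open>
  \<open>\<bar>f\<bar> \<and> \<bar>g\<bar> = 0\<close> in the dual Banach lattice, with the modulus \<open>\<bar>f\<bar> = f \<or> (-f)\<close> and the infimum taken
  with respect to the dual order. The suprema \<open>a = \<bar>f\<bar>\<close> and \<open>b = \<bar>g\<bar>\<close> always exist because the dual
  is a lattice.
\<close>

definition dual_disjoint :: "('a::banach_lattice \<Rightarrow>\<^sub>L real) \<Rightarrow> ('a \<Rightarrow>\<^sub>L real) \<Rightarrow> bool" where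
  "dual_disjoint f g \<longleftrightarrow>
     (\<exists>a b. isLub UNIV {f, - f} a \<and> isLub UNIV {g, - g} b \<and> isGlb UNIV {a, b} 0)"

definition dual_disjoint_seq :: "(nat \<Rightarrow> ('a::banach_lattice \<Rightarrow>\<^sub>L real)) \<Rightarrow> bool" where
  "dual_disjoint_seq f \<longleftrightarrow> (\<forall>n m. n \<noteq> m \<longrightarrow> dual_disjoint (f n) (f m))"


section \<open>Classes of spaces, sets and operators\<close>

definition positive_Schur :: "'a::banach_lattice itself \<Rightarrow> bool" where
  "positive_Schur _ \<longleftrightarrow>
     (\<forall>x :: nat \<Rightarrow> 'a. (\<forall>n. 0 \<le> x n) \<and> weakly_null x \<longrightarrow> (\<lambda>n. norm (x n)) \<longlonglongrightarrow> 0)"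

definition almost_Dunford_Pettis :: "('a::banach_lattice \<Rightarrow>\<^sub>L 'b::banach) \<Rightarrow> bool" where
  "almost_Dunford_Pettis T \<longleftrightarrow>
     (\<forall>x. disjoint_seq x \<and> weakly_null x \<longrightarrow> (\<lambda>n. norm (T (x n))) \<longlonglongrightarrow> 0)"

text \<open>
  Inserting \<open>0\<close> does not change the supremum of the nonnegative numbers \<open>\<bar>f\<^sub>n(y)\<bar>\<close> over a nonempty
  \<open>A\<close>; it only gives the supremum over the empty set its usual value \<open>0\<close>. The supremum is finite
  since \<open>A\<close> is bounded.
\<close>

definition almost_limited :: "'a::banach_lattice set \<Rightarrow> bool" where
  "almost_limited A \<longleftrightarrow> bounded A \<and>
     (\<forall>f. dual_disjoint_seq f \<and> weak_star_null f \<longrightarrow>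
        (\<lambda>n. SUP y\<in>insert 0 A. \<bar>blinfun_apply (f n) y\<bar>) \<longlonglongrightarrow> 0)"

definition weak_almost_limited :: "('a::banach \<Rightarrow>\<^sub>L 'b::banach_lattice) \<Rightarrow> bool" where
  "weak_almost_limited T \<longleftrightarrow>
     (\<forall>A. relatively_weakly_compact A \<longrightarrow> almost_limited (blinfun_apply T ` A))"

definition order_bounded_op :: "('a::banach_lattice \<Rightarrow>\<^sub>L 'b::banach_lattice) \<Rightarrow> bool" where
  "order_bounded_op T \<longleftrightarrow>
     (\<forall>A. bdd_below A \<and> bdd_above A \<longrightarrow>
        bdd_below (blinfun_apply T ` A) \<and> bdd_above (blinfun_apply T ` A))"

definition positive_op :: "('a::banach_lattice \<Rightarrow>\<^sub>L 'b::banach_lattice) \<Rightarrow> bool" where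
  "positive_op T \<longleftrightarrow> (\<forall>x\<ge>0. 0 \<le> blinfun_apply T x)"

end

theory Submission
  imports Defs
begin

text \<open>
  The dual is handled through positive functionals, with \<open>f \<and> g = 0\<close> expressed by splitting positive vectors.

  If the norm of \<open>F\<close> is order continuous and \<open>\<parallel>T x\<^sub>n\<parallel> \<ge> e\<close> for a disjoint weakly null \<open>x\<^sub>n\<close>, then \<open>\<bar>T x\<^sub>n\<bar>\<close> is
  weakly null, so norming functionals can be disjointified along a subsequence to \<open>h\<^sub>n\<close> with \<open>\<bar>h\<^sub>n (T x\<^sub>n)\<bar> \<ge> e/4\<close>.
  Order continuity makes \<open>h\<^sub>n\<close> weak* null, against \<open>{T x\<^sub>n}\<close> being almost limited.

  Conversely, if \<open>E\<close> fails the positive Schur property there are disjoint weakly null \<open>x\<^sub>n \<ge> 0\<close> and bounded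
  \<open>f\<^sub>n \<ge> 0\<close> with \<open>f\<^sub>n x\<^sub>n \<ge> d\<close>, and if the norm of \<open>F\<close> is not order continuous there is a disjoint sequence
  \<open>u\<^sub>n\<close> in an order interval with \<open>\<parallel>u\<^sub>n\<parallel> \<ge> e\<close>. The operator \<open>T x = \<Sum> f\<^sub>n(x) u\<^sub>n\<close> (an order sum) maps the unit ball
  into an order interval. In a \<open>\<sigma>\<close>-Dedekind complete space the moduli of a disjoint weak* null sequence are
  weak* null, so order intervals are almost limited and \<open>T\<close> is weak almost limited; but \<open>\<parallel>T x\<^sub>n\<parallel> \<ge> d e\<close>.
\<close>

section \<open>The Hahn-Banach theorem\<close>

text \<open>Two gaps separate what is given from what the arguments use. Suprema and infima of
  functionals are known only through the order of the dual, so \<open>isLub_modulus\<close> and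
  \<open>isGlb_perp\<close> test them against explicit bounds made from \<open>pos_part\<close>;
  afterwards only evaluations at positive vectors occur. And disjointness has to be manufactured:
  from the n-th member of a sequence one subtracts a large multiple of its predecessors and a small
  multiple of a weighted sum of all members. This is harmless only if the subtracted predecessors
  contribute little to the n-th evaluation, which a sparse subsequence provides. For functionals
  this comes from weak convergence of the vectors, for vectors from weak* convergence of the
  functionals. When the latter fails at some \<open>u\<close>, the interval from 0 to
  \<open>u\<close> already contains a disjoint sequence; hence the case distinction in
  \<open>not_positive_Schur_disjoint\<close>. Sigma-Dedekind completeness supplies the countable
  suprema that collect infinitely many local choices in one vector.\<close>

definition sublinear :: "('a::real_vector \<Rightarrow> real) \<Rightarrow> bool" where
  "sublinear p \<longleftrightarrow> (\<forall>x y. p (x + y) \<le> p x + p y) \<and> (\<forall>c x. 0 < c \<longrightarrow> p (c *\<^sub>R x) \<le> c * p x)"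

lemma sublinear_add: "sublinear p \<Longrightarrow> p (x + y) \<le> p x + p y"
  unfolding sublinear_def by blast

lemma sublinear_scaleR_le: "sublinear p \<Longrightarrow> 0 < c \<Longrightarrow> p (c *\<^sub>R x) \<le> c * p x"
  unfolding sublinear_def by blast

lemma sublinear_zero:
  assumes "sublinear p" shows "p 0 = 0"
proof -
  have "p (2 *\<^sub>R 0) \<le> 2 * p 0" "p ((1/2) *\<^sub>R 0) \<le> (1/2) * p 0"
    using assms by (intro sublinear_scaleR_le; simp)+
  then show ?thesis by simp
qed

lemma sublinear_scaleR:
  assumes "sublinear p" "0 \<le> c" shows "p (c *\<^sub>R x) = c * p x"
proof (cases "c = 0")
  case True then show ?thesis by (simp add: sublinear_zero assms)
next
  case False
  then have c: "0 < c" using assms by simp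
  have "p (inverse c *\<^sub>R (c *\<^sub>R x)) \<le> inverse c * p (c *\<^sub>R x)"
    using assms c by (intro sublinear_scaleR_le) auto
  then have "p x \<le> inverse c * p (c *\<^sub>R x)" using c by simp
  then have "c * p x \<le> p (c *\<^sub>R x)" using c by (simp add: field_simps)
  moreover have "p (c *\<^sub>R x) \<le> c * p x" by (rule sublinear_scaleR_le[OF assms(1) c])
  ultimately show ?thesis by simp
qed

lemma sublinear_minus:
  assumes "sublinear p" shows "- p (- x) \<le> p x"
  using sublinear_add[OF assms, of x "- x"] sublinear_zero[OF assms] by simp

text \<open>For sublinear \<open>p\<close> the choice \<open>t = 1\<close> shows that the value at
  \<open>- y\<close> is at most \<open>- p y\<close>, so a linear functional below the shift is at
  least \<open>p y\<close> at \<open>y\<close>. The shift never exceeds \<open>p\<close>, hence a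
  minimal sublinear functional equals all its shifts.\<close>

definition sublinear_shift :: "('a::real_vector \<Rightarrow> real) \<Rightarrow> 'a \<Rightarrow> 'a \<Rightarrow> real" where
  "sublinear_shift p y x = (INF t\<in>{0..}. p (x + t *\<^sub>R y) - t * p y)"

lemma sublinear_shift_le:
  assumes "sublinear p" "0 \<le> t"
  shows "sublinear_shift p y x \<le> p (x + t *\<^sub>R y) - t * p y"
  unfolding sublinear_shift_def
proof (rule cINF_lower)
  have "- p (- x) \<le> p (x + s *\<^sub>R y) - s * p y" if "0 \<le> s" for s
    using sublinear_add[OF assms(1), of "x + s *\<^sub>R y" "- x"] sublinear_scaleR[OF assms(1) that, of y]
    by simp
  then show "bdd_below ((\<lambda>t. p (x + t *\<^sub>R y) - t * p y) ` {0..})"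
    by (intro bdd_belowI2) auto
qed (use assms in auto)

lemma sublinear_shift_greatest:
  assumes "\<And>t. 0 \<le> t \<Longrightarrow> b \<le> p (x + t *\<^sub>R y) - t * p y"
  shows "b \<le> sublinear_shift p y x"
  unfolding sublinear_shift_def using assms by (intro cINF_greatest) auto

lemma sublinear_sublinear_shift:
  assumes p: "sublinear p"
  shows "sublinear (sublinear_shift p y)"
  unfolding sublinear_def
proof (intro conjI allI impI)
  fix x x'
  have "sublinear_shift p y (x + x') - (p (x + t *\<^sub>R y) - t * p y) \<le> sublinear_shift p y x'"
    if t: "0 \<le> t" for t
  proof (rule sublinear_shift_greatest)
    fix s :: real assume s: "0 \<le> s"
    have "sublinear_shift p y (x + x') \<le> p (x + x' + (t + s) *\<^sub>R y) - (t + s) * p y"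
      using t s by (intro sublinear_shift_le p) auto
    also have "x + x' + (t + s) *\<^sub>R y = (x + t *\<^sub>R y) + (x' + s *\<^sub>R y)"
      by (simp add: algebra_simps)
    also have "p \<dots> \<le> p (x + t *\<^sub>R y) + p (x' + s *\<^sub>R y)" by (rule sublinear_add[OF p])
    finally show "sublinear_shift p y (x + x') - (p (x + t *\<^sub>R y) - t * p y)
        \<le> p (x' + s *\<^sub>R y) - s * p y" by (simp add: algebra_simps)
  qed
  then have "sublinear_shift p y (x + x') - sublinear_shift p y x' \<le> sublinear_shift p y x"
    by (intro sublinear_shift_greatest) (simp add: algebra_simps)
  then show "sublinear_shift p y (x + x') \<le> sublinear_shift p y x + sublinear_shift p y x'" by simp
next
  fix c :: real and x assume c: "0 < c"
  have "sublinear_shift p y (c *\<^sub>R x) / c \<le> sublinear_shift p y x"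
  proof (rule sublinear_shift_greatest)
    fix t :: real assume t: "0 \<le> t"
    have "sublinear_shift p y (c *\<^sub>R x) \<le> p (c *\<^sub>R x + (c * t) *\<^sub>R y) - (c * t) * p y"
      using t c by (intro sublinear_shift_le p) auto
    also have "c *\<^sub>R x + (c * t) *\<^sub>R y = c *\<^sub>R (x + t *\<^sub>R y)" by (simp add: algebra_simps)
    also have "p \<dots> = c * p (x + t *\<^sub>R y)" using c by (intro sublinear_scaleR p) auto
    finally show "sublinear_shift p y (c *\<^sub>R x) / c \<le> p (x + t *\<^sub>R y) - t * p y"
      using c by (simp add: field_simps)
  qed
  then show "sublinear_shift p y (c *\<^sub>R x) \<le> c * sublinear_shift p y x"
    using c by (simp add: field_simps)
qed

text \<open>Zorn's lemma for the reversed order. The infimum of a chain is finite because every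
  member is at least \<open>- p (- x)\<close> at \<open>x\<close>, and it is subadditive because of
  any two members the smaller one serves for both arguments.\<close>

lemma minimal_sublinear:
  assumes p: "sublinear p"
  obtains q where "sublinear q" "q \<le> p" "\<And>r. sublinear r \<Longrightarrow> r \<le> q \<Longrightarrow> r = q"
proof -
  let ?A = "{q. sublinear q \<and> q \<le> p}"
  let ?P = "\<lambda>q r :: _ \<Rightarrow> real. r \<le> q"
  have "\<exists>m\<in>?A. \<forall>a\<in>?A. ?P m a \<longrightarrow> a = m"
  proof (rule predicate_Zorn)
    show "partial_order_on ?A (relation_of ?P ?A)"
      by (rule partial_order_on_relation_ofI) auto
    fix C assume "C \<in> Chains (relation_of ?P ?A)"
    then have C: "C \<subseteq> ?A" "\<And>q r. q \<in> C \<Longrightarrow> r \<in> C \<Longrightarrow> q \<le> r \<or> r \<le> q"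
      by (auto simp: Chains_def relation_of_def)
    show "\<exists>u\<in>?A. \<forall>a\<in>C. ?P a u"
    proof (cases "C = {}")
      case True then show ?thesis using p by auto
    next
      case False
      define u where "u x = (INF q\<in>C. q x)" for x
      have low: "- p (- x) \<le> q x" if "q \<in> C" for q x
      proof -
        have "sublinear q" "q (- x) \<le> p (- x)" using C that by (auto simp: le_fun_def)
        then show ?thesis using sublinear_minus[of q x] by linarith
      qed
      have u_le: "u x \<le> q x" if "q \<in> C" for q x
        unfolding u_def using low that by (intro cINF_lower bdd_belowI2[of _ "- p (- x)"]) auto
      have u_gr: "b \<le> u x" if "\<And>q. q \<in> C \<Longrightarrow> b \<le> q x" for b x
        unfolding u_def using False that by (intro cINF_greatest) auto
      have "sublinear u"
        unfolding sublinear_def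
      proof (intro conjI allI impI)
        fix x y
        have "u (x + y) - q x \<le> u y" if q: "q \<in> C" for q
        proof (rule u_gr)
          fix r assume r: "r \<in> C"
          obtain s where s: "s \<in> C" "s \<le> q" "s \<le> r" using C(2)[OF q r] q r by blast
          have "u (x + y) \<le> s (x + y)" by (rule u_le[OF s(1)])
          also have "\<dots> \<le> s x + s y" using s C by (intro sublinear_add) auto
          also have "\<dots> \<le> q x + r y" using s by (intro add_mono) (auto simp: le_fun_def)
          finally show "u (x + y) - q x \<le> r y" by simp
        qed
        then have "u (x + y) - u y \<le> u x" by (intro u_gr) (simp add: algebra_simps)
        then show "u (x + y) \<le> u x + u y" by simp
      next
        fix c :: real and x assume c: "0 < c"
        have "u (c *\<^sub>R x) / c \<le> u x"
        proof (rule u_gr)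
          fix q assume q: "q \<in> C"
          have "u (c *\<^sub>R x) \<le> q (c *\<^sub>R x)" by (rule u_le[OF q])
          also have "\<dots> \<le> c * q x" using q C c by (intro sublinear_scaleR_le) auto
          finally show "u (c *\<^sub>R x) / c \<le> q x" using c by (simp add: field_simps)
        qed
        then show "u (c *\<^sub>R x) \<le> c * u x" using c by (simp add: field_simps)
      qed
      moreover have "u \<le> p"
      proof -
        obtain q where "q \<in> C" using False by auto
        then show ?thesis using u_le[of q] C by (auto simp: le_fun_def intro: order_trans)
      qed
      ultimately show ?thesis using u_le by (auto simp: le_fun_def)
    qed
  qed
  then obtain q where q: "sublinear q" "q \<le> p" "\<forall>a\<in>?A. a \<le> q \<longrightarrow> a = q" by auto
  then show ?thesis by (intro that[of q]) (auto intro: order_trans)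
qed

text \<open>A minimal sublinear \<open>q\<close> is linear: it equals its own shift by
  \<open>y\<close>, and \<open>t = 1\<close> then reads \<open>q x + q y \<le> q (x + y)\<close>.
  Minimizing below the shift of \<open>p\<close> by \<open>a\<close>, instead of below
  \<open>p\<close>, secures the value at \<open>a\<close>.\<close>

theorem hahn_banach_sublinear:
  fixes p :: "'a::real_vector \<Rightarrow> real"
  assumes p: "sublinear p"
  obtains f where "linear f" "\<And>x. f x \<le> p x" "f a = p a"
proof -
  have p': "sublinear (sublinear_shift p a)" by (rule sublinear_sublinear_shift[OF p])
  then obtain q where q: "sublinear q" "q \<le> sublinear_shift p a"
    and min: "\<And>r. sublinear r \<Longrightarrow> r \<le> q \<Longrightarrow> r = q"
    by (rule minimal_sublinear) blast
  have shift: "sublinear_shift q y = q" for y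
    using sublinear_shift_le[OF q(1), of 0 y]
    by (intro min sublinear_sublinear_shift q) (auto simp: le_fun_def)
  have add: "q (x + y) = q x + q y" for x y
    using sublinear_shift_le[OF q(1), of 1 y x] sublinear_add[OF q(1), of x y]
    by (simp add: shift)
  have minus: "q (- x) = - q x" for x
    using add[of x "- x"] sublinear_zero[OF q(1)] by simp
  have scale: "q (c *\<^sub>R x) = c * q x" for c x
  proof (cases "0 \<le> c")
    case True then show ?thesis by (rule sublinear_scaleR[OF q(1)])
  next
    case False
    then have "q ((- c) *\<^sub>R x) = - c * q x" by (intro sublinear_scaleR[OF q(1)]) auto
    then show ?thesis using minus[of "c *\<^sub>R x"] by simp
  qed
  have le: "q x \<le> p x" for x
    using q(2) sublinear_shift_le[OF p, of 0 a x] by (auto simp: le_fun_def intro: order_trans)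
  have "q (- a) \<le> p (- a + 1 *\<^sub>R a) - 1 * p a"
    using q(2) sublinear_shift_le[OF p, of 1 a "- a"] by (auto simp: le_fun_def intro: order_trans)
  then have "p a \<le> q a" using minus sublinear_zero[OF p] by simp
  then have "q a = p a" using le by (simp add: antisym)
  moreover have "linear q" by (rule linearI) (simp_all add: add scale)
  ultimately show ?thesis using le that by blast
qed

section \<open>Banach lattices and positive functionals\<close>

lemma norm_abs_lattice [simp]: "norm \<bar>x\<bar> = norm x" for x :: "'a::banach_lattice"
  by (intro antisym norm_mono_abs) auto

lemma norm_mono_pos: "0 \<le> x \<Longrightarrow> x \<le> y \<Longrightarrow> norm x \<le> norm y" for x y :: "'a::banach_lattice"
  using abs_of_nonneg[of x] abs_of_nonneg[of y] by (intro norm_mono_abs) (auto intro: order_trans)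

lemma pprt_add_le: "pprt (x + y) \<le> pprt x + pprt y" for x y :: "'a::banach_lattice"
  unfolding pprt_def by (rule sup_least) (auto intro: add_mono)

lemma pprt_le_abs: "pprt x \<le> \<bar>x\<bar>" for x :: "'a::banach_lattice"
  unfolding pprt_def by (simp add: abs_ge_self)

lemma norm_pprt_le: "norm (pprt x) \<le> norm x" for x :: "'a::banach_lattice"
  using norm_mono_pos[OF zero_le_pprt pprt_le_abs, of x] by simp

lemma scaleR_sup:
  fixes x y :: "'a::banach_lattice"
  assumes "0 \<le> c" shows "c *\<^sub>R sup x y = sup (c *\<^sub>R x) (c *\<^sub>R y)"
proof (cases "c = 0")
  case False
  then have c: "0 < c" using assms by simp
  show ?thesis
  proof (rule antisym)
    have "inverse c *\<^sub>R (c *\<^sub>R x) \<le> inverse c *\<^sub>R sup (c *\<^sub>R x) (c *\<^sub>R y)"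
      "inverse c *\<^sub>R (c *\<^sub>R y) \<le> inverse c *\<^sub>R sup (c *\<^sub>R x) (c *\<^sub>R y)"
      using c by (intro scaleR_left_mono; simp)+
    then have "sup x y \<le> inverse c *\<^sub>R sup (c *\<^sub>R x) (c *\<^sub>R y)" using c by simp
    then have "c *\<^sub>R sup x y \<le> c *\<^sub>R (inverse c *\<^sub>R sup (c *\<^sub>R x) (c *\<^sub>R y))"
      using assms by (rule scaleR_left_mono)
    then show "c *\<^sub>R sup x y \<le> sup (c *\<^sub>R x) (c *\<^sub>R y)" using c by simp
    show "sup (c *\<^sub>R x) (c *\<^sub>R y) \<le> c *\<^sub>R sup x y"
      using assms by (intro sup_least scaleR_left_mono) auto
  qed
qed simp

lemma scaleR_inf:
  fixes x y :: "'a::banach_lattice"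
  assumes "0 \<le> c" shows "c *\<^sub>R inf x y = inf (c *\<^sub>R x) (c *\<^sub>R y)"
  by (simp only: inf_eq_neg_sup scaleR_minus_right scaleR_sup[OF assms])

lemma pprt_scaleR: "0 \<le> c \<Longrightarrow> pprt (c *\<^sub>R x) = c *\<^sub>R pprt x" for x :: "'a::banach_lattice"
  by (simp add: pprt_def scaleR_sup)

text \<open>Positivity of \<open>x n\<close> gives \<open>- l \<le> x n - l\<close>, so the positive
  part of \<open>- l\<close> is dominated by the modulus of \<open>x n - l\<close>, whose norm tends
  to 0.\<close>

lemma closed_nonneg: "closed {x :: 'a::banach_lattice. 0 \<le> x}"
  unfolding closed_sequential_limits
proof (intro allI impI, elim conjE)
  fix x :: "nat \<Rightarrow> 'a" and l
  assume x: "\<forall>n. x n \<in> {x. 0 \<le> x}" and l: "x \<longlonglongrightarrow> l"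
  have "norm (pprt (- l)) \<le> norm (x n - l)" for n
  proof -
    have "- l \<le> x n - l" using x by simp
    also have "\<dots> \<le> \<bar>x n - l\<bar>" by (rule abs_ge_self)
    finally have "pprt (- l) \<le> \<bar>x n - l\<bar>" by (simp add: pprt_def)
    then show ?thesis using norm_mono_pos[OF zero_le_pprt, of "- l" "\<bar>x n - l\<bar>"] by simp
  qed
  moreover have "(\<lambda>n. norm (x n - l)) \<longlonglongrightarrow> 0"
    using l by (simp add: LIM_zero_iff tendsto_norm_zero_iff)
  ultimately have "norm (pprt (- l)) \<le> 0" by (intro LIMSEQ_le_const[of _ 0]) auto
  then have "- l \<le> 0" by (simp add: le_zero_iff_zero_pprt)
  then show "l \<in> {x. 0 \<le> x}" by simp
qed

lemma LIMSEQ_nonneg_lattice: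
  fixes x :: "nat \<Rightarrow> 'a::banach_lattice"
  assumes "x \<longlonglongrightarrow> l" "\<And>n. 0 \<le> x n" shows "0 \<le> l"
  using closed_sequentially[OF closed_nonneg, of x l] assms by auto

lemma sum_le_suminf_lattice:
  fixes x :: "nat \<Rightarrow> 'a::banach_lattice"
  assumes "summable x" "\<And>n. 0 \<le> x n" shows "(\<Sum>i<n. x i) \<le> suminf x"
proof -
  have "(\<lambda>m. \<Sum>i<m + n. x i) \<longlonglongrightarrow> suminf x"
    by (rule LIMSEQ_ignore_initial_segment[OF summable_LIMSEQ[OF assms(1)]])
  then have "(\<lambda>m. (\<Sum>i<m + n. x i) - (\<Sum>i<n. x i)) \<longlonglongrightarrow> suminf x - (\<Sum>i<n. x i)"
    by (intro tendsto_diff) auto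
  then have "0 \<le> suminf x - (\<Sum>i<n. x i)"
  proof (rule LIMSEQ_nonneg_lattice)
    show "0 \<le> (\<Sum>i<m + n. x i) - (\<Sum>i<n. x i)" for m
      using assms(2) sum_mono2[of "{..<m+n}" "{..<n}" x] by simp
  qed
  then show ?thesis by simp
qed

lemma le_suminf_lattice:
  fixes x :: "nat \<Rightarrow> 'a::banach_lattice"
  assumes "summable x" "\<And>n. 0 \<le> x n" shows "x n \<le> suminf x"
proof -
  have "x n \<le> (\<Sum>i<Suc n. x i)" using assms(2) by (simp add: sum_nonneg)
  also have "\<dots> \<le> suminf x" by (rule sum_le_suminf_lattice[OF assms])
  finally show ?thesis .
qed

section \<open>Riesz decomposition and disjoint positive vectors\<close>

lemma riesz_decomposition:
  fixes x y z :: "'a::banach_lattice"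
  assumes "0 \<le> z" "z \<le> x + y" "0 \<le> x" "0 \<le> y"
  obtains a b where "z = a + b" "0 \<le> a" "a \<le> x" "0 \<le> b" "b \<le> y"
proof
  show "z = inf z x + (z - inf z x)" by (metis add.commute diff_add_cancel)
  show "0 \<le> inf z x" "inf z x \<le> x" using assms by auto
  show "0 \<le> z - inf z x" by (simp only: diff_ge_0_iff_ge inf_le1)
  have "z - inf z x = sup z x - x" using add_eq_inf_sup[of z x] by (simp add: algebra_simps del: diff_inf_eq_sup)
  also have "\<dots> \<le> y" using assms by (simp add: algebra_simps)
  finally show "z - inf z x \<le> y" .
qed

lemma pprt_minus_pprt: "pprt x - pprt (- x) = x" for x :: "'a::banach_lattice"
  using prts[of x] by (simp add: pprt_neg)

lemma pprt_plus_pprt: "pprt x + pprt (- x) = \<bar>x\<bar>" for x :: "'a::banach_lattice"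
  by (simp add: pprt_neg abs_prts)

lemma pprt_inf_pprt: "inf (pprt x) (pprt (- x)) = 0" for x :: "'a::banach_lattice"
proof -
  have "inf (pprt x) (pprt (- x)) = pprt (- x) + inf (pprt x - pprt (- x)) 0"
    by (simp add: add_inf_distrib_left)
  also have "\<dots> = pprt (- x) + nprt x" by (simp add: pprt_minus_pprt nprt_def)
  finally show ?thesis by (simp add: pprt_neg)
qed

lemma inf_eq_0_mono:
  fixes x y :: "'a::banach_lattice"
  assumes "inf x y = 0" "0 \<le> a" "a \<le> x" "0 \<le> b" "b \<le> y" shows "inf a b = 0"
proof (rule antisym)
  have "inf a b \<le> inf x y" using assms by (intro inf_mono)
  then show "inf a b \<le> 0" using assms by simp
qed (use assms in simp)

lemma inf_eq_0_add:
  fixes x y z :: "'a::banach_lattice"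
  assumes "inf x z = 0" "inf y z = 0" "0 \<le> x" "0 \<le> y" "0 \<le> z" shows "inf (x + y) z = 0"
proof (rule antisym)
  have "0 \<le> inf (x + y) z" using assms by simp
  then obtain a b where ab: "inf (x + y) z = a + b" "0 \<le> a" "a \<le> x" "0 \<le> b" "b \<le> y"
    using riesz_decomposition[of "inf (x + y) z" x y] assms by auto
  have "a + b \<le> z" using ab by (metis inf.cobounded2)
  then have "a \<le> z" "b \<le> z" using ab by (auto intro: order_trans[of _ "a + b"])
  then have "a \<le> inf x z" "b \<le> inf y z" using ab by auto
  then show "inf (x + y) z \<le> 0" using ab assms by (simp add: add_nonpos_nonpos)
  show "0 \<le> inf (x + y) z" by fact
qed

lemma inf_eq_0_scaleR:
  fixes x y :: "'a::banach_lattice"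
  assumes "inf x y = 0" "0 \<le> x" "0 \<le> y" "0 \<le> c" shows "inf (c *\<^sub>R x) y = 0"
proof (cases "c \<le> 1")
  case True
  then have "c *\<^sub>R x \<le> x" using assms scaleR_right_mono[of c 1 x] by simp
  then show ?thesis using inf_eq_0_mono[OF assms(1)] assms by (simp add: scaleR_nonneg_nonneg)
next
  case False
  have y: "y \<le> c *\<^sub>R y" using False assms scaleR_right_mono[of 1 c y] by simp
  have "inf (c *\<^sub>R x) (c *\<^sub>R y) = 0" using scaleR_inf[of c x y] assms by simp
  then show ?thesis by (rule inf_eq_0_mono) (use y assms in \<open>auto simp: scaleR_nonneg_nonneg\<close>)
qed

text \<open>Boundedness is automatic for positive maps: otherwise there are positive vectors of norm
  \<open>(1/2) ^ n\<close> with images of norm above \<open>2 ^ n\<close>, and the image of their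
  sum dominates all these images. Extending by differences then gives an operator.\<close>

lemma cone_extension:
  fixes g :: "'a::banach_lattice \<Rightarrow> 'b::banach_lattice"
  assumes add: "\<And>x y. 0 \<le> x \<Longrightarrow> 0 \<le> y \<Longrightarrow> g (x + y) = g x + g y"
    and scale: "\<And>c x. 0 \<le> c \<Longrightarrow> 0 \<le> x \<Longrightarrow> g (c *\<^sub>R x) = c *\<^sub>R g x"
    and nonneg: "\<And>x. 0 \<le> x \<Longrightarrow> 0 \<le> g x"
  obtains T :: "'a \<Rightarrow>\<^sub>L 'b" where "\<And>x. 0 \<le> x \<Longrightarrow> blinfun_apply T x = g x"
proof -
  have mono: "g x \<le> g y" if "0 \<le> x" "x \<le> y" for x y
    using add[of x "y - x"] nonneg[of "y - x"] that by simp
  have "\<exists>K. \<forall>x\<ge>0. norm (g x) \<le> K * norm x"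
  proof (rule ccontr)
    assume "\<nexists>K. \<forall>x\<ge>0. norm (g x) \<le> K * norm x"
    then have "\<forall>n::nat. \<exists>x\<ge>0. 4 ^ n * norm x < norm (g x)" by (meson not_le)
    then obtain x where x: "\<And>n. 0 \<le> x n" "\<And>n. 4 ^ n * norm (x n) < norm (g (x n))" by metis
    have x0: "0 < norm (x n)" for n
    proof -
      have "g 0 = 0" using scale[of 0 0] by simp
      then show ?thesis using x(2)[of n] by auto
    qed
    define y where "y n = (1 / (2 ^ n * norm (x n))) *\<^sub>R x n" for n
    have y: "0 \<le> y n" "norm (y n) = (1/2) ^ n" "2 ^ n < norm (g (y n))" for n
    proof -
      show "0 \<le> y n" using x by (simp add: y_def scaleR_nonneg_nonneg)
      show "norm (y n) = (1/2) ^ n" using x0[of n] by (simp add: y_def power_one_over divide_simps)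
      have "norm (g (y n)) = norm (g (x n)) / (2 ^ n * norm (x n))"
        using x(1)[of n] scale[of "1 / (2 ^ n * norm (x n))" "x n"] x0[of n] by (simp add: y_def)
      also have "\<dots> > 4 ^ n * norm (x n) / (2 ^ n * norm (x n))"
        using x(2) x0[of n] by (intro divide_strict_right_mono) auto
      also have "4 ^ n * norm (x n) / (2 ^ n * norm (x n)) = (2::real) ^ n"
        using x0[of n] power_mult_distrib[of 2 "2::real" n] by simp
      finally show "2 ^ n < norm (g (y n))" .
    qed
    have sum: "summable y"
      by (rule summable_norm_cancel) (simp add: y summable_geometric)
    have "(2::real) ^ n < norm (g (suminf y))" for n
      using y(3)[of n] norm_mono_pos[OF nonneg[OF y(1)] mono[OF y(1) le_suminf_lattice[OF sum y(1)]], of n]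
      by linarith
    then show False
      using real_arch_pow[of 2 "norm (g (suminf y))"] by (auto simp: not_less dest: less_asym)
  qed
  then obtain K where K: "\<And>x. 0 \<le> x \<Longrightarrow> norm (g x) \<le> K * norm x" by blast
  define G where "G x = g (pprt x) - g (pprt (- x))" for x
  \<comment> \<open>The value does not depend on how a vector is written as a difference of positive
    ones, which is what makes the extension additive.\<close>
  have G: "G (a - b) = g a - g b" if "0 \<le> a" "0 \<le> b" for a b
  proof -
    have "pprt (a - b) + b = a + pprt (- (a - b))"
      using pprt_minus_pprt[of "a - b"] by (simp add: algebra_simps)
    then have "g (pprt (a - b)) + g b = g a + g (pprt (- (a - b)))"
      using add[of "pprt (a - b)" b] add[of a "pprt (- (a - b))"] that by simp
    then show ?thesis by (simp add: G_def algebra_simps)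
  qed
  have Gp: "G x = g x" if "0 \<le> x" for x
    using G[of x 0] scale[of 0 0] that by simp
  have Gadd: "G (x + y) = G x + G y" for x y
  proof -
    have "x + y = (pprt x + pprt y) - (pprt (- x) + pprt (- y))"
      using pprt_minus_pprt[of x] pprt_minus_pprt[of y] by (simp add: algebra_simps)
    then have "G (x + y) = g (pprt x + pprt y) - g (pprt (- x) + pprt (- y))"
      using G[of "pprt x + pprt y" "pprt (- x) + pprt (- y)"] by simp
    then show ?thesis by (simp add: add G_def)
  qed
  have Gminus: "G (- x) = - G x" for x by (simp add: G_def)
  have Gpos: "G (c *\<^sub>R x) = c *\<^sub>R G x" if "0 \<le> c" for c x
    using that pprt_scaleR[of c "- x"] by (simp add: G_def pprt_scaleR scale scaleR_right_diff_distrib)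
  have Gscale: "G (c *\<^sub>R x) = c *\<^sub>R G x" for c x
  proof (cases "0 \<le> c")
    case False
    then have "G ((- c) *\<^sub>R x) = (- c) *\<^sub>R G x" by (intro Gpos) auto
    then show ?thesis using Gminus[of "c *\<^sub>R x"] by simp
  qed (rule Gpos)
  have "bounded_linear G"
  proof (rule bounded_linear_intro)
    fix x
    have "norm (G x) \<le> norm (g (pprt x)) + norm (g (pprt (- x)))"
      unfolding G_def by (rule norm_triangle_ineq4)
    also have "\<dots> \<le> K * norm (pprt x) + K * norm (pprt (- x))"
      by (intro add_mono K) auto
    also have "\<dots> \<le> \<bar>K\<bar> * norm x + \<bar>K\<bar> * norm x"
      using norm_pprt_le[of x] norm_pprt_le[of "- x"]
      by (intro add_mono) (auto intro!: mult_mono)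
    finally show "norm (G x) \<le> norm x * (2 * \<bar>K\<bar>)" by (simp add: algebra_simps)
  qed (use Gadd Gscale in auto)
  then show ?thesis using that[of "Blinfun G"] Gp by (simp add: bounded_linear_Blinfun_apply)
qed

section \<open>Uniform boundedness and the weak topology\<close>

lemma blinfun_norming_vector:
  fixes T :: "'a::real_normed_vector \<Rightarrow>\<^sub>L 'b::real_normed_vector"
  assumes "0 < r" "c < norm T" "0 \<le> c"
  obtains x where "norm x = r" "r * c < norm (T x)"
proof -
  have "\<not> (\<forall>x. norm (T x) \<le> c * norm x)"
    using norm_blinfun_bound[of c T] assms by auto
  then obtain x where x: "c * norm x < norm (T x)" by (auto simp: not_le)
  then have "x \<noteq> 0" by (auto simp: blinfun.zero_right)
  then have "norm ((r / norm x) *\<^sub>R x) = r" "r * c < norm (T ((r / norm x) *\<^sub>R x))"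
    using x assms by (auto simp: blinfun.scaleR_right field_simps)
  then show ?thesis by (rule that)
qed

text \<open>Sokal's proof: of \<open>x + \<xi>\<close> and \<open>x - \<xi>\<close> one has an image under \<open>T\<close> at least as large as \<open>T \<xi>\<close>.\<close>

theorem uniform_boundedness:
  fixes F :: "('a::banach \<Rightarrow>\<^sub>L 'b::real_normed_vector) set"
  assumes pw: "\<And>x. bounded ((\<lambda>T. blinfun_apply T x) ` F)"
  shows "bounded F"
proof (rule ccontr)
  assume "\<not> bounded F"
  then have "\<forall>n::nat. \<exists>T\<in>F. 4 ^ n < norm T" by (auto simp: bounded_iff not_le)
  then obtain T where T: "\<And>n. T n \<in> F" "\<And>n::nat. 4 ^ n < norm (T n)" by metis
  have "\<exists>\<xi>. norm \<xi> = (1/3) ^ n \<and> (1/3) ^ n * (2/3 * norm (T n)) < norm (T n \<xi>)" for n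
  proof -
    have "0 < norm (T n)" using T(2)[of n] by (rule order_less_trans[rotated]) simp
    then show ?thesis using blinfun_norming_vector[of "(1/3) ^ n" "2/3 * norm (T n)" "T n"] by auto
  qed
  then obtain \<xi> where \<xi>: "\<And>n. norm (\<xi> n) = (1/3) ^ n"
    "\<And>n. (1/3) ^ n * (2/3 * norm (T n)) < norm (T n (\<xi> n))" by metis
  define x where "x = rec_nat 0 (\<lambda>n y. if norm (T n (\<xi> n)) \<le> norm (T n (y + \<xi> n)) then y + \<xi> n else y - \<xi> n)"
  have x0: "x 0 = 0" by (simp add: x_def)
  have xS: "x (Suc n) = (if norm (T n (\<xi> n)) \<le> norm (T n (x n + \<xi> n)) then x n + \<xi> n else x n - \<xi> n)" for n
    by (simp add: x_def)
  have big: "norm (T n (\<xi> n)) \<le> norm (T n (x (Suc n)))" for n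
  proof -
    have "2 *\<^sub>R T n (\<xi> n) = T n (x n + \<xi> n) - T n (x n - \<xi> n)"
      by (simp add: blinfun.add_right blinfun.diff_right scaleR_2)
    then have "2 * norm (T n (\<xi> n)) \<le> norm (T n (x n + \<xi> n)) + norm (T n (x n - \<xi> n))"
      using norm_triangle_ineq4[of "T n (x n + \<xi> n)" "T n (x n - \<xi> n)"]
      by (metis norm_scaleR abs_numeral)
    then show ?thesis by (auto simp: xS)
  qed
  define d where "d k = x (Suc k) - x k" for k
  have d: "norm (d k) = (1/3) ^ k" for k using \<xi>(1)[of k] by (simp add: d_def xS)
  have sum: "summable d" by (rule summable_norm_cancel) (simp add: d summable_geometric)
  have xd: "x n = (\<Sum>k<n. d k)" for n by (simp add: d_def sum_lessThan_telescope x0)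
  define z where "z = suminf d"
  have tail: "norm (z - x (Suc n)) \<le> (1/3) ^ n / 2" for n
  proof -
    have "norm (z - x (Suc n)) = norm (\<Sum>k. d (k + Suc n))"
      using suminf_minus_initial_segment[OF sum, of "Suc n"] by (simp add: z_def xd)
    also have "\<dots> \<le> (\<Sum>k. norm (d (k + Suc n)))"
      by (rule summable_norm) (use summable_geometric[of "1/3::real"] in \<open>simp add: d power_add summable_mult2\<close>)
    also have "\<dots> = (\<Sum>k. (1/3) ^ k) * (1/3) ^ Suc n"
      by (subst suminf_mult2) (auto simp: d power_add summable_geometric intro!: suminf_cong)
    also have "\<dots> = (1/3) ^ n / 2" by (simp add: suminf_geometric)
    finally show ?thesis .
  qed
  obtain B where B: "\<And>n. norm (T n z) \<le> B"
    using pw[of z] T(1) unfolding bounded_iff by blast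
  \<comment> \<open>The n-th step makes the image larger than \<open>2/3\<close> of
    \<open>(1/3) ^ n * norm (T n)\<close>; all later steps together undo at most half of that
    quantity, and \<open>2/3 - 1/2 = 1/6\<close>.\<close>
  have "(4/3) ^ n \<le> 6 * B" for n
  proof -
    have "norm (T n (z - x (Suc n))) \<le> ((1/3) ^ n * norm (T n)) / 2"
      using norm_blinfun[of "T n" "z - x (Suc n)"] mult_left_mono[OF tail[of n] norm_ge_zero[of "T n"]]
      by (simp add: mult.commute)
    moreover have "norm (T n (x (Suc n))) \<le> norm (T n z) + norm (T n (z - x (Suc n)))"
      using norm_triangle_ineq4[of "T n z" "T n (z - x (Suc n))"] by (simp add: blinfun.diff_right)
    moreover have "(1/3) ^ n * 4 ^ n \<le> (1/3) ^ n * norm (T n)" using T(2)[of n] by simp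
    ultimately have "(1/3) ^ n * 4 ^ n / 6 \<le> B"
      using B[of n] \<xi>(2)[of n] big[of n] by linarith
    then show ?thesis by (simp add: power_mult_distrib[symmetric])
  qed
  then show False using real_arch_pow[of "4/3" "6 * B"] by (auto simp: not_le[symmetric])
qed

lemma norming_functional:
  fixes x :: "'a::real_normed_vector"
  obtains f :: "'a \<Rightarrow>\<^sub>L real" where "norm f \<le> 1" "blinfun_apply f x = norm x"
proof -
  have "sublinear (norm :: 'a \<Rightarrow> real)" by (auto simp: sublinear_def norm_triangle_ineq)
  then obtain f where f: "linear f" "\<And>y. f y \<le> norm y" "f x = norm x"
    using hahn_banach_sublinear[of norm x] by blast
  have abs: "\<bar>f y\<bar> \<le> norm y" for y
    using f(2)[of y] f(2)[of "- y"] linear_neg[OF f(1), of y] by auto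
  have "bounded_linear f"
    by (rule bounded_linear_intro[of _ 1]) (use abs f(1) in \<open>auto simp: linear_add linear_scale\<close>)
  then have "blinfun_apply (Blinfun f) = f" by (rule bounded_linear_Blinfun_apply)
  then show ?thesis using that[of "Blinfun f"] f(3) norm_blinfun_bound[of 1 "Blinfun f"] abs by simp
qed

text \<open>Uniform boundedness is applied to the evaluations at points of \<open>A\<close>. They
  act on the dual, which is complete even if \<open>'a\<close> is not, and norming functionals turn
  bounds on evaluations into bounds on norms.\<close>

lemma bounded_if_weakly_bounded:
  fixes A :: "'a::real_normed_vector set"
  assumes "\<And>f :: 'a \<Rightarrow>\<^sub>L real. bounded (f ` A)"
  shows "bounded A"
proof -
  define J where "J x = Blinfun (\<lambda>f :: 'a \<Rightarrow>\<^sub>L real. f x)" for x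
  have J: "J x f = f x" for x f
    unfolding J_def by (subst bounded_linear_Blinfun_apply) (auto intro: blinfun.bounded_linear_left)
  have "bounded (J ` A)"
    by (rule uniform_boundedness) (use assms in \<open>auto simp: image_image J\<close>)
  then obtain B where B: "\<And>x. x \<in> A \<Longrightarrow> norm (J x) \<le> B" by (auto simp: bounded_iff)
  have "norm x \<le> B" if "x \<in> A" for x
  proof -
    obtain f :: "'a \<Rightarrow>\<^sub>L real" where f: "norm f \<le> 1" "f x = norm x" by (rule norming_functional)
    have "norm x = norm (J x f)" using f by (simp add: J)
    also have "\<dots> \<le> norm (J x) * norm f" by (rule norm_blinfun)
    also have "\<dots> \<le> norm (J x) * 1" using f by (intro mult_left_mono) auto
    finally show ?thesis using B[OF that] by simp
  qed
  then show ?thesis by (auto simp: bounded_iff)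
qed

section \<open>Relatively weakly compact sets\<close>

lemma topspace_weak_topology [simp]: "topspace weak_topology = UNIV"
  by (simp add: weak_topology_def topspace_pullback_topology)

lemma continuous_map_weak_topology: "continuous_map weak_topology euclidean (blinfun_apply f)"
  for f :: "'a::real_normed_vector \<Rightarrow>\<^sub>L real"
proof -
  have "continuous_map weak_topology euclidean (\<lambda>x (f :: 'a \<Rightarrow>\<^sub>L real). f x)"
    unfolding weak_topology_def using continuous_map_pullback[OF continuous_map_id]
    by (simp add: o_def id_def)
  then have "continuous_map weak_topology (product_topology (\<lambda>_. euclidean) UNIV) (\<lambda>x (f :: 'a \<Rightarrow>\<^sub>L real). f x)"
    by (simp add: euclidean_product_topology)
  then show ?thesis by (simp add: continuous_map_componentwise_UNIV)
qed

lemma Hausdorff_space_weak_topology: "Hausdorff_space (weak_topology :: 'a::real_normed_vector topology)"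
  unfolding Hausdorff_space_def
proof (intro allI impI, elim conjE)
  fix x y :: 'a assume "x \<noteq> y"
  obtain f :: "'a \<Rightarrow>\<^sub>L real" where f: "f (x - y) = norm (x - y)" by (rule norming_functional)
  then have "f x \<noteq> f y" using \<open>x \<noteq> y\<close> by (auto simp: blinfun.diff_right)
  then obtain U V where UV: "open U" "open V" "f x \<in> U" "f y \<in> V" "U \<inter> V = {}"
    using hausdorff[of "f x" "f y"] by auto
  have op: "openin weak_topology (f -` W)" if "open W" for W
    using openin_continuous_map_preimage[OF continuous_map_weak_topology[of f], of W] that
    by (simp add: vimage_def)
  show "\<exists>U V. openin weak_topology U \<and> openin weak_topology V \<and> x \<in> U \<and> y \<in> V \<and> disjnt U V"
    using UV by (intro exI[of _ "f -` U"] exI[of _ "f -` V"]) (auto simp: op disjnt_def)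
qed

lemma relatively_weakly_compact_bounded:
  assumes "relatively_weakly_compact A" shows "bounded A"
proof (rule bounded_if_weakly_bounded)
  fix f :: "'a \<Rightarrow>\<^sub>L real"
  have "compactin euclidean (f ` (weak_topology closure_of A))"
    using assms image_compactin continuous_map_weak_topology unfolding relatively_weakly_compact_def by blast
  then have "bounded (f ` (weak_topology closure_of A))" by (simp add: compact_imp_bounded)
  then show "bounded (f ` A)"
    by (rule bounded_subset) (simp add: closure_of_subset image_mono)
qed

text \<open>Together with the limit 0 the range is weakly compact, hence closed by the Hausdorff
  property, so it contains the closure of the range.\<close>

lemma relatively_weakly_compact_range:
  assumes "weakly_null x" shows "relatively_weakly_compact (range x)"
proof -
  let ?K = "insert 0 (range x)"
  have K: "compactin weak_topology ?K"
    using assms by (intro compactin_sequence_with_limit) (auto simp: weakly_null_def)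
  have "closedin weak_topology ?K"
    by (rule compactin_imp_closedin[OF Hausdorff_space_weak_topology K])
  then have "weak_topology closure_of (range x) \<subseteq> ?K" by (intro closure_of_minimal) auto
  then show ?thesis
    unfolding relatively_weakly_compact_def by (rule closed_compactin[OF K]) simp
qed

section \<open>The order dual\<close>

lemma nonneg_blinfun_iff: "0 \<le> f \<longleftrightarrow> (\<forall>x\<ge>0. 0 \<le> f x)" for f :: "'a::banach_lattice \<Rightarrow>\<^sub>L real"
  by (simp add: less_eq_blinfun_def)

lemma blinfun_nonneg: "0 \<le> f \<Longrightarrow> 0 \<le> x \<Longrightarrow> 0 \<le> f x" for f :: "'a::banach_lattice \<Rightarrow>\<^sub>L real"
  by (simp add: nonneg_blinfun_iff)

lemma blinfun_le_apply: "f \<le> g \<Longrightarrow> 0 \<le> x \<Longrightarrow> f x \<le> g x" for f g :: "'a::banach_lattice \<Rightarrow>\<^sub>L real"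
  by (simp add: less_eq_blinfun_def)

lemma blinfun_mono_pos:
  fixes f :: "'a::banach_lattice \<Rightarrow>\<^sub>L real"
  assumes "0 \<le> f" "x \<le> y" shows "f x \<le> f y"
  using blinfun_nonneg[OF assms(1), of "y - x"] assms(2) by (simp add: blinfun.diff_right)

lemma blinfun_abs_le:
  fixes f :: "'a::banach_lattice \<Rightarrow>\<^sub>L real"
  assumes "0 \<le> f" shows "\<bar>f x\<bar> \<le> f \<bar>x\<bar>"
  using blinfun_mono_pos[OF assms abs_ge_self, of x] blinfun_mono_pos[OF assms abs_ge_self, of "- x"]
  by (simp add: blinfun.minus_right)

lemma norm_blinfun_mono:
  fixes f g :: "'a::banach_lattice \<Rightarrow>\<^sub>L real"
  assumes "0 \<le> f" "f \<le> g" shows "norm f \<le> norm g"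
proof (rule norm_blinfun_bound)
  fix x
  have "norm (f x) \<le> f \<bar>x\<bar>" using blinfun_abs_le[OF assms(1)] by simp
  also have "\<dots> \<le> g \<bar>x\<bar>" by (rule blinfun_le_apply[OF assms(2)]) simp
  also have "\<dots> \<le> norm g * norm \<bar>x\<bar>" using norm_blinfun[of g "\<bar>x\<bar>"] by simp
  finally show "norm (f x) \<le> norm g * norm x" by simp
qed simp

text \<open>The Riesz-Kantorovich formula for the supremum of \<open>f\<close> and 0. The values on
  the cone determine the functional; that a bounded linear one with these values exists is shown in
  \<open>pos_part_apply\<close>.\<close>

definition pos_part :: "('a::banach_lattice \<Rightarrow>\<^sub>L real) \<Rightarrow> ('a \<Rightarrow>\<^sub>L real)" where
  "pos_part f = (SOME g. \<forall>x\<ge>0. blinfun_apply g x = (SUP y\<in>{0..x}. f y))"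

lemma bdd_above_blinfun_interval: "bdd_above (blinfun_apply f ` {0..x})"
  for f :: "'a::banach_lattice \<Rightarrow>\<^sub>L real"
proof (rule bdd_aboveI2)
  fix y assume "y \<in> {0..x}"
  then have "norm f * norm y \<le> norm f * norm x" by (intro mult_left_mono norm_mono_pos) auto
  then show "f y \<le> norm f * norm x" using norm_blinfun[of f y] by auto
qed

text \<open>Additivity of the suprema on the cone is the Riesz decomposition of
  \<open>{0..x + y}\<close>; boundedness comes with \<open>cone_extension\<close>.\<close>

lemma pos_part_apply:
  assumes "0 \<le> x" shows "pos_part f x = (SUP y\<in>{0..x}. f y)"
proof -
  define S where "S x = (SUP y\<in>{0..x}. blinfun_apply f y)" for x
  have up: "f y \<le> S x" if "0 \<le> y" "y \<le> x" for x y
    unfolding S_def using that by (intro cSUP_upper bdd_above_blinfun_interval) auto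
  have least: "S x \<le> b" if "0 \<le> x" "\<And>y. 0 \<le> y \<Longrightarrow> y \<le> x \<Longrightarrow> f y \<le> b" for x b
    unfolding S_def using that by (intro cSUP_least) auto
  have S0: "S 0 = 0" by (simp add: S_def)
  have Sc: "S (c *\<^sub>R x) \<le> c * S x" if "0 < c" "0 \<le> x" for c x
  proof (rule least)
    fix y assume y: "0 \<le> y" "y \<le> c *\<^sub>R x"
    then have "inverse c *\<^sub>R y \<le> inverse c *\<^sub>R (c *\<^sub>R x)" using that by (intro scaleR_left_mono) auto
    then have "f (inverse c *\<^sub>R y) \<le> S x" using that y by (intro up) (auto simp: scaleR_nonneg_nonneg)
    then show "f y \<le> c * S x" using that by (simp add: blinfun.scaleR_right field_simps)
  qed (use that in \<open>simp add: scaleR_nonneg_nonneg\<close>)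
  obtain g :: "'a \<Rightarrow>\<^sub>L real" where "\<And>x. 0 \<le> x \<Longrightarrow> g x = S x"
  proof (rule cone_extension[of S])
    fix x y :: 'a assume xy: "0 \<le> x" "0 \<le> y"
    show "S (x + y) = S x + S y"
    proof (rule antisym)
      show "S (x + y) \<le> S x + S y"
      proof (rule least)
        fix z assume z: "0 \<le> z" "z \<le> x + y"
        obtain a b where ab: "z = a + b" "0 \<le> a" "a \<le> x" "0 \<le> b" "b \<le> y"
          by (rule riesz_decomposition[OF z xy])
        then show "f z \<le> S x + S y" using up[of a x] up[of b y] by (simp add: blinfun.add_right)
      qed (use xy in simp)
      have "S y \<le> S (x + y) - f a" if a: "0 \<le> a" "a \<le> x" for a
      proof (rule least)
        fix b assume "0 \<le> b" "b \<le> y"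
        then show "f b \<le> S (x + y) - f a"
          using up[of "a + b" "x + y"] a by (simp add: blinfun.add_right add_mono)
      qed (use xy in simp)
      then have "S x \<le> S (x + y) - S y" using xy by (intro least) (auto simp: algebra_simps)
      then show "S x + S y \<le> S (x + y)" by simp
    qed
  next
    fix c :: real and x :: 'a assume cx: "0 \<le> c" "0 \<le> x"
    show "S (c *\<^sub>R x) = c *\<^sub>R S x"
    proof (cases "c = 0")
      case False
      then have "S (inverse c *\<^sub>R c *\<^sub>R x) \<le> inverse c * S (c *\<^sub>R x)"
        using cx by (intro Sc) (auto simp: scaleR_nonneg_nonneg)
      then have "c * S x \<le> S (c *\<^sub>R x)" using False cx by (simp add: field_simps)
      then show ?thesis using Sc[of c x] False cx by simp
    qed (simp add: S0)
  next
    show "0 \<le> S x" if "0 \<le> x" for x using up[of 0 x] that by (simp add: blinfun.zero_right)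
  qed blast
  then have "\<exists>g. \<forall>x\<ge>0. blinfun_apply g x = (SUP y\<in>{0..x}. f y)" unfolding S_def by blast
  then have "\<forall>x\<ge>0. pos_part f x = (SUP y\<in>{0..x}. f y)" unfolding pos_part_def by (rule someI_ex)
  then show ?thesis using assms by blast
qed

lemma pos_part_upper: "0 \<le> y \<Longrightarrow> y \<le> x \<Longrightarrow> f y \<le> pos_part f x"
  for f :: "'a::banach_lattice \<Rightarrow>\<^sub>L real"
  by (subst pos_part_apply) (auto intro!: cSUP_upper bdd_above_blinfun_interval)

lemma pos_part_least:
  fixes f :: "'a::banach_lattice \<Rightarrow>\<^sub>L real"
  assumes "0 \<le> x" "\<And>y. 0 \<le> y \<Longrightarrow> y \<le> x \<Longrightarrow> f y \<le> b" shows "pos_part f x \<le> b"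
  using assms by (subst pos_part_apply) (auto intro!: cSUP_least)

lemma pos_part_approx:
  fixes f :: "'a::banach_lattice \<Rightarrow>\<^sub>L real"
  assumes "0 \<le> x" "0 < e" obtains y where "0 \<le> y" "y \<le> x" "pos_part f x < f y + e"
proof -
  have "\<not> (\<forall>y. 0 \<le> y \<longrightarrow> y \<le> x \<longrightarrow> f y \<le> pos_part f x - e)"
    using pos_part_least[of x f "pos_part f x - e"] assms by auto
  then obtain y where "0 \<le> y" "y \<le> x" "\<not> f y \<le> pos_part f x - e" by blast
  then show ?thesis by (intro that[of y]) auto
qed

lemma pos_part_nonneg: "0 \<le> pos_part f"
  unfolding nonneg_blinfun_iff using pos_part_upper[of 0] by (metis blinfun.zero_right order_refl)

lemma le_pos_part: "f \<le> pos_part f"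
  by (simp add: less_eq_blinfun_def pos_part_upper)

lemma pos_part_le:
  fixes f h :: "'a::banach_lattice \<Rightarrow>\<^sub>L real"
  assumes "f \<le> h" "0 \<le> h" shows "pos_part f \<le> h"
  unfolding less_eq_blinfun_def
  by (auto intro!: pos_part_least intro: order_trans[OF blinfun_le_apply[OF assms(1)] blinfun_mono_pos[OF assms(2)]])

text \<open>For positive functionals this is \<open>f \<and> g = 0\<close>, by the Riesz-Kantorovich formula for the infimum.\<close>

definition perp :: "('a::banach_lattice \<Rightarrow>\<^sub>L real) \<Rightarrow> ('a \<Rightarrow>\<^sub>L real) \<Rightarrow> bool" where
  "perp f g \<longleftrightarrow> (\<forall>x\<ge>0. \<forall>e>0. \<exists>y. 0 \<le> y \<and> y \<le> x \<and> f y < e \<and> g (x - y) < e)"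

lemma perpI:
  assumes "\<And>x e. 0 \<le> x \<Longrightarrow> 0 < e \<Longrightarrow> \<exists>y. 0 \<le> y \<and> y \<le> x \<and> blinfun_apply f y < e \<and> blinfun_apply g (x - y) < e"
  shows "perp f g"
  using assms unfolding perp_def by blast

lemma perpE:
  assumes "perp f g" "0 \<le> x" "0 < e"
  obtains y where "0 \<le> y" "y \<le> x" "blinfun_apply f y < e" "blinfun_apply g (x - y) < e"
  using assms unfolding perp_def by blast

lemma perp_commute:
  assumes "perp f g" shows "perp g f"
proof (rule perpI)
  fix x :: 'a and e :: real assume "0 \<le> x" "0 < e"
  then obtain y where "0 \<le> y" "y \<le> x" "f y < e" "g (x - y) < e" by (rule perpE[OF assms])
  then show "\<exists>y. 0 \<le> y \<and> y \<le> x \<and> g y < e \<and> f (x - y) < e"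
    by (intro exI[of _ "x - y"]) auto
qed

lemma perp_mono:
  assumes "perp f g" "f' \<le> f" "g' \<le> g" shows "perp f' g'"
proof (rule perpI)
  fix x :: 'a and e :: real assume "0 \<le> x" "0 < e"
  then obtain y where "0 \<le> y" "y \<le> x" "f y < e" "g (x - y) < e" by (rule perpE[OF assms(1)])
  then show "\<exists>y. 0 \<le> y \<and> y \<le> x \<and> f' y < e \<and> g' (x - y) < e"
    using blinfun_le_apply[OF assms(2), of y] blinfun_le_apply[OF assms(3), of "x - y"]
    by (intro exI[of _ y]) auto
qed

lemma perp_scaleR:
  assumes "perp f g" "0 \<le> c" shows "perp (c *\<^sub>R f) g"
proof (rule perpI)
  fix x :: 'a and e :: real assume x: "0 \<le> x" and e: "0 < e"
  have e': "0 < e / (c + 1)" "e / (c + 1) \<le> e" "c * (e / (c + 1)) < e"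
    using e assms(2) by (auto simp: field_simps)
  obtain y where y: "0 \<le> y" "y \<le> x" "f y < e / (c + 1)" "g (x - y) < e / (c + 1)"
    by (rule perpE[OF assms(1) x e'(1)])
  have "c * f y \<le> c * (e / (c + 1))" using y assms(2) by (intro mult_left_mono) auto
  then show "\<exists>y. 0 \<le> y \<and> y \<le> x \<and> (c *\<^sub>R f) y < e \<and> g (x - y) < e"
    using y e' by (intro exI[of _ y]) (auto simp: blinfun.scaleR_left)
qed

text \<open>The infimum of the two witnesses works: \<open>f\<close> and \<open>g\<close> only
  decrease, and what is left of \<open>x\<close> is at most the sum of the two remainders, both of
  which \<open>h\<close> hardly sees.\<close>

lemma perp_add:
  assumes "perp f h" "perp g h" "0 \<le> f" "0 \<le> g" "0 \<le> h" shows "perp (f + g) h"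
proof (rule perpI)
  fix x :: 'a and e :: real assume x: "0 \<le> x" and e: "0 < e"
  then have e2: "0 < e / 2" by simp
  obtain y where y: "0 \<le> y" "y \<le> x" "f y < e / 2" "h (x - y) < e / 2"
    by (rule perpE[OF assms(1) x e2])
  obtain z where z: "0 \<le> z" "z \<le> x" "g z < e / 2" "h (x - z) < e / 2"
    by (rule perpE[OF assms(2) x e2])
  have "f (inf y z) \<le> f y" "g (inf y z) \<le> g z" by (intro blinfun_mono_pos assms; simp)+
  moreover have "h (x - inf y z) \<le> h (x - y) + h (x - z)"
  proof -
    have "x - inf y z = sup (x - y) (x - z)" by (simp add: diff_inf_eq_sup add_sup_distrib_left)
    also have "\<dots> \<le> (x - y) + (x - z)"
      using y z by (intro sup_least) (auto simp del: add_diff_eq)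
    finally show ?thesis using blinfun_mono_pos[OF assms(5)] by (metis blinfun.add_right)
  qed
  ultimately show "\<exists>y. 0 \<le> y \<and> y \<le> x \<and> (f + g) y < e \<and> h (x - y) < e"
    using y z by (intro exI[of _ "inf y z"]) (auto simp: blinfun.add_left intro: le_infI1)
qed

lemma perp_sum:
  assumes "finite I" "\<And>i. i \<in> I \<Longrightarrow> perp (f i) h" "\<And>i. i \<in> I \<Longrightarrow> 0 \<le> f i" "0 \<le> h"
  shows "perp (\<Sum>i\<in>I. f i) h \<and> 0 \<le> (\<Sum>i\<in>I. f i)"
  using assms
proof (induction I rule: finite_induct)
  case empty
  have "perp 0 h" by (rule perpI, rule exI) (auto simp: blinfun.zero_right)
  then show ?case by simp
next
  case (insert i I)
  then show ?case
    using perp_add[of "f i" h "\<Sum>i\<in>I. f i"]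
    by (auto simp: nonneg_blinfun_iff blinfun.add_left)
qed

text \<open>If \<open>z\<close> nearly attains the supremum that defines
  \<open>pos_part f x\<close>, then \<open>f\<close> can be neither much above 0 below
  \<open>x - z\<close> nor much below 0 below \<open>z\<close>. So \<open>x - z\<close> is the
  splitting vector.\<close>

lemma perp_pos_part: "perp (pos_part f) (pos_part (- f))"
  for f :: "'a::banach_lattice \<Rightarrow>\<^sub>L real"
proof (rule perpI)
  fix x :: 'a and e :: real assume x: "0 \<le> x" and e: "0 < e"
  then have e2: "0 < e / 2" by simp
  obtain z where z: "0 \<le> z" "z \<le> x" "pos_part f x < f z + e / 2"
    by (rule pos_part_approx[OF x e2])
  have "pos_part f (x - z) \<le> e / 2"
  proof (rule pos_part_least)
    fix w assume "0 \<le> w" "w \<le> x - z"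
    then have "f (w + z) \<le> pos_part f x" using z by (intro pos_part_upper) (auto simp: algebra_simps)
    then show "f w \<le> e / 2" using z by (simp add: blinfun.add_right)
  qed (use z in simp)
  moreover have "pos_part (- f) z \<le> e / 2"
  proof (rule pos_part_least)
    fix w assume w: "0 \<le> w" "w \<le> z"
    have "z - w \<le> x" using w z by (metis diff_left_mono diff_zero order_trans)
    then have "f (z - w) \<le> pos_part f x" using w by (intro pos_part_upper) auto
    then show "(- f) w \<le> e / 2" using z by (simp add: blinfun.diff_right blinfun.minus_left)
  qed (use z in simp)
  ultimately show "\<exists>y. 0 \<le> y \<and> y \<le> x \<and> pos_part f y < e \<and> pos_part (- f) (x - y) < e"
    using z e by (intro exI[of _ "x - z"]) auto
qed

text \<open>Translates an abstract modulus in the dual into evaluations of \<open>f\<close>. The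
  last part returns to \<open>f\<close> itself, the only functional about which weak* convergence
  says anything.\<close>

lemma isLub_modulus:
  fixes f a :: "'a::banach_lattice \<Rightarrow>\<^sub>L real"
  assumes "isLub UNIV {f, - f} a"
  shows isLub_modulus_nonneg: "0 \<le> a"
    and isLub_modulus_abs_le: "\<bar>f x\<bar> \<le> a \<bar>x\<bar>"
    and isLub_modulus_approx: "0 \<le> x \<Longrightarrow> 0 < e \<Longrightarrow> \<exists>v. 0 \<le> v \<and> v \<le> x \<and> a x < 2 * \<bar>f v\<bar> + e"
proof -
  have "isUb UNIV {f, - f} a" by (rule isLub_isUb[OF assms])
  then have a: "f \<le> a" "- f \<le> a" by (auto simp: isUb_def setle_def)
  have a': "f x \<le> a x" "- f x \<le> a x" if "0 \<le> x" for x
    using blinfun_le_apply[OF a(1) that] blinfun_le_apply[OF a(2) that] by (auto simp: blinfun.minus_left)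
  show "0 \<le> a" unfolding nonneg_blinfun_iff
  proof (intro allI impI)
    show "0 \<le> a x" if "0 \<le> x" for x using a'[OF that] by linarith
  qed
  have "f x = f (pprt x) - f (pprt (- x))" by (metis blinfun.diff_right pprt_minus_pprt)
  moreover have "a \<bar>x\<bar> = a (pprt x) + a (pprt (- x))" by (metis blinfun.add_right pprt_plus_pprt)
  ultimately show "\<bar>f x\<bar> \<le> a \<bar>x\<bar>"
    using a'[OF zero_le_pprt, of x] a'[OF zero_le_pprt, of "- x"] by linarith
  show "\<exists>v. 0 \<le> v \<and> v \<le> x \<and> a x < 2 * \<bar>f v\<bar> + e" if x: "0 \<le> x" and e: "0 < e"
  proof -
    \<comment> \<open>The lattice identity for the modulus in terms of the positive part. At a
      nearly optimal \<open>y\<close> it bounds \<open>a x\<close> by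
      \<open>f y - f (x - y) + e\<close>, and one of these two terms carries half; hence the factor
      2.\<close>
    let ?g = "2 *\<^sub>R pos_part f - f"
    have "f \<le> ?g" "- f \<le> ?g"
      using le_pos_part[of f] pos_part_nonneg[of f]
      by (auto simp: less_eq_blinfun_def blinfun.diff_left blinfun.scaleR_left blinfun.minus_left)
    then have "a \<le> ?g" by (intro isLub_le_isUb[OF assms]) (auto simp: isUb_def setle_def)
    then have ax: "a x \<le> 2 * pos_part f x - f x"
      using blinfun_le_apply[of a ?g x] x by (simp add: blinfun.diff_left blinfun.scaleR_left)
    have e2: "0 < e / 2" using e by simp
    obtain y where y: "0 \<le> y" "y \<le> x" "pos_part f x < f y + e / 2" by (rule pos_part_approx[OF x e2])
    have "a x < f y - f (x - y) + e" using ax y by (simp add: blinfun.diff_right)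
    then have "a x < 2 * \<bar>f y\<bar> + e \<or> a x < 2 * \<bar>f (x - y)\<bar> + e" by linarith
    then show ?thesis using y by (metis diff_ge_0_iff_ge diff_left_mono diff_zero)
  qed
qed

text \<open>By a lattice identity \<open>a - pos_part (a - b)\<close> is the infimum of
  \<open>a\<close> and \<open>b\<close>, so it is at most 0. A vector that nearly attains
  \<open>pos_part (a - b) x\<close> then splits \<open>x\<close>.\<close>

lemma isGlb_perp:
  fixes a b :: "'a::banach_lattice \<Rightarrow>\<^sub>L real"
  assumes "isGlb UNIV {a, b} 0" shows "perp a b"
proof (rule perpI)
  fix x :: 'a and e :: real assume x: "0 \<le> x" and e: "0 < e"
  have "isLb UNIV {a, b} 0" by (rule isGlb_isLb[OF assms])
  then have pos: "0 \<le> a" "0 \<le> b" by (auto simp: isLb_def setge_def)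
  let ?q = "a - pos_part (a - b)"
  have "?q \<le> a" "?q \<le> b"
    using le_pos_part[of "a - b"] pos_part_nonneg[of "a - b"]
    by (auto simp: less_eq_blinfun_def blinfun.diff_left algebra_simps)
  then have "?q \<le> 0" by (intro isGlb_le_isLb[OF assms]) (auto simp: isLb_def setge_def)
  then have q: "a x \<le> pos_part (a - b) x"
    using blinfun_le_apply[of ?q 0 x] x by (simp add: blinfun.diff_left)
  obtain z where z: "0 \<le> z" "z \<le> x" "pos_part (a - b) x < (a - b) z + e"
    by (rule pos_part_approx[OF x e])
  have "a (x - z) + b z < e" using q z by (simp add: blinfun.diff_left blinfun.diff_right)
  moreover have "0 \<le> a (x - z)" "0 \<le> b z" using z pos by (auto intro: blinfun_nonneg)
  ultimately show "\<exists>y. 0 \<le> y \<and> y \<le> x \<and> a y < e \<and> b (x - y) < e"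
    using z by (intro exI[of _ "x - z"]) auto
qed

lemma dual_disjoint_if_perp:
  assumes "0 \<le> f" "0 \<le> g" "perp f g" shows "dual_disjoint f g"
proof -
  have lub: "isLub UNIV {h, - h} h" if "0 \<le> h" for h :: "'a \<Rightarrow>\<^sub>L real"
    using that by (auto simp: isLub_def leastP_def isUb_def setle_def setge_def less_eq_blinfun_def
        blinfun.minus_left)
  have "h \<le> 0" if h: "h \<le> f" "h \<le> g" for h unfolding less_eq_blinfun_def
  proof (intro allI impI)
    fix x :: 'a assume x: "0 \<le> x"
    have "h x \<le> 0 + e" if "0 < e" for e
    proof -
      have e2: "0 < e / 2" using that by simp
      obtain y where y: "0 \<le> y" "y \<le> x" "f y < e / 2" "g (x - y) < e / 2"
        by (rule perpE[OF assms(3) x e2])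
      have "h y \<le> f y" "h (x - y) \<le> g (x - y)" using h y by (auto intro: blinfun_le_apply)
      then show ?thesis using y by (simp add: blinfun.diff_right)
    qed
    then show "h x \<le> blinfun_apply 0 x" using field_le_epsilon[of "h x" 0] by simp
  qed
  then have "isGlb UNIV {f, g} 0"
    using assms by (auto simp: isGlb_def greatestP_def isLb_def setge_def setle_def)
  then show ?thesis unfolding dual_disjoint_def using lub assms by blast
qed

text \<open>Domination forces positivity: \<open>f (- x) \<le> p (- x) \<le> 0\<close> on the cone.
  The lemmas that follow only choose a suitable \<open>p\<close>.\<close>

lemma positive_hahn_banach:
  fixes p :: "'a::banach_lattice \<Rightarrow> real"
  assumes p: "sublinear p" and bound: "\<And>x. p x \<le> K * norm x" and neg: "\<And>x. 0 \<le> x \<Longrightarrow> p (- x) \<le> 0"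
  obtains f :: "'a \<Rightarrow>\<^sub>L real" where "0 \<le> f" "\<And>x. f x \<le> p x" "f a = p a"
proof -
  obtain f where f: "linear f" "\<And>y. f y \<le> p y" "f a = p a"
    using hahn_banach_sublinear[OF p, of a] by blast
  have "norm (f x) \<le> norm x * K" for x
    using f(2)[of x] f(2)[of "- x"] bound[of x] bound[of "- x"] linear_neg[OF f(1), of x]
    by (auto simp: mult.commute)
  then have "bounded_linear f"
    by (intro bounded_linear_intro[of _ K]) (use f(1) in \<open>auto simp: linear_add linear_scale\<close>)
  then have eq: "blinfun_apply (Blinfun f) = f" by (rule bounded_linear_Blinfun_apply)
  have "0 \<le> f x" if "0 \<le> x" for x
    using f(2)[of "- x"] neg[OF that] linear_neg[OF f(1), of x] by simp
  then show ?thesis using that[of "Blinfun f"] f by (simp add: eq nonneg_blinfun_iff)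
qed

text \<open>Dominating by \<open>norm (pprt y)\<close> instead of \<open>norm y\<close> gives the
  same value at positive \<open>x\<close> and vanishes on negative vectors.\<close>

lemma positive_norming_functional:
  fixes x :: "'a::banach_lattice"
  assumes "0 \<le> x"
  obtains f :: "'a \<Rightarrow>\<^sub>L real" where "0 \<le> f" "norm f \<le> 1" "f x = norm x"
proof -
  have "sublinear (\<lambda>y::'a. norm (pprt y))"
    unfolding sublinear_def
    by (auto simp: pprt_scaleR intro: order_trans[OF norm_mono_pos[OF zero_le_pprt pprt_add_le] norm_triangle_ineq])
  then obtain f :: "'a \<Rightarrow>\<^sub>L real" where f: "0 \<le> f" "\<And>y. f y \<le> norm (pprt y)" "f x = norm (pprt x)"
    by (rule positive_hahn_banach[of _ 1]) (auto simp: norm_pprt_le)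
  have "\<bar>f y\<bar> \<le> norm y" for y
    using f(2)[of y] f(2)[of "- y"] norm_pprt_le[of y] norm_pprt_le[of "- y"]
    by (simp add: blinfun.minus_right)
  then have "norm f \<le> 1" by (intro norm_blinfun_bound) auto
  then show ?thesis using that[of f] f assms by simp
qed

text \<open>The equation is extremal, since \<open>h\<close> lies between 0 and \<open>g\<close>: it
  means that \<open>h\<close> agrees with \<open>g\<close> on \<open>pprt z\<close> and vanishes on
  \<open>pprt (- z)\<close>.\<close>

lemma functional_component:
  fixes g :: "'a::banach_lattice \<Rightarrow>\<^sub>L real"
  assumes g: "0 \<le> g"
  obtains h where "0 \<le> h" "h \<le> g" "blinfun_apply h z = g (pprt z)"
proof -
  have "sublinear (\<lambda>y. g (pprt y))"
    unfolding sublinear_def using blinfun_mono_pos[OF g pprt_add_le]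
    by (auto simp: pprt_scaleR blinfun.scaleR_right blinfun.add_right)
  moreover have "g (pprt y) \<le> norm g * norm y" for y
    using norm_blinfun[of g "pprt y"] mult_left_mono[OF norm_pprt_le[of y] norm_ge_zero[of g]]
    by simp
  ultimately obtain h :: "'a \<Rightarrow>\<^sub>L real"
    where h: "0 \<le> h" "\<And>y. h y \<le> g (pprt y)" "h z = g (pprt z)"
    by (rule positive_hahn_banach) (auto simp: blinfun.zero_right)
  have "h \<le> g" unfolding less_eq_blinfun_def using h(2) by (metis pprt_eq_id)
  then show ?thesis using that h by blast
qed

section \<open>Weak and weak* convergence tested on positive elements\<close>

lemma blinfun_eq_diff_nonneg:
  fixes f :: "'a::banach_lattice \<Rightarrow>\<^sub>L real"
  obtains g h where "0 \<le> g" "0 \<le> h" "f = g - h"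
proof (rule that[of "pos_part f" "pos_part f - f"])
  show "0 \<le> pos_part f - f" using le_pos_part[of f] by (simp add: less_eq_blinfun_def blinfun.diff_left)
  show "f = pos_part f - (pos_part f - f)" by simp
qed (rule pos_part_nonneg)

lemma weakly_nullI:
  fixes x :: "nat \<Rightarrow> 'a::banach_lattice"
  assumes "\<And>f :: 'a \<Rightarrow>\<^sub>L real. 0 \<le> f \<Longrightarrow> (\<lambda>n. blinfun_apply f (x n)) \<longlonglongrightarrow> 0"
  shows "weakly_null x"
  unfolding weakly_null_iff
proof
  fix f :: "'a \<Rightarrow>\<^sub>L real"
  obtain g h where gh: "0 \<le> g" "0 \<le> h" "f = g - h" by (rule blinfun_eq_diff_nonneg)
  show "(\<lambda>n. f (x n)) \<longlonglongrightarrow> 0"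
    using tendsto_diff[OF assms[OF gh(1)] assms[OF gh(2)]] gh(3) by (simp add: blinfun.diff_left)
qed

lemma weakly_null_dominated:
  fixes x y :: "nat \<Rightarrow> 'a::banach_lattice"
  assumes "weakly_null y" "\<And>n. \<bar>x n\<bar> \<le> y n" shows "weakly_null x"
proof (rule weakly_nullI)
  fix f :: "'a \<Rightarrow>\<^sub>L real" assume f: "0 \<le> f"
  show "(\<lambda>n. f (x n)) \<longlonglongrightarrow> 0"
  proof (rule tendsto_0_le[where K = 1])
    show "(\<lambda>n. f (y n)) \<longlonglongrightarrow> 0" using assms(1) by (simp add: weakly_null_iff)
    show "\<forall>\<^sub>F n in sequentially. norm (f (x n)) \<le> norm (f (y n)) * 1"
      using order_trans[OF order_trans[OF blinfun_abs_le[OF f] blinfun_mono_pos[OF f assms(2)]] abs_ge_self]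
      by (intro always_eventually) auto
  qed
qed

lemma weakly_null_add:
  assumes "weakly_null x" "weakly_null y" shows "weakly_null (\<lambda>n. x n + y n)"
  using assms unfolding weakly_null_iff by (auto simp: blinfun.add_right intro: tendsto_add_zero)

lemma weakly_null_minus:
  fixes x :: "nat \<Rightarrow> 'a::real_normed_vector"
  assumes "weakly_null x" shows "weakly_null (\<lambda>n. - x n)"
  unfolding weakly_null_iff blinfun.minus_right
proof
  fix f :: "'a \<Rightarrow>\<^sub>L real"
  show "(\<lambda>n. - f (x n)) \<longlonglongrightarrow> 0"
    using tendsto_minus[of "\<lambda>n. f (x n)" 0] assms unfolding weakly_null_iff by simp
qed

lemma weakly_null_subseq:
  fixes x :: "nat \<Rightarrow> 'a::real_normed_vector"
  assumes "weakly_null x" "strict_mono r" shows "weakly_null (\<lambda>n. x (r n))"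
  unfolding weakly_null_iff
proof
  fix f :: "'a \<Rightarrow>\<^sub>L real"
  show "(\<lambda>n. f (x (r n))) \<longlonglongrightarrow> 0"
    using LIMSEQ_subseq_LIMSEQ[OF _ assms(2), of "\<lambda>n. f (x n)" 0] assms(1)
    unfolding weakly_null_iff by (simp add: o_def)
qed

lemma weak_star_nullI:
  fixes f :: "nat \<Rightarrow> 'a::banach_lattice \<Rightarrow>\<^sub>L real"
  assumes "\<And>x. 0 \<le> x \<Longrightarrow> (\<lambda>n. blinfun_apply (f n) x) \<longlonglongrightarrow> 0"
  shows "weak_star_null f"
  unfolding weak_star_null_iff
proof
  fix x
  have "f n x = f n (pprt x) - f n (pprt (- x))" for n
    by (metis blinfun.diff_right pprt_minus_pprt)
  then show "(\<lambda>n. f n x) \<longlonglongrightarrow> 0"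
    using tendsto_diff[OF assms[OF zero_le_pprt, of x] assms[OF zero_le_pprt, of "- x"]] by simp
qed

section \<open>Disjoint weakly null sequences\<close>

lemma inf_eq_0_sum:
  fixes x :: "'i \<Rightarrow> 'a::banach_lattice"
  assumes "finite I" "\<And>i. i \<in> I \<Longrightarrow> 0 \<le> x i" "\<And>i. i \<in> I \<Longrightarrow> inf (x i) z = 0" "0 \<le> z"
  shows "inf (\<Sum>i\<in>I. x i) z = 0"
  using assms
proof (induction I rule: finite_induct)
  case empty
  then show ?case by (simp add: inf_absorb1)
next
  case (insert i I)
  then have "inf (x i + (\<Sum>i\<in>I. x i)) z = 0" by (intro inf_eq_0_add) (auto intro: sum_nonneg)
  then show ?case using insert by simp
qed

text \<open>Partial sums are disjoint by finite additivity. Adding both remainders to each of them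
  raises their infimum by exactly that amount, which tends to 0.\<close>

lemma inf_suminf_eq_0:
  fixes x y :: "nat \<Rightarrow> 'a::banach_lattice"
  assumes "summable x" "summable y" "\<And>n. 0 \<le> x n" "\<And>n. 0 \<le> y n" "\<And>n m. inf (x n) (y m) = 0"
  shows "inf (suminf x) (suminf y) = 0"
proof (rule antisym)
  let ?P = "\<lambda>N. \<Sum>n<N. x n" and ?Q = "\<lambda>N. \<Sum>n<N. y n"
  have le: "inf (suminf x) (suminf y) \<le> (suminf x - ?P N) + (suminf y - ?Q N)" for N
  proof -
    have "inf (?Q N) (x n) = 0" for n
      using assms by (intro inf_eq_0_sum) (auto simp: inf_commute)
    then have PQ: "inf (?P N) (?Q N) = 0"
      using assms by (intro inf_eq_0_sum) (auto simp: inf_commute sum_nonneg)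
    let ?r = "suminf x - ?P N" and ?s = "suminf y - ?Q N"
    have "0 \<le> ?r" "0 \<le> ?s" using sum_le_suminf_lattice assms by auto
    then have "suminf x \<le> ?P N + (?r + ?s)" "suminf y \<le> ?Q N + (?r + ?s)" by (auto simp: algebra_simps)
    then have "inf (suminf x) (suminf y) \<le> inf (?P N + (?r + ?s)) (?Q N + (?r + ?s))" by (rule inf_mono)
    also have "\<dots> = ?r + ?s" by (simp only: add_inf_distrib_right[symmetric] PQ add_0)
    finally show ?thesis .
  qed
  have "(\<lambda>N. (suminf x - ?P N) + (suminf y - ?Q N) - inf (suminf x) (suminf y))
      \<longlonglongrightarrow> (suminf x - suminf x) + (suminf y - suminf y) - inf (suminf x) (suminf y)"
    by (intro tendsto_intros summable_LIMSEQ assms)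
  then have "0 \<le> (suminf x - suminf x) + (suminf y - suminf y) - inf (suminf x) (suminf y)"
    by (rule LIMSEQ_nonneg_lattice) (use le in \<open>simp only: diff_ge_0_iff_ge\<close>)
  then show "inf (suminf x) (suminf y) \<le> 0"
    by (simp only: diff_self add_0 diff_0 neg_0_le_iff_le)
  show "0 \<le> inf (suminf x) (suminf y)"
    using sum_le_suminf_lattice[of x 0] sum_le_suminf_lattice[of y 0] assms by simp
qed

text \<open>The component of \<open>f\<close> on \<open>w\<close>, where \<open>w\<close> combines all \<open>x\<^sub>n\<close>, sees only the positive parts.\<close>

lemma disjoint_seq_component:
  fixes f :: "'a::banach_lattice \<Rightarrow>\<^sub>L real"
  assumes "disjoint_seq x" "0 \<le> f"
  obtains h where "0 \<le> h" "h \<le> f" "\<And>n. blinfun_apply h (x n) = f (pprt (x n))"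
proof -
  \<comment> \<open>Weights that make all the scaled positive and negative parts summable;
    \<open>1 +\<close> keeps the denominator away from 0 when \<open>x n = 0\<close>.\<close>
  define c where "c n = (1/2) ^ n / (1 + norm (x n))" for n
  have c: "0 < c n" for n by (simp add: c_def add_pos_nonneg)
  define p where "p n = c n *\<^sub>R pprt (x n)" for n
  define q where "q n = c n *\<^sub>R pprt (- x n)" for n
  have pq: "0 \<le> p n" "0 \<le> q n" for n
    using less_imp_le[OF c, of n] by (simp_all add: p_def q_def scaleR_nonneg_nonneg)
  have "norm (c n *\<^sub>R y) \<le> (1/2) ^ n" if "norm y \<le> norm (x n)" for n and y :: 'a
  proof -
    have "norm (c n *\<^sub>R y) = (1/2) ^ n * (norm y / (1 + norm (x n)))" by (simp add: c_def)
    also have "\<dots> \<le> (1/2) ^ n * 1"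
      using that by (intro mult_left_mono) (auto simp: divide_le_eq add_pos_nonneg)
    finally show ?thesis by simp
  qed
  then have "norm (p n) \<le> (1/2) ^ n" "norm (q n) \<le> (1/2) ^ n" for n
    using norm_pprt_le[of "x n"] norm_pprt_le[of "- x n"] by (auto simp: p_def q_def)
  then have sum: "summable p" "summable q"
    by (auto intro!: summable_comparison_test'[OF summable_geometric[of "1/2::real"]])
  have "inf (pprt (x n)) (pprt (- x m)) = 0" for n m
  proof (cases "n = m")
    case False
    then have 0: "inf \<bar>x n\<bar> \<bar>x m\<bar> = 0" using assms(1) by (simp add: disjoint_seq_def)
    show ?thesis
      using pprt_le_abs[of "x n"] pprt_le_abs[of "- x m"] by (intro inf_eq_0_mono[OF 0]) simp_all
  qed (simp add: pprt_inf_pprt)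
  then have "inf (p n) (pprt (- x m)) = 0" for n m
    unfolding p_def using less_imp_le[OF c, of n] by (intro inf_eq_0_scaleR) auto
  then have "inf (q m) (p n) = 0" for n m
    unfolding q_def using less_imp_le[OF c, of m] pq
    by (intro inf_eq_0_scaleR) (auto simp: inf_commute)
  then have "inf (p n) (q m) = 0" for n m by (simp add: inf_commute)
  then have inf0: "inf (suminf p) (suminf q) = 0" using sum pq by (intro inf_suminf_eq_0)
  define w where "w = suminf p - suminf q"
  \<comment> \<open>Two disjoint positive vectors are the positive and the negative part of their
    difference.\<close>
  have "pprt w = suminf p + sup (- suminf q) (- suminf p)"
    by (simp add: w_def pprt_def add_sup_distrib_left)
  also have "\<dots> = suminf p" using inf0 by (simp only: neg_inf_eq_sup[symmetric] inf_commute[of "suminf q"]) simp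
  finally have w: "pprt w = suminf p" .
  obtain h where h: "0 \<le> h" "h \<le> f" "h w = f (pprt w)" by (rule functional_component[OF assms(2)])
  have P0: "0 \<le> suminf p" "0 \<le> suminf q"
    using sum_le_suminf_lattice[of _ 0] sum pq by auto
  then have "h (suminf p) \<le> f (suminf p)" "0 \<le> h (suminf q)"
    using h by (auto intro: blinfun_le_apply blinfun_nonneg)
  then have hP: "h (suminf p) = f (suminf p)" and hQ: "h (suminf q) = 0"
    using h(3) w by (auto simp: w_def blinfun.diff_right)
  have "h (x n) = f (pprt (x n))" for n
  proof -
    have "p n \<le> suminf p" "q n \<le> suminf q" using sum pq by (auto intro: le_suminf_lattice)
    \<comment> \<open>The positive functional \<open>f - h\<close> vanishes at the whole sum, hence
      at each term below it; likewise \<open>h\<close> on the negative parts.\<close>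
    have "(f - h) (p n) \<le> (f - h) (suminf p)"
      by (rule blinfun_mono_pos) (use h \<open>p n \<le> suminf p\<close> in \<open>auto simp: less_eq_blinfun_def blinfun.diff_left\<close>)
    then have "h (p n) = f (p n)"
      using hP blinfun_le_apply[OF h(2) pq(1), of n] by (simp add: blinfun.diff_left)
    moreover have "h (q n) = 0"
      using hQ blinfun_mono_pos[OF h(1) \<open>q n \<le> suminf q\<close>] blinfun_nonneg[OF h(1) pq(2), of n] by simp
    ultimately have "h (pprt (x n)) = f (pprt (x n))" "h (pprt (- x n)) = 0"
      using c[of n] by (auto simp: p_def q_def blinfun.scaleR_right)
    then show ?thesis by (metis blinfun.diff_right diff_zero pprt_minus_pprt)
  qed
  then show ?thesis using that h by blast
qed

text \<open>Taking positive parts does not preserve weak convergence in general. Here disjointness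
  lets a single functional \<open>h\<close> compute \<open>f\<close> on all positive parts
  simultaneously.\<close>

lemma weakly_null_pprt_disjoint:
  fixes x :: "nat \<Rightarrow> 'a::banach_lattice"
  assumes "disjoint_seq x" "weakly_null x" shows "weakly_null (\<lambda>n. pprt (x n))"
proof (rule weakly_nullI)
  fix f :: "'a \<Rightarrow>\<^sub>L real" assume "0 \<le> f"
  then obtain h :: "'a \<Rightarrow>\<^sub>L real" where h: "\<And>n. h (x n) = f (pprt (x n))"
    by (rule disjoint_seq_component[OF assms(1)]) blast
  have "(\<lambda>n. h (x n)) \<longlonglongrightarrow> 0" using assms(2) by (simp add: weakly_null_iff)
  then show "(\<lambda>n. f (pprt (x n))) \<longlonglongrightarrow> 0" by (simp add: h)
qed

lemma weakly_null_abs_disjoint: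
  fixes x :: "nat \<Rightarrow> 'a::banach_lattice"
  assumes "disjoint_seq x" "weakly_null x" shows "weakly_null (\<lambda>n. \<bar>x n\<bar>)"
proof -
  have "disjoint_seq (\<lambda>n. - x n)" using assms(1) by (simp add: disjoint_seq_def)
  then have "weakly_null (\<lambda>n. pprt (x n) + pprt (- x n))"
    using assms by (intro weakly_null_add weakly_null_pprt_disjoint weakly_null_minus)
  then show ?thesis by (simp add: pprt_plus_pprt)
qed

section \<open>Disjointification\<close>

lemma diagonal_subsequence:
  assumes "\<And>k i. \<exists>N. \<forall>n\<ge>N. P k i n"
  obtains s :: "nat \<Rightarrow> nat" where "strict_mono s" "\<And>i k. i < k \<Longrightarrow> P k (s i) (s k)"
proof -
  obtain N where N: "\<And>k i n. N k i \<le> n \<Longrightarrow> P k i n" using assms by metis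
  \<comment> \<open>Only finitely many thresholds, those with \<open>i \<le> s k\<close>, concern
    the next index, and their sum exceeds each of them.\<close>
  define s where "s = rec_nat 0 (\<lambda>k m. Suc m + (\<Sum>i\<le>m. N (Suc k) i))"
  have sS: "s (Suc k) = Suc (s k) + (\<Sum>i\<le>s k. N (Suc k) i)" for k by (simp add: s_def)
  have mono: "strict_mono s" by (auto simp: strict_mono_Suc_iff sS)
  have "P k (s i) (s k)" if ik: "i < k" for i k
  proof -
    obtain l where l: "k = Suc l" using ik by (cases k) auto
    have "s i \<le> s l" using ik l strict_mono_less_eq[OF mono] by simp
    then have "N k (s i) \<le> (\<Sum>i\<le>s l. N k i)" by (intro member_le_sum) auto
    then show ?thesis by (intro N) (simp add: l sS)
  qed
  then show ?thesis using that mono by blast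
qed

lemma sum_geometric_half_le: "0 \<le> d \<Longrightarrow> (\<Sum>k<n. d / 2 ^ Suc k) \<le> (d::real)"
proof -
  assume "0 \<le> d"
  have "(\<Sum>k<n. d / 2 ^ Suc k) = d - d / 2 ^ n" by (induction n) (auto simp: field_simps)
  then show ?thesis using \<open>0 \<le> d\<close> by simp
qed

text \<open>The hypothesis has the form of the thresholds \<open>\<eta> k\<close> used below: they
  cancel the factor \<open>2 ^ k / d\<close> of the disjointification and the number of summands,
  with \<open>+ 1\<close> for the case \<open>k = 0\<close>.\<close>

lemma weighted_sum_le:
  fixes c :: "nat \<Rightarrow> real"
  assumes d: "0 < d" and e: "0 \<le> e" and c: "\<And>i. i < k \<Longrightarrow> c i \<le> e * d / 2 ^ k / (real k + 1)"
  shows "(2 ^ k / d) * (\<Sum>i<k. c i) \<le> e"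
proof -
  let ?b = "e * d / 2 ^ k"
  have b: "0 \<le> ?b" using d e by simp
  have "(\<Sum>i<k. c i) \<le> (\<Sum>i<k. ?b / (real k + 1))" by (intro sum_mono c) simp
  also have "\<dots> = ?b * (real k / (real k + 1))" by simp
  also have "\<dots> \<le> ?b * 1" using b by (intro mult_left_mono) auto
  finally have "(2 ^ k / d) * (\<Sum>i<k. c i) \<le> (2 ^ k / d) * ?b" using d by (intro mult_left_mono) auto
  then show ?thesis using d by simp
qed

lemma pos_part_mono:
  fixes f g :: "'a::banach_lattice \<Rightarrow>\<^sub>L real"
  assumes "f \<le> g" shows "pos_part f \<le> pos_part g"
  by (rule pos_part_le[OF order_trans[OF assms le_pos_part] pos_part_nonneg])

text \<open>For \<open>i < k\<close> subtracting \<open>A k\<close> times the predecessors gives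
  \<open>g k \<le> pos_part (f k - A k *\<^sub>R f i)\<close>. The multiple of \<open>F\<close>
  subtracted from \<open>f i\<close> contains \<open>f k\<close> with coefficient
  \<open>d / 2 ^ k = 1 / A k\<close>, so \<open>g i\<close> is at most a multiple of the opposite
  part. This match dictates \<open>A k\<close>; the loss \<open>2 * d * norm x\<close> comes from
  \<open>norm F \<le> 2\<close>.\<close>

lemma disjointify_functionals:
  fixes f :: "nat \<Rightarrow> 'a::banach_lattice \<Rightarrow>\<^sub>L real"
  assumes pos: "\<And>n. 0 \<le> f n" and bound: "\<And>n. norm (f n) \<le> 1" and d: "0 < d"
  obtains g where "\<And>n. 0 \<le> g n" "\<And>n. norm (g n) \<le> 1" "\<And>i j. i \<noteq> j \<Longrightarrow> perp (g i) (g j)"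
    "\<And>n x. 0 \<le> x \<Longrightarrow> f n x - (2 ^ n / d) * (\<Sum>i<n. f i x) - 2 * d * norm x \<le> blinfun_apply (g n) x"
proof -
  define F where "F = (\<Sum>i. (1/2) ^ i *\<^sub>R f i)"
  have norm_le: "norm ((1/2) ^ i *\<^sub>R f i) \<le> (1/2) ^ i" for i
    using bound[of i] mult_left_mono[of "norm (f i)" 1 "(1/2) ^ i"] by simp
  have summ_norm: "summable (\<lambda>i. norm ((1/2) ^ i *\<^sub>R f i))"
    using norm_le by (intro summable_comparison_test'[OF summable_geometric[of "1/2::real"], of 0]) auto
  have summ: "summable (\<lambda>i. (1/2) ^ i *\<^sub>R f i)" by (rule summable_norm_cancel[OF summ_norm])
  have "norm F \<le> (\<Sum>i. norm ((1/2) ^ i *\<^sub>R f i))" unfolding F_def by (rule summable_norm[OF summ_norm])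
  also have "\<dots> \<le> (\<Sum>i. (1/2::real) ^ i)" by (intro suminf_le norm_le summ_norm summable_geometric) simp
  also have "\<dots> = 2" by (simp add: suminf_geometric)
  finally have F2: "norm F \<le> 2" .
  have Fx: "(\<lambda>i. (1/2) ^ i * f i x) sums F x" for x
    using bounded_linear.sums[OF blinfun.bounded_linear_left[of x] summable_sums[OF summ]]
    by (simp add: F_def blinfun.scaleR_left)
  have Fge: "(1/2) ^ i * f i x \<le> F x" "0 \<le> F x" if "0 \<le> x" for i x
  proof -
    have nn: "0 \<le> (1/2) ^ n * f n x" for n using blinfun_nonneg[OF pos that] by simp
    show "(1/2) ^ i * f i x \<le> F x" using nn
      sum_le_suminf[OF sums_summable[OF Fx], of "{i}" x] Fx[of x] by (simp add: sums_iff)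
    then show "0 \<le> F x" using nn[of i] by linarith
  qed
  define A where "A n = 2 ^ n / d" for n :: nat
  have A: "0 < A n" for n using d by (simp add: A_def)
  define g where "g n = pos_part (f n - A n *\<^sub>R (\<Sum>i<n. f i) - d *\<^sub>R F)" for n
  have form: "(f n - A n *\<^sub>R (\<Sum>i<n. f i) - d *\<^sub>R F) x = f n x - A n * (\<Sum>i<n. f i x) - d * F x" for n x
    by (simp add: blinfun.diff_left blinfun.scaleR_left blinfun.sum_left)
  have sum0: "0 \<le> (\<Sum>i<n. f i x)" if "0 \<le> x" for n x
    using blinfun_nonneg[OF pos that] by (simp add: sum_nonneg)
  have g_le: "g n \<le> f n" for n
    unfolding g_def
  proof (rule pos_part_le)
    show "f n - A n *\<^sub>R (\<Sum>i<n. f i) - d *\<^sub>R F \<le> f n"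
      unfolding less_eq_blinfun_def form
      using sum0 Fge(2) less_imp_le[OF A] less_imp_le[OF d] by (simp add: add_nonneg_nonneg algebra_simps)
  qed (rule pos)
  have lt: "perp (g i) (g k)" if "i < k" for i k
  proof -
    define a where "a = f k - A k *\<^sub>R f i"
    have "f k - A k *\<^sub>R (\<Sum>i<k. f i) - d *\<^sub>R F \<le> a"
      unfolding less_eq_blinfun_def form
    proof (intro allI impI)
      fix x :: 'a assume x: "0 \<le> x"
      have "f i x \<le> (\<Sum>i<k. f i x)"
        using that blinfun_nonneg[OF pos x] by (intro member_le_sum) auto
      then have "A k * f i x \<le> A k * (\<Sum>i<k. f i x)" using A[of k] by simp
      then show "f k x - A k * (\<Sum>i<k. f i x) - d * F x \<le> a x"
        using Fge(2)[OF x] d by (simp add: a_def blinfun.diff_left blinfun.scaleR_left) (smt (verit) mult_nonneg_nonneg)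
    qed
    then have gk: "g k \<le> pos_part a" unfolding g_def by (rule pos_part_mono)
    have "f i - A i *\<^sub>R (\<Sum>j<i. f j) - d *\<^sub>R F \<le> (1 / A k) *\<^sub>R pos_part (- a)"
      unfolding less_eq_blinfun_def form
    proof (intro allI impI)
      fix x :: 'a assume x: "0 \<le> x"
      have "(- a) x \<le> pos_part (- a) x" using x by (intro pos_part_upper) auto
      then have "(1 / A k) * (A k * f i x - f k x) \<le> (1 / A k) * pos_part (- a) x"
        using A[of k] by (intro mult_left_mono) (auto simp: a_def blinfun.diff_left blinfun.scaleR_left blinfun.minus_left)
      moreover have "(1 / A k) * (A k * f i x - f k x) = f i x - (1 / A k) * f k x"
        using A[of k] by (simp add: right_diff_distrib)
      moreover have "1 / A k = d * (1/2) ^ k" by (simp add: A_def power_one_over)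
      ultimately have "f i x - d * ((1/2) ^ k * f k x) \<le> (1 / A k) * pos_part (- a) x" by simp
      moreover have "d * ((1/2) ^ k * f k x) \<le> d * F x" using Fge(1)[OF x] d by simp
      moreover have "0 \<le> A i * (\<Sum>j<i. f j x)" using sum0[OF x] A[of i] by simp
      ultimately show "f i x - A i * (\<Sum>j<i. f j x) - d * F x \<le> ((1 / A k) *\<^sub>R pos_part (- a)) x"
        by (simp add: blinfun.scaleR_left)
    qed
    moreover have "0 \<le> (1 / A k) *\<^sub>R pos_part (- a)"
      using A[of k] by (auto simp: nonneg_blinfun_iff blinfun.scaleR_left intro!: divide_nonneg_pos blinfun_nonneg[OF pos_part_nonneg])
    ultimately have gi: "g i \<le> (1 / A k) *\<^sub>R pos_part (- a)" unfolding g_def by (rule pos_part_le)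
    have "perp ((1 / A k) *\<^sub>R pos_part (- a)) (pos_part a)"
      using A[of k] by (intro perp_scaleR perp_commute[OF perp_pos_part]) auto
    then show ?thesis using gi gk by (rule perp_mono)
  qed
  show ?thesis
  proof (rule that[of g])
    show g0: "0 \<le> g n" for n by (simp add: g_def pos_part_nonneg)
    show "norm (g n) \<le> 1" for n by (rule order_trans[OF norm_blinfun_mono[OF g0 g_le] bound])
    show "perp (g i) (g j)" if "i \<noteq> j" for i j
      using lt[of i j] perp_commute[OF lt[of j i]] that by linarith
    show "f n x - (2 ^ n / d) * (\<Sum>i<n. f i x) - 2 * d * norm x \<le> g n x" if "0 \<le> x" for n x
    proof -
      have "F x \<le> 2 * norm x"
        using norm_blinfun[of F x] mult_right_mono[OF F2 norm_ge_zero[of x]] by simp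
      then have "d * F x \<le> d * (2 * norm x)" using d by simp
      moreover have "f n x - A n * (\<Sum>i<n. f i x) - d * F x \<le> g n x"
        unfolding g_def form[symmetric] using that by (intro pos_part_upper) auto
      ultimately show ?thesis by (simp add: A_def)
    qed
  qed
qed

lemma weakly_null_bounded:
  fixes x :: "nat \<Rightarrow> 'a::real_normed_vector"
  assumes "weakly_null x"
  obtains C where "0 < C" "\<And>n. norm (x n) \<le> C"
proof -
  have "bounded (range x)"
    by (rule relatively_weakly_compact_bounded[OF relatively_weakly_compact_range[OF assms]])
  then show ?thesis using that unfolding bounded_pos by blast
qed

text \<open>Norming functionals of earlier vectors are small at later ones by weak nullity, so along
  a sparse subsequence disjointification costs little.\<close>

lemma disjoint_functionals_of_weakly_null:
  fixes y :: "nat \<Rightarrow> 'a::banach_lattice"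
  assumes y: "\<And>n. 0 \<le> y n" "weakly_null y" and e: "0 < e" "\<And>n. e \<le> norm (y n)"
  obtains s :: "nat \<Rightarrow> nat" and g where "strict_mono s" "\<And>k. 0 \<le> g k" "\<And>k. norm (g k) \<le> 1"
    "\<And>i j. i \<noteq> j \<Longrightarrow> perp (g i) (g j)" "\<And>k. e / 2 \<le> blinfun_apply (g k) (y (s k))"
proof -
  have "\<exists>f :: 'a \<Rightarrow>\<^sub>L real. 0 \<le> f \<and> norm f \<le> 1 \<and> blinfun_apply f (y n) = norm (y n)" for n
    using positive_norming_functional[OF y(1)] by blast
  then obtain f :: "nat \<Rightarrow> 'a \<Rightarrow>\<^sub>L real"
    where f: "\<And>n. 0 \<le> f n" "\<And>n. norm (f n) \<le> 1" "\<And>n. f n (y n) = norm (y n)" by metis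
  obtain C where C: "0 < C" "\<And>n. norm (y n) \<le> C" using weakly_null_bounded[OF y(2)] by blast
  \<comment> \<open>Then \<open>2 * d * C = e / 4\<close>; the predecessors cost at most another
    \<open>e / 4\<close>, which leaves \<open>e / 2\<close>.\<close>
  define d where "d = e / (8 * C)"
  have d: "0 < d" using e C by (simp add: d_def)
  define \<eta> where "\<eta> k = (e / 4) * d / 2 ^ k / (real k + 1)" for k :: nat
  have \<eta>: "0 < \<eta> k" for k using e d by (simp add: \<eta>_def)
  have "\<exists>N. \<forall>n\<ge>N. f i (y n) \<le> \<eta> k" for k i
  proof -
    have "(\<lambda>n. f i (y n)) \<longlonglongrightarrow> 0" using y(2) by (simp add: weakly_null_iff)
    then have "\<forall>\<^sub>F n in sequentially. f i (y n) < \<eta> k" using \<eta>[of k] by (rule order_tendstoD(2))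
    then show ?thesis by (auto simp: eventually_sequentially intro: less_imp_le)
  qed
  then obtain s where s: "strict_mono s" "\<And>i k. i < k \<Longrightarrow> f (s i) (y (s k)) \<le> \<eta> k"
    by (rule diagonal_subsequence[where P = "\<lambda>k i n. f i (y n) \<le> \<eta> k"]) blast
  obtain g where g: "\<And>n. 0 \<le> g n" "\<And>n. norm (g n) \<le> 1" "\<And>i j. i \<noteq> j \<Longrightarrow> perp (g i) (g j)"
    "\<And>n x. 0 \<le> x \<Longrightarrow> f (s n) x - (2 ^ n / d) * (\<Sum>i<n. f (s i) x) - 2 * d * norm x \<le> blinfun_apply (g n) x"
    by (rule disjointify_functionals[of "\<lambda>n. f (s n)" d, OF f(1) f(2) d]) (rule that; assumption)
  have "e / 2 \<le> g k (y (s k))" for k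
  proof -
    have 1: "(2 ^ k / d) * (\<Sum>i<k. f (s i) (y (s k))) \<le> e / 4"
      by (rule weighted_sum_le[OF d]) (use e s(2) in \<open>simp_all add: \<eta>_def\<close>)
    have "2 * d * norm (y (s k)) \<le> 2 * d * C" using C d by simp
    also have "\<dots> = e / 4" using C by (simp add: d_def)
    finally show ?thesis using g(4)[OF y(1), of k "s k"] 1 f(3)[of "s k"] e(2)[of "s k"] by linarith
  qed
  then show ?thesis using that[of s g] s g by blast
qed

text \<open>The truncation of \<open>disjointify_functionals\<close>, now in the lattice itself. The
  lower bound is phrased through arbitrary positive \<open>g\<close> in the dual unit ball, so that
  each \<open>x n\<close> can later be tested with its own functional.\<close>

lemma disjointify_vectors:
  fixes y :: "nat \<Rightarrow> 'a::banach_lattice"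
  assumes pos: "\<And>n. 0 \<le> y n" and bound: "\<And>n. norm (y n) \<le> C" and d: "0 < d"
  obtains x where "\<And>n. 0 \<le> x n" "\<And>n. x n \<le> y n" "\<And>i j. i \<noteq> j \<Longrightarrow> inf (x i) (x j) = 0"
    "\<And>n g. 0 \<le> g \<Longrightarrow> norm g \<le> 1 \<Longrightarrow>
       blinfun_apply g (y n) - (2 ^ n / d) * (\<Sum>i<n. g (y i)) - 2 * C * d \<le> g (x n)"
proof -
  define Y where "Y = (\<Sum>i. (1/2) ^ i *\<^sub>R y i)"
  have nn: "0 \<le> (1/2) ^ i *\<^sub>R y i" for i using pos by (simp add: scaleR_nonneg_nonneg)
  have norm_le: "norm ((1/2) ^ i *\<^sub>R y i) \<le> C * (1/2) ^ i" for i
    using bound[of i] mult_left_mono[of "norm (y i)" C "(1/2) ^ i"] by (simp add: mult.commute)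
  have geo: "summable (\<lambda>i. C * (1/2) ^ i)" by (intro summable_mult summable_geometric) simp
  have summ_norm: "summable (\<lambda>i. norm ((1/2) ^ i *\<^sub>R y i))"
    using norm_le by (intro summable_comparison_test'[OF geo, of 0]) auto
  have summ: "summable (\<lambda>i. (1/2) ^ i *\<^sub>R y i)" by (rule summable_norm_cancel[OF summ_norm])
  have "norm Y \<le> (\<Sum>i. norm ((1/2) ^ i *\<^sub>R y i))" unfolding Y_def by (rule summable_norm[OF summ_norm])
  also have "\<dots> \<le> (\<Sum>i. C * (1/2) ^ i)" by (intro suminf_le norm_le summ_norm geo)
  also have "\<dots> = 2 * C" by (simp add: suminf_mult suminf_geometric)
  finally have Y2: "norm Y \<le> 2 * C" .
  have Yge: "(1/2) ^ i *\<^sub>R y i \<le> Y" for i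
    unfolding Y_def using le_suminf_lattice[OF summ nn] .
  have Y0: "0 \<le> Y" using order_trans[OF nn Yge] .
  define A where "A n = 2 ^ n / d" for n :: nat
  have A: "0 < A n" for n using d by (simp add: A_def)
  define x where "x n = pprt (y n - A n *\<^sub>R (\<Sum>i<n. y i) - d *\<^sub>R Y)" for n
  have dY: "0 \<le> d *\<^sub>R Y" using d Y0 by (simp add: scaleR_nonneg_nonneg)
  have AS: "0 \<le> A n *\<^sub>R (\<Sum>i<n. y i)" for n
    using A[of n] pos by (intro scaleR_nonneg_nonneg sum_nonneg) auto
  have x_le: "x n \<le> y n" for n
  proof -
    have "y n - A n *\<^sub>R (\<Sum>i<n. y i) - d *\<^sub>R Y \<le> y n"
      using add_nonneg_nonneg[OF AS[of n] dY] by (simp add: algebra_simps)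
    then have "x n \<le> pprt (y n)" unfolding x_def by (rule pprt_mono)
    then show ?thesis using pos by simp
  qed
  have lt: "inf (x i) (x k) = 0" if "i < k" for i k
  proof -
    define a where "a = y k - A k *\<^sub>R y i"
    have "y i \<le> (\<Sum>i<k. y i)" using that pos sum_mono2[of "{..<k}" "{i}" y] by simp
    then have "A k *\<^sub>R y i \<le> A k *\<^sub>R (\<Sum>i<k. y i)" using A[of k] by (intro scaleR_left_mono) auto
    then have "y k - A k *\<^sub>R (\<Sum>i<k. y i) - d *\<^sub>R Y \<le> a - 0"
      unfolding a_def using dY by (intro diff_mono) auto
    then have xk: "x k \<le> pprt a" unfolding x_def by (intro pprt_mono) simp
    have "d *\<^sub>R ((1/2) ^ k *\<^sub>R y k) \<le> d *\<^sub>R Y" using Yge d by (intro scaleR_left_mono) auto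
    then have "y i - A i *\<^sub>R (\<Sum>j<i. y j) - d *\<^sub>R Y \<le> y i - 0 - d *\<^sub>R ((1/2) ^ k *\<^sub>R y k)"
      using AS[of i] by (intro diff_mono) auto
    also have "\<dots> = (1 / A k) *\<^sub>R (- a)"
      using A[of k] d by (simp add: a_def A_def power_one_over scaleR_diff_right)
    finally have "x i \<le> pprt ((1 / A k) *\<^sub>R (- a))" unfolding x_def by (rule pprt_mono)
    also have "\<dots> = (1 / A k) *\<^sub>R pprt (- a)" using A[of k] by (intro pprt_scaleR) auto
    finally have xi: "x i \<le> (1 / A k) *\<^sub>R pprt (- a)" .
    have "inf ((1 / A k) *\<^sub>R pprt (- a)) (pprt a) = 0"
      using A[of k] pprt_inf_pprt[of a] by (intro inf_eq_0_scaleR) (simp_all add: inf_commute)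
    then show ?thesis by (rule inf_eq_0_mono) (use xi xk in \<open>simp_all add: x_def\<close>)
  qed
  show ?thesis
  proof (rule that[of x])
    show "0 \<le> x n" for n by (simp add: x_def)
    show "inf (x i) (x j) = 0" if "i \<noteq> j" for i j
      using lt[of i j] lt[of j i] that inf_commute[of "x i" "x j"] by (cases i j rule: linorder_cases) auto
    fix n and g :: "'a \<Rightarrow>\<^sub>L real" assume g: "0 \<le> g" "norm g \<le> 1"
    have "g Y \<le> norm g * norm Y" using norm_blinfun[of g Y] by simp
    also have "\<dots> \<le> 1 * (2 * C)" using g Y2 by (intro mult_mono) auto
    finally have "d * g Y \<le> d * (2 * C)" using d by simp
    moreover have "g (y n - A n *\<^sub>R (\<Sum>i<n. y i) - d *\<^sub>R Y) \<le> g (x n)"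
      unfolding x_def by (intro blinfun_mono_pos g) (simp only: pprt_def sup_ge1)
    then have "g (y n) - A n * (\<Sum>i<n. g (y i)) - d * g Y \<le> g (x n)"
      by (simp only: blinfun.diff_right blinfun.scaleR_right blinfun.sum_right real_scaleR_def)
    ultimately show "g (y n) - (2 ^ n / d) * (\<Sum>i<n. g (y i)) - 2 * C * d \<le> g (x n)"
      by (simp add: A_def algebra_simps)
  qed (rule x_le)
qed

section \<open>Splitting an order interval along disjoint functionals\<close>

text \<open>Induction: split \<open>u\<close> between \<open>\<psi> j\<close> and the sum of the
  others, give \<open>y\<close> to \<open>j\<close> and distribute \<open>u - y\<close> with half
  the tolerance; the other half pays for removing \<open>y\<close>.\<close>

lemma finite_splitting:
  fixes \<psi> :: "'i \<Rightarrow> 'a::banach_lattice \<Rightarrow>\<^sub>L real"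
  assumes "finite I" "\<And>i. i \<in> I \<Longrightarrow> 0 \<le> \<psi> i" "\<And>i j. i \<in> I \<Longrightarrow> j \<in> I \<Longrightarrow> i \<noteq> j \<Longrightarrow> perp (\<psi> i) (\<psi> j)"
    "0 \<le> u" "0 < \<eta>"
  shows "\<exists>v. (\<forall>i\<in>I. 0 \<le> v i \<and> \<psi> i (u - v i) \<le> \<eta>) \<and> (\<Sum>i\<in>I. v i) \<le> u"
  using assms
proof (induction I arbitrary: u \<eta> rule: finite_induct)
  case empty
  then show ?case by simp
next
  case (insert j I)
  have S: "perp (\<Sum>i\<in>I. \<psi> i) (\<psi> j) \<and> 0 \<le> (\<Sum>i\<in>I. \<psi> i)"
    using insert.prems insert.hyps by (intro perp_sum) auto
  have h: "0 < \<eta> / 2" using insert.prems by simp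
  obtain y where y: "0 \<le> y" "y \<le> u" "(\<Sum>i\<in>I. \<psi> i) y < \<eta> / 2" "\<psi> j (u - y) < \<eta> / 2"
    using perpE[OF conjunct1[OF S] \<open>0 \<le> u\<close> h] by blast
  have "\<exists>v. (\<forall>i\<in>I. 0 \<le> v i \<and> \<psi> i (u - y - v i) \<le> \<eta> / 2) \<and> (\<Sum>i\<in>I. v i) \<le> u - y"
    using insert.prems y h by (intro insert.IH) auto
  then obtain v where v: "\<And>i. i \<in> I \<Longrightarrow> 0 \<le> v i" "\<And>i. i \<in> I \<Longrightarrow> \<psi> i (u - y - v i) \<le> \<eta> / 2"
    "(\<Sum>i\<in>I. v i) \<le> u - y" by blast
  have "\<psi> i (u - v i) \<le> \<eta>" if "i \<in> I" for i
  proof -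
    have "\<psi> i y \<le> (\<Sum>i\<in>I. \<psi> i y)"
      using that insert.hyps blinfun_nonneg[OF insert.prems(1) y(1)] by (intro member_le_sum) auto
    then have "\<psi> i y < \<eta> / 2" using y(3) by (simp add: blinfun.sum_left)
    then show ?thesis using v(2)[OF that] by (simp add: blinfun.diff_right)
  qed
  moreover have "(\<Sum>i\<in>insert j I. (v(j := y)) i) = y + (\<Sum>i\<in>I. v i)"
    using insert.hyps by (auto intro!: sum.cong)
  moreover have "i \<noteq> j" if "i \<in> I" for i using that insert.hyps by auto
  ultimately show ?case
    using y v insert.prems by (intro exI[of _ "v(j := y)"]) (auto simp: algebra_simps)
qed

text \<open>Pigeonhole: split \<open>u\<close> among more than \<open>C / \<eta>\<close>
  functionals. Since the pieces sum to at most \<open>u\<close>, every \<open>\<psi> m\<close> with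
  \<open>m\<close> in \<open>M\<close> is at most \<open>\<eta>\<close> on some piece, and one piece
  serves infinitely many \<open>m\<close>.\<close>

lemma splitting_step:
  fixes \<psi> :: "nat \<Rightarrow> 'a::banach_lattice \<Rightarrow>\<^sub>L real"
  assumes pos: "\<And>n. 0 \<le> \<psi> n" and dj: "\<And>i j. i \<noteq> j \<Longrightarrow> perp (\<psi> i) (\<psi> j)"
    and u: "0 \<le> u" and M: "infinite M" "\<And>m. m \<in> M \<Longrightarrow> \<psi> m u \<le> C" and \<eta>: "0 < \<eta>"
  shows "\<exists>i v. i \<in> M \<and> 0 \<le> v \<and> v \<le> u \<and> \<psi> i (u - v) \<le> \<eta> \<and> infinite {m \<in> M. i < m \<and> \<psi> m v \<le> \<eta>}"
proof -
  obtain N where N: "C < real N * \<eta>" using reals_Archimedean3[OF \<eta>] by blast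
  obtain I where I: "finite I" "card I = N" "I \<subseteq> M" using infinite_arbitrarily_large[OF M(1)] by blast
  obtain v where v: "\<And>i. i \<in> I \<Longrightarrow> 0 \<le> v i" "\<And>i. i \<in> I \<Longrightarrow> \<psi> i (u - v i) \<le> \<eta>"
    "(\<Sum>i\<in>I. v i) \<le> u"
    using finite_splitting[of I \<psi> u \<eta>, OF I(1) pos _ u \<eta>] dj by metis
  have "\<exists>i\<in>I. \<psi> m (v i) \<le> \<eta>" if "m \<in> M" for m
  proof (rule ccontr)
    assume "\<not> (\<exists>i\<in>I. \<psi> m (v i) \<le> \<eta>)"
    then have "(\<Sum>i\<in>I. \<eta>) \<le> (\<Sum>i\<in>I. \<psi> m (v i))" by (intro sum_mono) (auto simp: not_le intro: less_imp_le)
    also have "\<dots> \<le> \<psi> m u" using blinfun_mono_pos[OF pos v(3)] by (simp add: blinfun.sum_right)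
    also have "\<dots> \<le> C" by (rule M(2)[OF that])
    finally show False using N I by simp
  qed
  then have "M \<subseteq> (\<Union>i\<in>I. {m \<in> M. \<psi> m (v i) \<le> \<eta>})" by blast
  then have "infinite (\<Union>i\<in>I. {m \<in> M. \<psi> m (v i) \<le> \<eta>})" using M(1) finite_subset by blast
  then obtain i where i: "i \<in> I" "infinite {m \<in> M. \<psi> m (v i) \<le> \<eta>}" using I(1) by blast
  have "{m \<in> M. \<psi> m (v i) \<le> \<eta>} \<subseteq> {m \<in> M. i < m \<and> \<psi> m (v i) \<le> \<eta>} \<union> {..i}" by auto
  then have "infinite {m \<in> M. i < m \<and> \<psi> m (v i) \<le> \<eta>}"
    using i(2) by (meson finite_Un finite_atMost finite_subset)
  moreover have "v i \<le> u"
    using order_trans[OF sum_mono2[of I "{i}" v] v(3)] v(1) i(1) I(1) by simp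
  ultimately show ?thesis using i I v by (intro exI[of _ i] exI[of _ "v i"]) auto
qed

text \<open>Each round peels off a vector for one functional and keeps a disjoint remainder on which
  infinitely many later functionals are still large. The state is the remainder together with the
  index set of these functionals.\<close>

lemma splitting_sequence:
  fixes \<psi> :: "nat \<Rightarrow> 'a::banach_lattice \<Rightarrow>\<^sub>L real"
  assumes pos: "\<And>n. 0 \<le> \<psi> n" and dj: "\<And>i j. i \<noteq> j \<Longrightarrow> perp (\<psi> i) (\<psi> j)"
    and u: "0 \<le> u" and c: "\<And>n. c \<le> \<psi> n u" and C: "\<And>n. \<psi> n u \<le> C" and d: "0 < d"
  obtains r x w where "strict_mono r" "w 0 = u" "\<And>k. 0 \<le> x k" "\<And>k. 0 \<le> w k"
    "\<And>k. x k + w (Suc k) \<le> w k" "\<And>k. inf (x k) (w (Suc k)) = 0"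
    "\<And>k. c - 2 * d \<le> \<psi> (r k) (x k)" "\<And>k. \<psi> (r k) (w (Suc k)) \<le> d / 2 ^ Suc k"
    "\<And>j k. k < j \<Longrightarrow> \<psi> (r j) (x k) \<le> d / 2 ^ Suc k"
proof -
  \<comment> \<open>The lower bound after \<open>k\<close> rounds: round \<open>k\<close> costs
    twice \<open>d / 2 ^ Suc k\<close>, in total less than \<open>2 * d\<close>.\<close>
  define b where "b k = c - 2 * d * (1 - 1 / 2 ^ k)" for k :: nat
  define P where "P k s \<longleftrightarrow> 0 \<le> fst s \<and> fst s \<le> u \<and> infinite (snd s) \<and> (\<forall>m\<in>snd s. b k \<le> \<psi> m (fst s))"
    for k :: nat and s :: "'a \<times> nat set"
  define R where "R k s t i x \<longleftrightarrow> i \<in> snd s \<and> (\<forall>m\<in>snd t. i < m) \<and> snd t \<subseteq> snd s \<and> 0 \<le> x \<and>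
      x + fst t \<le> fst s \<and> inf x (fst t) = 0 \<and> b (Suc k) \<le> \<psi> i x \<and> \<psi> i (fst t) \<le> d / 2 ^ Suc k \<and>
      (\<forall>m\<in>snd t. \<psi> m x \<le> d / 2 ^ Suc k)"
    for k :: nat and s t :: "'a \<times> nat set" and i x
  have "\<exists>s. P 0 s" by (intro exI[of _ "(u, UNIV)"]) (simp add: P_def b_def u c)
  moreover have "\<exists>t. P (Suc k) t \<and> (\<exists>i x. R k s t i x)" if "P k s" for k s
  proof -
    obtain z M where s: "s = (z, M)" by (cases s)
    have z: "0 \<le> z" "z \<le> u" "infinite M" "\<And>m. m \<in> M \<Longrightarrow> b k \<le> \<psi> m z" using that by (auto simp: P_def s)
    define \<eta> where "\<eta> = d / 2 ^ Suc k"
    have \<eta>: "0 < \<eta>" "b (Suc k) = b k - 2 * \<eta>" using d by (auto simp: \<eta>_def b_def field_simps)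
    have zC: "\<psi> m z \<le> C" if "m \<in> M" for m by (rule order_trans[OF blinfun_mono_pos[OF pos z(2)] C])
    obtain i v where v: "i \<in> M" "0 \<le> v" "v \<le> z" "\<psi> i (z - v) \<le> \<eta>"
        "infinite {m \<in> M. i < m \<and> \<psi> m v \<le> \<eta>}"
      using splitting_step[of \<psi> z M C \<eta>, OF pos dj z(1) z(3) zC \<eta>(1)] by auto
    \<comment> \<open>\<open>v\<close> and \<open>z - v\<close> need not be disjoint, but the parts
      of their difference \<open>v + v - z\<close> are, and lie below them. The selected functional
      loses twice \<open>\<psi> i (z - v)\<close> at \<open>x\<close>, the remaining ones lose twice
      \<open>\<psi> m v\<close> at \<open>z'\<close>.\<close>
    define x where "x = pprt (v + v - z)"
    define z' where "z' = pprt (- (v + v - z))"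
    define M' where "M' = {m \<in> M. i < m \<and> \<psi> m v \<le> \<eta>}"
    have "v + v - z \<le> v" using v by (simp add: algebra_simps)
    then have xv: "x \<le> v" using v by (simp add: x_def pprt_def)
    have zv: "- (v + v - z) \<le> z - v" using v by simp
    then have z'v: "z' \<le> z - v" using v by (simp add: z'_def pprt_def)
    have sum: "x + z' \<le> z"
      using add_mono[OF xv z'v] by simp
    have x: "0 \<le> x" "v + v - z \<le> x" and z': "0 \<le> z'" "- (v + v - z) \<le> z'"
      by (simp_all add: x_def z'_def pprt_def)
    have "b (Suc k) \<le> \<psi> i x"
      using blinfun_mono_pos[OF pos x(2), of i] v(4) z(4)[OF v(1)] \<eta>(2)
      by (simp add: blinfun.diff_right blinfun.add_right)
    moreover have "\<psi> i z' \<le> \<eta>" using blinfun_mono_pos[OF pos z'v, of i] v(4) by linarith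
    moreover have "\<psi> m x \<le> \<eta>" if "m \<in> M'" for m
      using blinfun_mono_pos[OF pos xv, of m] that by (simp add: M'_def)
    moreover have "b (Suc k) \<le> \<psi> m z'" if "m \<in> M'" for m
      using blinfun_mono_pos[OF pos z'(2), of m] that z(4)[of m] \<eta>(2)
      by (simp add: M'_def blinfun.diff_right blinfun.add_right blinfun.minus_right)
    moreover have "inf x z' = 0" unfolding x_def z'_def by (rule pprt_inf_pprt)
    moreover have "z' \<le> u" by (rule order_trans[OF add_increasing[OF x(1) order_refl] order_trans[OF sum z(2)]])
    ultimately have "P (Suc k) (z', M') \<and> R k s (z', M') i x"
      using v x z' sum by (auto simp: P_def R_def s M'_def \<eta>_def)
    then show ?thesis by blast
  qed
  ultimately obtain f where "\<forall>n. P n (f n) \<and> (\<exists>i x. R n (f n) (f (Suc n)) i x)"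
    using dependent_nat_choice[of P "\<lambda>k s t. \<exists>i x. R k s t i x"] by blast
  then obtain f where P: "\<And>n. P n (f n)" and "\<forall>n. \<exists>i x. R n (f n) (f (Suc n)) i x" by blast
  then obtain r x where R: "\<And>n. R n (f n) (f (Suc n)) (r n) (x n)" by metis
  have sub: "snd (f j) \<subseteq> snd (f k)" if "k \<le> j" for j k
    using that by (rule lift_Suc_antimono_le[rotated]) (use R in \<open>auto simp: R_def\<close>)
  have r: "r n \<in> snd (f n)" for n using R by (simp add: R_def)
  \<comment> \<open>The initial state is only known to lie below \<open>u\<close>, so the value at 0
    is replaced by \<open>u\<close>; this preserves \<open>x 0 + w 1 \<le> w 0\<close>.\<close>
  define w where "w k = (if k = 0 then u else fst (f k))" for k
  have w0: "fst (f k) \<le> w k" for k using P[of 0] by (auto simp: w_def P_def)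
  show ?thesis
  proof (rule that[of r w x])
    show "strict_mono r" using R r unfolding strict_mono_Suc_iff R_def by blast
    show "w 0 = u" by (simp add: w_def)
    show "0 \<le> x k" "inf (x k) (w (Suc k)) = 0" "\<psi> (r k) (w (Suc k)) \<le> d / 2 ^ Suc k" for k
      using R[of k] by (auto simp: R_def w_def)
    show "0 \<le> w k" for k using P[of k] u by (auto simp: P_def w_def)
    show "x k + w (Suc k) \<le> w k" for k using R[of k] order_trans[OF _ w0[of k]] by (auto simp: R_def w_def)
    show "c - 2 * d \<le> \<psi> (r k) (x k)" for k
    proof -
      have "c - 2 * d \<le> b (Suc k)" using d by (simp add: b_def algebra_simps)
      then show ?thesis using R[of k] by (simp add: R_def)
    qed
    show "\<psi> (r j) (x k) \<le> d / 2 ^ Suc k" if "k < j" for j k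
      using R[of k] sub[of "Suc k" j] r[of j] that unfolding R_def by auto
  qed
qed

lemma splitting_sequence_sum_le:
  fixes x w :: "nat \<Rightarrow> 'a::banach_lattice"
  assumes "\<And>k. x k + w (Suc k) \<le> w k"
  shows "(\<Sum>k=i..<i+n. x k) + w (i + n) \<le> w i"
proof (induction n)
  case (Suc n)
  have "(\<Sum>k=i..<i+n. x k) + (x (i + n) + w (Suc (i + n))) \<le> (\<Sum>k=i..<i+n. x k) + w (i + n)"
    by (intro add_left_mono assms)
  from order_trans[OF this Suc] show ?case by (simp add: add.assoc)
qed simp

text \<open>Everything peeled off after round \<open>i\<close> lies below \<open>w (Suc i)\<close>,
  which is disjoint from \<open>x i\<close>.\<close>

lemma splitting_sequence_disjoint:
  fixes x w :: "nat \<Rightarrow> 'a::banach_lattice"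
  assumes "\<And>k. 0 \<le> x k" "\<And>k. 0 \<le> w k" "\<And>k. x k + w (Suc k) \<le> w k" "\<And>k. inf (x k) (w (Suc k)) = 0"
    and "i \<noteq> j"
  shows "inf (x i) (x j) = 0"
proof -
  have lt: "inf (x i) (x j) = 0" if "i < j" for i j
  proof -
    have "(\<Sum>k=Suc i..<Suc i+(j - Suc i). x k) + w j \<le> w (Suc i)"
      using splitting_sequence_sum_le[of x w "Suc i" "j - Suc i", OF assms(3)] that by simp
    from order_trans[OF add_increasing[OF sum_nonneg order_refl] this] have "w j \<le> w (Suc i)"
      using assms(1) by blast
    moreover have "x j \<le> w j" by (rule order_trans[OF add_increasing2[OF assms(2) order_refl] assms(3)])
    ultimately show ?thesis by (intro inf_eq_0_mono[OF assms(4)[of i]]) (use assms in auto)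
  qed
  show ?thesis
    using lt[of i j] lt[of j i] assms(5) inf_commute[of "x i" "x j"] by (cases i j rule: linorder_cases) auto
qed

text \<open>For positive \<open>f\<close> the partial sums of \<open>f (x k)\<close> stay below
  \<open>f u\<close>, so the series converges and its terms vanish.\<close>

lemma weakly_null_bounded_sums:
  fixes x :: "nat \<Rightarrow> 'a::banach_lattice"
  assumes "\<And>k. 0 \<le> x k" "\<And>n. (\<Sum>k<n. x k) \<le> u"
  shows "weakly_null x"
proof (rule weakly_nullI)
  fix f :: "'a \<Rightarrow>\<^sub>L real" assume f: "0 \<le> f"
  have "summable (\<lambda>k. f (x k))"
  proof (rule bounded_imp_summable)
    show "0 \<le> f (x k)" for k by (intro blinfun_nonneg f assms)
    show "(\<Sum>k\<le>n. f (x k)) \<le> f u" for n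
      using blinfun_mono_pos[OF f assms(2)[of "Suc n"]] by (simp add: blinfun.sum_right lessThan_Suc_atMost)
  qed
  then show "(\<lambda>k. f (x k)) \<longlonglongrightarrow> 0" by (rule summable_LIMSEQ_zero)
qed

lemma sum_le_if_splitting_sequence:
  fixes x w :: "nat \<Rightarrow> 'a::banach_lattice"
  assumes "\<And>k. 0 \<le> w k" "\<And>k. x k + w (Suc k) \<le> w k"
  shows "(\<Sum>k<n. x k) \<le> w 0"
  using order_trans[OF add_increasing2[OF assms(1) order_refl] splitting_sequence_sum_le[of x w 0 n, OF assms(2)]]
  by (simp add: atLeast0LessThan)

section \<open>Weak* null sequences\<close>

lemma sigma_Dedekind_complete_sup:
  fixes x :: "nat \<Rightarrow> 'a::banach_lattice"
  assumes "sigma_Dedekind_complete TYPE('a)" "\<And>n. x n \<le> u"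
  obtains s where "\<And>n. x n \<le> s" "\<And>b. (\<And>n. x n \<le> b) \<Longrightarrow> s \<le> b"
proof -
  have "bdd_above (range x)" using assms(2) by (intro bdd_aboveI2)
  then have "countable (range x) \<and> range x \<noteq> {} \<and> bdd_above (range x)" by simp
  with assms(1)[unfolded sigma_Dedekind_complete_def, THEN spec, of "range x"]
  obtain s where s: "isLub UNIV (range x) s" by blast
  show ?thesis
  proof (rule that[of s])
    show "x n \<le> s" for n using isLub_isUb[OF s] by (simp add: isUb_def setle_def)
    show "s \<le> b" if "\<And>n. x n \<le> b" for b
      using isLub_le_isUb[OF s] that by (auto simp: isUb_def setle_def)
  qed
qed

lemma sigma_Dedekind_complete_inf:
  fixes x :: "nat \<Rightarrow> 'a::banach_lattice"
  assumes "sigma_Dedekind_complete TYPE('a)" "\<And>n. l \<le> x n"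
  obtains s where "\<And>n. s \<le> x n" "\<And>b. (\<And>n. b \<le> x n) \<Longrightarrow> b \<le> s"
proof -
  have "- x n \<le> - l" for n using assms(2) by simp
  then obtain s where s: "\<And>n. - x n \<le> s" "\<And>b. (\<And>n. - x n \<le> b) \<Longrightarrow> s \<le> b"
    by (rule sigma_Dedekind_complete_sup[OF assms(1), of "\<lambda>n. - x n"]) blast
  show ?thesis
  proof (rule that[of "- s"])
    show "- s \<le> x n" for n using s(1)[of n] by (simp add: minus_le_iff)
    show "b \<le> - s" if "\<And>n. b \<le> x n" for b using s(2)[of "- b"] that by (simp add: le_minus_iff)
  qed
qed

lemma weak_star_null_bounded:
  fixes f :: "nat \<Rightarrow> 'a::banach \<Rightarrow>\<^sub>L real"
  assumes "weak_star_null f"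
  obtains B where "0 < B" "\<And>n. norm (f n) \<le> B"
proof -
  have "bounded (range f)"
  proof (rule uniform_boundedness)
    fix x
    have "(\<lambda>n. f n x) \<longlonglongrightarrow> 0" using assms by (simp add: weak_star_null_iff)
    then have "bounded (range (\<lambda>n. f n x))" by (rule convergent_imp_bounded)
    then show "bounded ((\<lambda>T. blinfun_apply T x) ` range f)" by (simp add: image_image)
  qed
  then show ?thesis using that unfolding bounded_pos by blast
qed

lemma not_tendsto_0_subseq:
  fixes f :: "nat \<Rightarrow> real"
  assumes "\<not> f \<longlonglongrightarrow> 0"
  obtains e and r :: "nat \<Rightarrow> nat" where "0 < e" "strict_mono r" "\<And>n. e \<le> \<bar>f (r n)\<bar>"
proof -
  obtain e where e: "0 < e" "\<forall>N. \<exists>n\<ge>N. e \<le> \<bar>f n\<bar>"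
    using assms unfolding LIMSEQ_iff by (auto simp: not_less)
  then have "infinite {n. e \<le> \<bar>f n\<bar>}" unfolding infinite_nat_iff_unbounded_le by blast
  then obtain r :: "nat \<Rightarrow> nat" where "strict_mono r" "\<forall>n. r n \<in> {n. e \<le> \<bar>f n\<bar>}"
    using infinite_enumerate by blast
  then show ?thesis using that e(1) by auto
qed

text \<open>A sequence of disjoint weak* null functionals with \<open>\<bar>\<phi>\<^sub>n\<bar> u \<ge> e\<close> would, along a subsequence, be far from
  \<open>0\<close> at the order sum of the vectors \<open>v\<^sub>k\<close> on which the individual \<open>\<phi>\<^sub>k\<close> are large.\<close>

theorem weak_star_null_modulus:
  fixes \<phi> a :: "nat \<Rightarrow> 'a::banach_lattice \<Rightarrow>\<^sub>L real"
  assumes sdc: "sigma_Dedekind_complete TYPE('a)" and null: "weak_star_null \<phi>"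
    and a: "\<And>n. isLub UNIV {\<phi> n, - \<phi> n} (a n)"
    and dj: "\<And>n m. n \<noteq> m \<Longrightarrow> perp (a n) (a m)" and u: "0 \<le> u"
  shows "(\<lambda>n. a n u) \<longlonglongrightarrow> 0"
proof (rule ccontr)
  note pos = isLub_modulus_nonneg[OF a]
  assume "\<not> (\<lambda>n. a n u) \<longlonglongrightarrow> 0"
  then obtain e and r0 :: "nat \<Rightarrow> nat" where e: "0 < e" and r0: "strict_mono r0" and "\<And>n. e \<le> \<bar>a (r0 n) u\<bar>"
    by (rule not_tendsto_0_subseq) (rule that; assumption)
  then have low: "e \<le> a (r0 n) u" for n using blinfun_nonneg[OF pos u] by (metis abs_of_nonneg)
  obtain B where B: "0 < B" "\<And>n. norm (\<phi> n) \<le> B" by (rule weak_star_null_bounded[OF null]) (rule that; assumption)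
  \<comment> \<open>The norm bound is available for \<open>\<phi>\<close> and is transferred to the
    modulus through an approximating vector, with tolerance 1.\<close>
  have up: "a (r0 n) u \<le> 2 * (B * norm u) + 1" for n
  proof -
    obtain v where v: "0 \<le> v" "v \<le> u" "a (r0 n) u < 2 * \<bar>\<phi> (r0 n) v\<bar> + 1"
      using isLub_modulus_approx[OF a u zero_less_one] by blast
    have "\<bar>\<phi> (r0 n) v\<bar> \<le> norm (\<phi> (r0 n)) * norm v" using norm_blinfun[of "\<phi> (r0 n)" v] by simp
    also have "\<dots> \<le> B * norm u" using B v by (intro mult_mono norm_mono_pos) auto
    finally show ?thesis using v(3) by linarith
  qed
  have inj: "r0 i \<noteq> r0 j" if "i \<noteq> j" for i j using strict_mono_eq[OF r0] that by simp
  have d: "0 < e / 16" using e by simp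
  obtain r x w where r: "strict_mono r" and w0: "w 0 = u" and x: "\<And>k. 0 \<le> x k" and w: "\<And>k. 0 \<le> w k"
    and xw: "\<And>k. x k + w (Suc k) \<le> w k" and "\<And>k. inf (x k) (w (Suc k)) = 0"
    and large: "\<And>k. e - 2 * (e / 16) \<le> a (r0 (r k)) (x k)"
    and tail: "\<And>k. a (r0 (r k)) (w (Suc k)) \<le> e / 16 / 2 ^ Suc k"
    and head: "\<And>j k. k < j \<Longrightarrow> a (r0 (r j)) (x k) \<le> e / 16 / 2 ^ Suc k"
    by (rule splitting_sequence[of "\<lambda>n. a (r0 n)", OF pos dj[OF inj] u low up d]) (assumption | rule that; assumption)+
  define \<rho> where "\<rho> k = r0 (r k)" for k
  have \<rho>: "strict_mono \<rho>" using r r0 by (simp add: \<rho>_def strict_mono_def)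
  have "\<exists>v. 0 \<le> v \<and> v \<le> x k \<and> a (\<rho> k) (x k) < 2 * \<bar>\<phi> (\<rho> k) v\<bar> + e / 8" for k
    using e by (intro isLub_modulus_approx[OF a x]) auto
  then obtain v where v: "\<And>k. 0 \<le> v k" "\<And>k. v k \<le> x k"
    "\<And>k. a (\<rho> k) (x k) < 2 * \<bar>\<phi> (\<rho> k) (v k)\<bar> + e / 8" by metis
  have vbig: "3 * e / 8 \<le> \<bar>\<phi> (\<rho> k) (v k)\<bar>" for k
    using v(3)[of k] large[of k] by (simp add: \<rho>_def)
  have vw: "v k + w (Suc k) \<le> w k" for k using add_right_mono[OF v(2)] xw order_trans by blast
  define s where "s n = (\<Sum>k<n. v k)" for n
  have s_split: "s (i + n) = s i + (\<Sum>k=i..<i+n. v k)" for i n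
    by (induction n) (auto simp: s_def add.assoc)
  have s_mono: "s i \<le> s j" if "i \<le> j" for i j
    using that v(1) unfolding s_def by (intro sum_mono2) auto
  \<comment> \<open>The remainder \<open>w i\<close> bounds all that is added from step
    \<open>i\<close> on, hence also the difference between the supremum \<open>t\<close> and
    \<open>s i\<close>.\<close>
  have s_tail: "s j \<le> s i + w i" for i j
  proof (cases "i \<le> j")
    case True
    then obtain n where n: "j = i + n" using le_Suc_ex by blast
    have "(\<Sum>k=i..<i+n. v k) \<le> (\<Sum>k=i..<i+n. v k) + w (i + n)" using w by simp
    also have "\<dots> \<le> w i" by (rule splitting_sequence_sum_le[of v w, OF vw])
    finally show ?thesis unfolding n s_split by (rule add_left_mono)
  next
    case False
    then have "s j \<le> s i" by (intro s_mono) simp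
    then show ?thesis using w[of i] by (rule add_increasing2[rotated])
  qed
  obtain t where t: "\<And>n. s n \<le> t" "\<And>b. (\<And>n. s n \<le> b) \<Longrightarrow> t \<le> b"
    by (rule sigma_Dedekind_complete_sup[OF sdc, of s "s 0 + w 0"]) (rule s_tail, blast)
  \<comment> \<open>Of the three pieces of \<open>t\<close> the middle one contributes at least
    \<open>3 * e / 8\<close>, which is half of \<open>7 * e / 8 - e / 8\<close>. The preceding
    vectors and the tail disturb it by at most \<open>e / 16\<close> each.\<close>
  have "e / 4 \<le> \<bar>\<phi> (\<rho> i) t\<bar>" for i
  proof -
    have t_eq: "\<phi> (\<rho> i) t = \<phi> (\<rho> i) (s i) + \<phi> (\<rho> i) (v i) + \<phi> (\<rho> i) (t - s (Suc i))"
      by (simp add: s_def blinfun.diff_right blinfun.add_right)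
    have "\<bar>\<phi> (\<rho> i) (s i)\<bar> \<le> a (\<rho> i) \<bar>s i\<bar>" by (rule isLub_modulus_abs_le[OF a])
    also have "\<bar>s i\<bar> = s i" using v(1) by (intro abs_of_nonneg) (simp add: s_def sum_nonneg)
    also have "a (\<rho> i) (s i) \<le> (\<Sum>k<i. a (\<rho> i) (x k))"
      unfolding s_def blinfun.sum_right by (intro sum_mono blinfun_mono_pos pos v)
    also have "\<dots> \<le> (\<Sum>k<i. e / 16 / 2 ^ Suc k)" unfolding \<rho>_def by (intro sum_mono head) simp
    also have "\<dots> \<le> e / 16" using d by (intro sum_geometric_half_le) simp
    finally have 1: "\<bar>\<phi> (\<rho> i) (s i)\<bar> \<le> e / 16" .
    have "t \<le> s (Suc i) + w (Suc i)" by (rule t(2)[OF s_tail])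
    then have tw: "t - s (Suc i) \<le> w (Suc i)" by (simp add: algebra_simps)
    have "\<bar>\<phi> (\<rho> i) (t - s (Suc i))\<bar> \<le> a (\<rho> i) \<bar>t - s (Suc i)\<bar>" by (rule isLub_modulus_abs_le[OF a])
    also have "\<bar>t - s (Suc i)\<bar> = t - s (Suc i)" using t(1) by (intro abs_of_nonneg) simp
    also have "a (\<rho> i) (t - s (Suc i)) \<le> a (\<rho> i) (w (Suc i))" by (rule blinfun_mono_pos[OF pos tw])
    also have "\<dots> \<le> e / 16 / 2 ^ Suc i" unfolding \<rho>_def by (rule tail)
    also have "\<dots> \<le> e / 16 / 1" using e by (intro divide_left_mono) (auto simp del: power_Suc)
    finally have 2: "\<bar>\<phi> (\<rho> i) (t - s (Suc i))\<bar> \<le> e / 16" by simp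
    show ?thesis using t_eq 1 2 vbig[of i] by linarith
  qed
  moreover have "(\<lambda>i. \<bar>\<phi> (\<rho> i) t\<bar>) \<longlonglongrightarrow> 0"
    using LIMSEQ_subseq_LIMSEQ[OF _ \<rho>, of "\<lambda>n. \<phi> n t" 0] null
    by (simp add: weak_star_null_iff o_def tendsto_rabs_zero)
  ultimately have "e / 4 \<le> 0" by (intro LIMSEQ_le_const[of _ 0]) auto
  then show False using e by simp
qed

text \<open>The modulus of \<open>f n\<close> at the single vector \<open>u\<close> bounds
  \<open>f n\<close> uniformly on \<open>A\<close>.\<close>

lemma almost_limited_order_bounded:
  fixes A :: "'a::banach_lattice set"
  assumes sdc: "sigma_Dedekind_complete TYPE('a)" and u: "\<And>y. y \<in> A \<Longrightarrow> \<bar>y\<bar> \<le> u"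
  shows "almost_limited A"
proof (cases "A = {}")
  case True then show ?thesis by (simp add: almost_limited_def)
next
  case False
  have u0: "0 \<le> u" using False u abs_ge_zero order_trans by blast
  show ?thesis
    unfolding almost_limited_def
  proof (intro conjI allI impI)
    have "norm y \<le> norm u" if "y \<in> A" for y
      using u[OF that] abs_of_nonneg[OF u0] by (intro norm_mono_abs) simp
    then show "bounded A" by (auto simp: bounded_iff)
    fix f :: "nat \<Rightarrow> 'a \<Rightarrow>\<^sub>L real"
    assume f: "dual_disjoint_seq f \<and> weak_star_null f"
    then have dd: "dual_disjoint (f n) (f m)" if "n \<noteq> m" for n m
      using that by (simp add: dual_disjoint_seq_def)
    have "\<exists>a. isLub UNIV {f n, - f n} a" for n
      using dd[of n "Suc n"] unfolding dual_disjoint_def by auto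
    then obtain a where a: "\<And>n. isLub UNIV {f n, - f n} (a n)" by metis
    \<comment> \<open>The moduli in \<open>dual_disjoint\<close> are chosen anew for each pair of
      indices; uniqueness of least upper bounds identifies them with the fixed
      \<open>a n\<close>.\<close>
    have uniq: "b = a n" if "isLub UNIV {f n, - f n} b" for n b
      using isLub_le_isUb[OF that isLub_isUb[OF a]] isLub_le_isUb[OF a isLub_isUb[OF that]] by (rule antisym)
    have dj: "perp (a n) (a m)" if nm: "n \<noteq> m" for n m
    proof -
      obtain b c where "isLub UNIV {f n, - f n} b" "isLub UNIV {f m, - f m} c" "isGlb UNIV {b, c} 0"
        using dd[OF nm] unfolding dual_disjoint_def by auto
      then show ?thesis using uniq isGlb_perp by blast
    qed
    have lim: "(\<lambda>n. a n u) \<longlonglongrightarrow> 0"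
      by (rule weak_star_null_modulus[OF sdc _ a _ u0]) (simp_all add: f dj)
    have le: "\<bar>f n y\<bar> \<le> a n u" if "y \<in> insert 0 A" for n y
    proof (cases "y = 0")
      case True
      then show ?thesis using blinfun_nonneg[OF isLub_modulus_nonneg[OF a] u0] by (simp add: blinfun.zero_right)
    next
      case False
      then have "\<bar>y\<bar> \<le> u" using that u by simp
      from order_trans[OF isLub_modulus_abs_le[OF a] blinfun_mono_pos[OF isLub_modulus_nonneg[OF a] this]]
      show ?thesis .
    qed
    show "(\<lambda>n. SUP y\<in>insert 0 A. \<bar>f n y\<bar>) \<longlonglongrightarrow> 0"
    proof (rule tendsto_sandwich[OF _ _ tendsto_const lim])
      show "\<forall>\<^sub>F n in sequentially. (SUP y\<in>insert 0 A. \<bar>f n y\<bar>) \<le> a n u"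
        using le by (intro always_eventually allI cSUP_least) auto
      have "\<bar>f n 0\<bar> \<le> (SUP y\<in>insert 0 A. \<bar>f n y\<bar>)" for n
        using le by (intro cSUP_upper bdd_aboveI2[of _ _ "a n u"]) auto
      then show "\<forall>\<^sub>F n in sequentially. 0 \<le> (SUP y\<in>insert 0 A. \<bar>f n y\<bar>)"
        by (intro always_eventually allI) (simp add: blinfun.zero_right)
    qed
  qed
qed

lemma order_continuous_norm_decreasing:
  fixes x :: "nat \<Rightarrow> 'a::banach_lattice"
  assumes oc: "order_continuous_norm TYPE('a)" and dec: "\<And>m n. m \<le> n \<Longrightarrow> x n \<le> x m"
    and x0: "\<And>n. 0 \<le> x n" and inf0: "\<And>b. (\<And>n. b \<le> x n) \<Longrightarrow> b \<le> 0" and e: "0 < e"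
  obtains n where "norm (x n) < e"
proof -
  have "\<exists>z\<in>range x. z \<le> x m \<and> z \<le> x n" for m n
    using dec[of m "max m n"] dec[of n "max m n"] by auto
  moreover have "isGlb UNIV (range x) 0"
    using x0 inf0 by (auto simp: isGlb_def greatestP_def isLb_def setge_def setle_def)
  ultimately have "\<exists>z\<in>range x. \<forall>y\<in>range x. y \<le> z \<longrightarrow> norm y < e"
    using oc e unfolding order_continuous_norm_def
    by (elim allE[of _ "range x"] impE) (auto simp del: Bex_def)
  then show ?thesis using that by blast
qed

text \<open>Vectors \<open>X\<^sub>n \<in> [0, x]\<close> are chosen almost carried by \<open>h\<^sub>n\<close>; their limes superior \<open>W\<close> is almost null for every
  \<open>h\<^sub>n\<close>, although \<open>sup\<^bsub>k\<ge>n\<^esub> X\<^sub>k\<close> decreases to it in norm.\<close>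

theorem order_continuous_disjoint_weak_star_null:
  fixes h :: "nat \<Rightarrow> 'a::banach_lattice \<Rightarrow>\<^sub>L real"
  assumes sdc: "sigma_Dedekind_complete TYPE('a)" and oc: "order_continuous_norm TYPE('a)"
    and pos: "\<And>n. 0 \<le> h n" and bound: "\<And>n. norm (h n) \<le> 1"
    and dj: "\<And>i j. i \<noteq> j \<Longrightarrow> perp (h i) (h j)"
  shows "weak_star_null h"
proof (rule weak_star_nullI, rule ccontr)
  fix x :: 'a assume x: "0 \<le> x"
  assume "\<not> (\<lambda>n. h n x) \<longlonglongrightarrow> 0"
  then obtain e and r :: "nat \<Rightarrow> nat" where e: "0 < e" and r: "strict_mono r" and "\<And>n. e \<le> \<bar>h (r n) x\<bar>"
    by (rule not_tendsto_0_subseq) (rule that; assumption)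
  then have low: "e \<le> h (r n) x" for n using blinfun_nonneg[OF pos x] by (metis abs_of_nonneg)
  define g where "g n = h (r n)" for n
  have g: "0 \<le> g n" for n by (simp add: g_def pos)
  have g1: "g n z \<le> norm z" for n z
    using norm_blinfun[of "g n" z] mult_right_mono[OF bound norm_ge_zero, of "r n" z] by (simp add: g_def)
  define d where "d = e / 8"
  have d: "0 < d" using e by (simp add: d_def)
  \<comment> \<open>Separating \<open>g n\<close> from the sum of its predecessors gives a vector
    that carries \<open>g n\<close> at \<open>x\<close> up to \<open>d\<close> and is nearly null
    for each earlier functional, with summable errors.\<close>
  have "\<exists>y. 0 \<le> y \<and> y \<le> x \<and> g n (x - y) \<le> d \<and> (\<forall>m<n. g m y \<le> d / 2 ^ Suc n)" for n
  proof -
    have "perp (g m) (g n)" if "m < n" for m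
      using dj[of "r m" "r n"] strict_mono_eq[OF r, of m n] that by (simp add: g_def)
    then have p: "perp (\<Sum>m<n. g m) (g n)" using perp_sum[of "{..<n}" g "g n"] g by simp
    have dn: "0 < d / 2 ^ Suc n" using d by simp
    obtain y where y: "0 \<le> y" "y \<le> x" "(\<Sum>m<n. g m) y < d / 2 ^ Suc n" "g n (x - y) < d / 2 ^ Suc n"
      by (rule perpE[OF p x dn])
    have "g m y \<le> d / 2 ^ Suc n" if "m < n" for m
    proof -
      have "g m y \<le> (\<Sum>m<n. g m y)" using that blinfun_nonneg[OF g y(1)] by (intro member_le_sum) auto
      then show ?thesis using y(3) by (simp add: blinfun.sum_left)
    qed
    moreover have "d / 2 ^ Suc n \<le> d / 1" using d by (intro divide_left_mono) (auto simp del: power_Suc)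
    ultimately show ?thesis using y by (intro exI[of _ y]) auto
  qed
  then obtain X where X: "\<And>n. 0 \<le> X n" "\<And>n. X n \<le> x" "\<And>n. g n (x - X n) \<le> d"
    "\<And>n m. m < n \<Longrightarrow> g m (X n) \<le> d / 2 ^ Suc n" by metis
  have "\<exists>w. (\<forall>k. X (n + k) \<le> w) \<and> (\<forall>b. (\<forall>k. X (n + k) \<le> b) \<longrightarrow> w \<le> b)" for n
    by (rule sigma_Dedekind_complete_sup[OF sdc, of "\<lambda>k. X (n + k)" x]) (use X(2) in blast)+
  then obtain w where w: "\<And>n k. X (n + k) \<le> w n" "\<And>n b. (\<And>k. X (n + k) \<le> b) \<Longrightarrow> w n \<le> b" by metis
  have w_dec: "w n \<le> w m" if "m \<le> n" for m n
  proof (rule w(2))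
    show "X (n + k) \<le> w m" for k using w(1)[of m "n - m + k"] that by simp
  qed
  have w0: "0 \<le> w n" for n using order_trans[OF X(1) w(1)[of n 0]] by simp
  obtain W where W: "\<And>n. W \<le> w n" "\<And>b. (\<And>n. b \<le> w n) \<Longrightarrow> b \<le> W"
    by (rule sigma_Dedekind_complete_inf[OF sdc, of 0 w]) (rule w0, blast)
  obtain n where n: "norm (w n - W) < d"
  proof (rule order_continuous_norm_decreasing[OF oc _ _ _ d, of "\<lambda>n. w n - W"])
    show "w n - W \<le> w m - W" if "m \<le> n" for m n using w_dec[OF that] by simp
    show "0 \<le> w n - W" for n using W(1) by simp
    show "b \<le> 0" if "\<And>n. b \<le> w n - W" for b
    proof -
      have "b + W \<le> W" by (rule W(2)) (use that in \<open>simp add: algebra_simps\<close>)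
      then show ?thesis by simp
    qed
  qed (rule that)
  define S where "S i = (\<Sum>k<i. X (Suc n + k))" for i
  \<comment> \<open>The partial sums of the \<open>X\<close> need not be order bounded. Capped by
    \<open>x\<close> they have a supremum, which still dominates every later \<open>X\<close>, since
    each is at most \<open>x\<close>.\<close>
  define t where "t i = inf x (S i)" for i
  have S_mono: "S i \<le> S j" if "i \<le> j" for i j
    unfolding S_def using that X(1) by (intro sum_mono2) auto
  have t_mono: "t i \<le> t j" if "i \<le> j" for i j
    unfolding t_def using S_mono[OF that] by (intro inf_mono) auto
  have g_t: "g n (t i) \<le> d" for i
  proof -
    have "g n (t i) \<le> g n (S i)" by (intro blinfun_mono_pos g) (simp add: t_def)
    also have "\<dots> \<le> (\<Sum>k<i. d / 2 ^ Suc k)"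
      unfolding S_def blinfun.sum_right
    proof (rule sum_mono)
      fix k
      have "g n (X (Suc n + k)) \<le> d / 2 ^ Suc (Suc n + k)" by (rule X(4)) simp
      also have "\<dots> \<le> d / 2 ^ Suc k" using d by (intro divide_left_mono power_increasing) auto
      finally show "g n (X (Suc n + k)) \<le> d / 2 ^ Suc k" .
    qed
    also have "\<dots> \<le> d" using d by (intro sum_geometric_half_le) simp
    finally show ?thesis .
  qed
  have "t i \<le> x" for i by (simp add: t_def)
  then obtain T where T: "\<And>i. t i \<le> T" "\<And>b. (\<And>i. t i \<le> b) \<Longrightarrow> T \<le> b"
    by (rule sigma_Dedekind_complete_sup[OF sdc, of t x]) blast
  \<comment> \<open>\<open>g n\<close> is at most \<open>d\<close> on every \<open>t i\<close> but
    is only norm continuous; order continuity of the norm carries the estimate to the supremum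
    \<open>T\<close>.\<close>
  obtain i where i: "norm (T - t i) < d"
  proof (rule order_continuous_norm_decreasing[OF oc _ _ _ d, of "\<lambda>i. T - t i"])
    show "T - t j \<le> T - t i" if "i \<le> j" for i j using t_mono[OF that] by simp
    show "0 \<le> T - t i" for i using T(1) by simp
    show "b \<le> 0" if "\<And>i. b \<le> T - t i" for b
    proof -
      have "T \<le> T - b" by (rule T(2)) (use that in \<open>simp add: algebra_simps\<close>)
      then show ?thesis by simp
    qed
  qed (rule that)
  have "w (Suc n) \<le> T"
  proof (rule w(2))
    fix k
    have "X (Suc n + k) \<le> S (Suc k)" unfolding S_def using X(1) by (simp add: sum_nonneg)
    then have "X (Suc n + k) \<le> t (Suc k)" using X(2) by (simp add: t_def)
    then show "X (Suc n + k) \<le> T" using T(1) order_trans by blast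
  qed
  then have "W \<le> T" using W(1) order_trans by blast
  then have "g n W \<le> g n T" by (rule blinfun_mono_pos[OF g])
  also have "\<dots> = g n (T - t i) + g n (t i)" by (simp add: blinfun.diff_right)
  also have "\<dots> \<le> d + d" using g1[of n "T - t i"] i g_t[of i] by linarith
  finally have gW: "g n W \<le> d + d" .
  \<comment> \<open>The errors add up to \<open>g n x \<le> 4 * d = e / 2\<close>, against the lower
    bound \<open>e\<close>.\<close>
  have "g n x - d \<le> g n (X n)" using X(3)[of n] by (simp add: blinfun.diff_right)
  also have "\<dots> \<le> g n (w n)" using w(1)[of n 0] by (intro blinfun_mono_pos g) simp
  also have "\<dots> = g n (w n - W) + g n W" by (simp add: blinfun.diff_right)
  also have "\<dots> \<le> d + (d + d)" using g1[of n "w n - W"] n gW by linarith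
  finally show False using low[of n] d by (simp add: g_def d_def)
qed

section \<open>Operators into spaces with order continuous norm\<close>

lemma abs_scaleR_lattice:
  fixes x :: "'a::banach_lattice"
  assumes "0 \<le> c" shows "\<bar>c *\<^sub>R x\<bar> = c *\<^sub>R \<bar>x\<bar>"
  using pprt_plus_pprt[of "c *\<^sub>R x"] pprt_plus_pprt[of x] pprt_scaleR[OF assms, of x] pprt_scaleR[OF assms, of "- x"]
  by (simp add: scaleR_add_right[symmetric])

text \<open>The sums of the Riesz-Kantorovich formula for the modulus of \<open>T\<close>, whose
  value at \<open>x \<ge> 0\<close> would be their supremum over
  \<open>partitions x\<close>.\<close>

definition abs_sum :: "('a::banach_lattice \<Rightarrow>\<^sub>L 'b::banach_lattice) \<Rightarrow> 'a list \<Rightarrow> 'b" where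
  "abs_sum T xs = (\<Sum>x\<leftarrow>xs. \<bar>T x\<bar>)"

definition partitions :: "'a::banach_lattice \<Rightarrow> 'a list set" where
  "partitions x = {xs. (\<forall>y\<in>set xs. 0 \<le> y) \<and> sum_list xs = x}"

text \<open>A sum of moduli is the supremum, over all choices of signs, of the images of the signed
  sums, and each signed sum has modulus at most \<open>sum_list xs\<close>. The induction moves one
  signed term at a time into \<open>c\<close>.\<close>

lemma abs_sum_le:
  fixes T :: "'a::banach_lattice \<Rightarrow>\<^sub>L 'b::banach_lattice"
  assumes "\<And>y. y \<in> set xs \<Longrightarrow> 0 \<le> y" "\<And>z. \<bar>z\<bar> \<le> sum_list xs \<Longrightarrow> c + T z \<le> w"
  shows "c + abs_sum T xs \<le> w"
  using assms
proof (induction xs arbitrary: c)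
  case Nil
  from Nil.prems(2)[of 0] show ?case by (simp add: abs_sum_def blinfun.zero_right)
next
  case (Cons y ys)
  have y: "0 \<le> y" using Cons.prems(1) by simp
  have bound: "\<bar>y + z\<bar> \<le> sum_list (y # ys)" "\<bar>- y + z\<bar> \<le> sum_list (y # ys)" if "\<bar>z\<bar> \<le> sum_list ys" for z
    using order_trans[OF abs_triangle_ineq[of y z]] order_trans[OF abs_triangle_ineq[of "- y" z]]
      add_left_mono[OF that, of y] abs_of_nonneg[OF y] by auto
  have "(c + T y) + abs_sum T ys \<le> w"
  proof (rule Cons.IH)
    show "c + T y + T z \<le> w" if "\<bar>z\<bar> \<le> sum_list ys" for z
      using Cons.prems(2)[OF bound(1)[OF that]] by (simp add: blinfun.add_right add.assoc)
  qed (use Cons.prems(1) in simp)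
  moreover have "(c + T (- y)) + abs_sum T ys \<le> w"
  proof (rule Cons.IH)
    show "c + T (- y) + T z \<le> w" if "\<bar>z\<bar> \<le> sum_list ys" for z
      using Cons.prems(2)[OF bound(2)[OF that]] by (simp only: blinfun.add_right add.assoc)
  qed (use Cons.prems(1) in simp)
  ultimately have "T y \<le> w - c - abs_sum T ys" "- T y \<le> w - c - abs_sum T ys"
    by (simp_all add: blinfun.minus_right algebra_simps)
  then have "\<bar>T y\<bar> \<le> w - c - abs_sum T ys" by (rule abs_leI)
  then show ?case by (simp add: abs_sum_def algebra_simps)
qed

text \<open>Each entry is split by Riesz decomposition along \<open>x\<close> and \<open>y\<close>;
  the triangle inequality shows that this refinement only increases the sum. It yields subadditivity
  of the functional built next.\<close>

lemma partitions_add: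
  fixes T :: "'a::banach_lattice \<Rightarrow>\<^sub>L 'b::banach_lattice"
  assumes "xs \<in> partitions (x + y)" "0 \<le> x" "0 \<le> y"
  shows "\<exists>as\<in>partitions x. \<exists>bs\<in>partitions y. abs_sum T xs \<le> abs_sum T as + abs_sum T bs"
  using assms
proof (induction xs arbitrary: x y)
  case Nil
  then have "x + y = 0" by (simp add: partitions_def)
  then have "x = 0" "y = 0" using Nil.prems add_nonneg_eq_0_iff[of x y] by auto
  then show ?case by (intro bexI[of _ "[]"]) (auto simp: partitions_def abs_sum_def)
next
  case (Cons z zs)
  then have z: "0 \<le> z" "\<forall>w\<in>set zs. 0 \<le> w" "z + sum_list zs = x + y" by (auto simp: partitions_def)
  have "0 \<le> sum_list zs" using z by (intro sum_list_nonneg) auto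
  then have "z \<le> x + y" using z(3) by (metis le_add_same_cancel1)
  then obtain a b where ab: "z = a + b" "0 \<le> a" "a \<le> x" "0 \<le> b" "b \<le> y"
    by (rule riesz_decomposition[OF z(1) _ Cons.prems(2,3)])
  have "sum_list zs = (x + y) - z" using z(3) by (simp add: algebra_simps)
  also have "\<dots> = (x - a) + (y - b)" using ab(1) by (simp add: algebra_simps)
  finally have "zs \<in> partitions ((x - a) + (y - b))" using z(2) by (simp add: partitions_def)
  then obtain as bs where IH: "as \<in> partitions (x - a)" "bs \<in> partitions (y - b)"
    "abs_sum T zs \<le> abs_sum T as + abs_sum T bs"
    using Cons.IH[of "x - a" "y - b"] ab by auto
  have "\<bar>T z\<bar> \<le> \<bar>T a\<bar> + \<bar>T b\<bar>" unfolding ab(1) blinfun.add_right by (rule abs_triangle_ineq)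
  then have "abs_sum T (z # zs) \<le> (\<bar>T a\<bar> + \<bar>T b\<bar>) + (abs_sum T as + abs_sum T bs)"
    using IH(3) by (simp add: abs_sum_def add_mono)
  then have "abs_sum T (z # zs) \<le> abs_sum T (a # as) + abs_sum T (b # bs)"
    by (simp add: abs_sum_def algebra_simps)
  moreover have "a # as \<in> partitions x" "b # bs \<in> partitions y"
    using IH ab by (auto simp: partitions_def)
  ultimately show ?case by blast
qed

text \<open>The functional \<open>g\<close> is \<open>f \<circ> \<bar>T\<bar>\<close>; it is built directly, since \<open>\<bar>T\<bar>\<close> need not exist unless \<open>'b\<close> is Dedekind complete.\<close>

lemma order_bounded_functional_majorant:
  fixes T :: "'a::banach_lattice \<Rightarrow>\<^sub>L 'b::banach_lattice" and f :: "'b \<Rightarrow>\<^sub>L real"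
  assumes T: "order_bounded_op T" and f: "0 \<le> f"
  obtains g :: "'a \<Rightarrow>\<^sub>L real" where "0 \<le> g" "\<And>x. f \<bar>T x\<bar> \<le> g \<bar>x\<bar>"
proof -
  define G where "G x = (SUP xs\<in>partitions x. f (abs_sum T xs))" for x
  have ne: "[x] \<in> partitions x" if "0 \<le> x" for x :: 'a using that by (simp add: partitions_def)
  have bdd: "bdd_above ((\<lambda>xs. f (abs_sum T xs)) ` partitions x)" for x
  proof -
    have "bdd_above (T ` {- x..x})"
      using T[unfolded order_bounded_op_def, THEN spec, of "{- x..x}"] by simp
    \<comment> \<open>An upper bound of the image of the symmetric interval bounds all sums over
      partitions, by the choice of signs in \<open>abs_sum_le\<close>; here order boundedness makes
      the supremum finite.\<close>
    then obtain w where w: "\<And>z. z \<in> {- x..x} \<Longrightarrow> T z \<le> w" unfolding bdd_above_def by blast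
    have "0 + abs_sum T xs \<le> w" if "xs \<in> partitions x" for xs
    proof (rule abs_sum_le)
      show "0 \<le> y" if "y \<in> set xs" for y using \<open>xs \<in> partitions x\<close> that by (simp add: partitions_def)
      show "0 + T z \<le> w" if "\<bar>z\<bar> \<le> sum_list xs" for z
      proof -
        have "\<bar>z\<bar> \<le> x" using that \<open>xs \<in> partitions x\<close> by (simp add: partitions_def)
        then have "z \<in> {- x..x}" using abs_le_D1[of z x] abs_le_D2[of z x] by (simp add: minus_le_iff)
        then show ?thesis using w by simp
      qed
    qed
    then show ?thesis by (intro bdd_aboveI2[of _ _ "f w"] blinfun_mono_pos[OF f]) simp
  qed
  have up: "f (abs_sum T xs) \<le> G x" if "xs \<in> partitions x" for xs x
    unfolding G_def using that bdd by (rule cSUP_upper)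
  have least: "G x \<le> b" if "0 \<le> x" "\<And>xs. xs \<in> partitions x \<Longrightarrow> f (abs_sum T xs) \<le> b" for x b
    unfolding G_def using ne[OF that(1)] that(2) by (intro cSUP_least) auto
  have Gadd: "G (x + y) = G x + G y" if xy: "0 \<le> x" "0 \<le> y" for x y
  proof (rule antisym)
    show "G (x + y) \<le> G x + G y"
    proof (rule least)
      fix xs assume "xs \<in> partitions (x + y)"
      then obtain as bs where ab: "as \<in> partitions x" "bs \<in> partitions y" "abs_sum T xs \<le> abs_sum T as + abs_sum T bs"
        using partitions_add[OF _ xy] by blast
      have "f (abs_sum T xs) \<le> f (abs_sum T as) + f (abs_sum T bs)"
        using blinfun_mono_pos[OF f ab(3)] by (simp add: blinfun.add_right)
      then show "f (abs_sum T xs) \<le> G x + G y" using up[OF ab(1)] up[OF ab(2)] by linarith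
    qed (use xy in simp)
    have "G y \<le> G (x + y) - f (abs_sum T as)" if a: "as \<in> partitions x" for as
    proof (rule least[OF xy(2)])
      fix bs assume "bs \<in> partitions y"
      then have "as @ bs \<in> partitions (x + y)" using a by (auto simp: partitions_def)
      then have "f (abs_sum T (as @ bs)) \<le> G (x + y)" by (rule up)
      then show "f (abs_sum T bs) \<le> G (x + y) - f (abs_sum T as)"
        by (simp add: abs_sum_def blinfun.add_right)
    qed
    then have "G x \<le> G (x + y) - G y" using xy by (intro least) (auto simp: algebra_simps)
    then show "G x + G y \<le> G (x + y)" by simp
  qed
  have Gscale_le: "G (c *\<^sub>R x) \<le> c * G x" if c: "0 < c" and x: "0 \<le> x" for c x
  proof (rule least)
    fix xs assume xs: "xs \<in> partitions (c *\<^sub>R x)"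
    let ?ys = "map (\<lambda>y. inverse c *\<^sub>R y) xs"
    have "sum_list (map (\<lambda>y. inverse c *\<^sub>R y) zs) = inverse c *\<^sub>R sum_list zs" for zs :: "'a list"
      by (induction zs) (auto simp: scaleR_add_right)
    then have "?ys \<in> partitions x" using xs c by (auto simp: partitions_def intro!: scaleR_nonneg_nonneg)
    then have "f (abs_sum T ?ys) \<le> G x" by (rule up)
    moreover have "abs_sum T (map (\<lambda>y. inverse c *\<^sub>R y) zs) = inverse c *\<^sub>R abs_sum T zs" for zs
      using c by (induction zs) (auto simp: abs_sum_def scaleR_add_right blinfun.scaleR_right abs_scaleR_lattice)
    ultimately show "f (abs_sum T xs) \<le> c * G x" using c by (simp add: blinfun.scaleR_right field_simps)
  qed (use c x in \<open>simp add: scaleR_nonneg_nonneg\<close>)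
  have G0: "G 0 = 0" using Gadd[of 0 0] by simp
  have f_le: "f \<bar>T x\<bar> \<le> G x" if "0 \<le> x" for x using up[OF ne[OF that]] by (simp add: abs_sum_def)
  have Gnn: "0 \<le> G x" if "0 \<le> x" for x
    using f_le[OF that] blinfun_nonneg[OF f abs_ge_zero, of "T x"] by linarith
  obtain g :: "'a \<Rightarrow>\<^sub>L real" where g: "\<And>x. 0 \<le> x \<Longrightarrow> g x = G x"
  proof (rule cone_extension[of G])
    fix c :: real and x :: 'a assume cx: "0 \<le> c" "0 \<le> x"
    show "G (c *\<^sub>R x) = c *\<^sub>R G x"
    proof (cases "c = 0")
      case False
      then have "G (inverse c *\<^sub>R c *\<^sub>R x) \<le> inverse c * G (c *\<^sub>R x)"
        using cx by (intro Gscale_le) (auto simp: scaleR_nonneg_nonneg)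
      then have "c * G x \<le> G (c *\<^sub>R x)" using False cx by (simp add: field_simps)
      then show ?thesis using Gscale_le[of c x] False cx by simp
    qed (simp add: G0)
  qed (use Gadd Gnn in blast)+
  show ?thesis
  proof (rule that[of g])
    show "0 \<le> g" using g Gnn by (simp add: nonneg_blinfun_iff)
    show "f \<bar>T x\<bar> \<le> g \<bar>x\<bar>" for x
    proof -
      have "T x = T (pprt x) - T (pprt (- x))" by (metis blinfun.diff_right pprt_minus_pprt)
      then have "\<bar>T x\<bar> \<le> \<bar>T (pprt x)\<bar> + \<bar>T (pprt (- x))\<bar>" using abs_triangle_ineq4 by metis
      then have "f \<bar>T x\<bar> \<le> f \<bar>T (pprt x)\<bar> + f \<bar>T (pprt (- x))\<bar>"
        using blinfun_mono_pos[OF f] by (metis blinfun.add_right)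
      also have "\<dots> \<le> g (pprt x) + g (pprt (- x))"
        using f_le[of "pprt x"] f_le[of "pprt (- x)"] by (simp add: g)
      also have "\<dots> = g \<bar>x\<bar>" by (metis blinfun.add_right pprt_plus_pprt)
      finally show ?thesis .
    qed
  qed
qed

text \<open>Passes from the modulus of \<open>z\<close> back to \<open>z\<close> at the cost of a
  factor 2: the larger of the two parts is isolated by a component of \<open>g\<close>, and staying
  below \<open>g\<close> preserves disjointness.\<close>

lemma functional_component_large:
  fixes g :: "'a::banach_lattice \<Rightarrow>\<^sub>L real"
  assumes g: "0 \<le> g" and e: "2 * e \<le> g \<bar>z\<bar>"
  obtains h where "0 \<le> h" "h \<le> g" "e \<le> \<bar>blinfun_apply h z\<bar>"
proof -
  have "g \<bar>z\<bar> = g (pprt z) + g (pprt (- z))" by (metis blinfun.add_right pprt_plus_pprt)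
  then consider "e \<le> g (pprt z)" | "e \<le> g (pprt (- z))" using e by linarith
  then show ?thesis
  proof cases
    case 1
    obtain h where "0 \<le> h" "h \<le> g" "h z = g (pprt z)" by (rule functional_component[OF g])
    then show ?thesis using 1 that[of h] by simp
  next
    case 2
    obtain h where "0 \<le> h" "h \<le> g" "h (- z) = g (pprt (- z))" by (rule functional_component[OF g])
    then show ?thesis using 2 that[of h] by (simp add: blinfun.minus_right)
  qed
qed

theorem almost_Dunford_Pettis_if_order_continuous_norm:
  fixes T :: "'a::banach_lattice \<Rightarrow>\<^sub>L 'b::banach_lattice"
  assumes sdc: "sigma_Dedekind_complete TYPE('b)" and oc: "order_continuous_norm TYPE('b)"
    and T: "order_bounded_op T" "weak_almost_limited T"
  shows "almost_Dunford_Pettis T"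
  unfolding almost_Dunford_Pettis_def
proof (intro allI impI, elim conjE, rule ccontr)
  fix x :: "nat \<Rightarrow> 'a"
  assume x: "disjoint_seq x" "weakly_null x" and "\<not> (\<lambda>n. norm (T (x n))) \<longlonglongrightarrow> 0"
  then obtain e and r :: "nat \<Rightarrow> nat" where e: "0 < e" and r: "strict_mono r" and low: "\<And>n. e \<le> \<bar>norm (T (x (r n)))\<bar>"
    using not_tendsto_0_subseq[of "\<lambda>n. norm (T (x n))"] by metis
  define y where "y n = \<bar>T (x (r n))\<bar>" for n
  \<comment> \<open>The images \<open>T (x n)\<close> are not assumed disjoint, so their moduli
    cannot be handled directly. The moduli of the disjoint \<open>x n\<close> are weakly null, and a
    majorant of \<open>f\<close> on the images transfers this.\<close>
  have ynull: "weakly_null y"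
  proof (rule weakly_nullI)
    fix f :: "'b \<Rightarrow>\<^sub>L real" assume f: "0 \<le> f"
    obtain g :: "'a \<Rightarrow>\<^sub>L real" where g: "0 \<le> g" "\<And>x. f \<bar>T x\<bar> \<le> g \<bar>x\<bar>"
      by (rule order_bounded_functional_majorant[OF T(1) f]) (rule that; assumption)
    have "weakly_null (\<lambda>n. \<bar>x (r n)\<bar>)"
      using weakly_null_subseq[OF weakly_null_abs_disjoint[OF x] r] .
    then have lim: "(\<lambda>n. g \<bar>x (r n)\<bar>) \<longlonglongrightarrow> 0" by (simp add: weakly_null_iff)
    show "(\<lambda>n. f (y n)) \<longlonglongrightarrow> 0"
      by (rule tendsto_sandwich[OF _ _ tendsto_const lim])
        (use g(2) blinfun_nonneg[OF f abs_ge_zero] in \<open>simp_all add: y_def\<close>)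
  qed
  have y0: "0 \<le> y n" for n by (simp add: y_def)
  have lowy: "e \<le> norm (y n)" for n using low[of n] by (simp add: y_def)
  obtain s :: "nat \<Rightarrow> nat" and g where s: "strict_mono s" and g: "\<And>k. 0 \<le> g k" "\<And>k. norm (g k) \<le> 1"
    and dj: "\<And>i j. i \<noteq> j \<Longrightarrow> perp (g i) (g j)" and large: "\<And>k. e / 2 \<le> blinfun_apply (g k) (y (s k))"
    by (rule disjoint_functionals_of_weakly_null[of y e]) (rule y0 ynull e lowy | rule that; assumption)+
  define z where "z k = T (x (r (s k)))" for k
  have "\<exists>h. 0 \<le> h \<and> h \<le> g k \<and> e / 4 \<le> \<bar>blinfun_apply h (z k)\<bar>" for k
  proof -
    have "2 * (e / 4) \<le> g k \<bar>z k\<bar>" using large[of k] by (simp add: y_def z_def)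
    then show ?thesis by (rule functional_component_large[OF g(1)]) blast
  qed
  then obtain h where h: "\<And>k. 0 \<le> h k" "\<And>k. h k \<le> g k" "\<And>k. e / 4 \<le> \<bar>blinfun_apply (h k) (z k)\<bar>" by metis
  have hdj: "perp (h i) (h j)" if "i \<noteq> j" for i j by (rule perp_mono[OF dj[OF that] h(2) h(2)])
  have h1: "norm (h k) \<le> 1" for k by (rule order_trans[OF norm_blinfun_mono[OF h(1) h(2)] g(2)])
  have null: "weak_star_null h"
    by (rule order_continuous_disjoint_weak_star_null[OF sdc oc h(1) h1]) (rule hdj)
  have dd: "dual_disjoint_seq h"
    unfolding dual_disjoint_seq_def using dual_disjoint_if_perp[OF h(1) h(1) hdj] by blast
  define A where "A = T ` range x"
  have "almost_limited A"
    using T(2) relatively_weakly_compact_range[OF x(2)] by (simp add: weak_almost_limited_def A_def)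
  then have A: "bounded A" "(\<lambda>n. SUP y\<in>insert 0 A. \<bar>h n y\<bar>) \<longlonglongrightarrow> 0"
    using null dd by (auto simp: almost_limited_def)
  obtain B where B: "\<And>y. y \<in> A \<Longrightarrow> norm y \<le> B" using A(1) unfolding bounded_iff by blast
  have "e / 4 \<le> (SUP y\<in>insert 0 A. \<bar>h k y\<bar>)" for k
  proof -
    have "\<bar>h k y\<bar> \<le> \<bar>B\<bar>" if "y \<in> insert 0 A" for y
    proof -
      have "norm (h k y) \<le> 1 * norm y" using norm_blinfun[of "h k" y] mult_right_mono[OF h1 norm_ge_zero[of y], of k] by linarith
      also have "\<dots> \<le> \<bar>B\<bar>" using that B[of y] by auto
      finally show ?thesis by simp
    qed
    then have "\<bar>h k (z k)\<bar> \<le> (SUP y\<in>insert 0 A. \<bar>h k y\<bar>)"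
      by (intro cSUP_upper bdd_aboveI2[of _ _ "\<bar>B\<bar>"]) (auto simp: A_def z_def)
    then show ?thesis using h(3)[of k] by linarith
  qed
  then have "e / 4 \<le> 0" using A(2) by (intro LIMSEQ_le_const[of _ 0]) auto
  then show False using e by simp
qed

text \<open>The moduli of a disjoint weakly null sequence are positive and weakly null, so the
  sequence itself is already norm null.\<close>

theorem almost_Dunford_Pettis_if_positive_Schur:
  fixes T :: "'a::banach_lattice \<Rightarrow>\<^sub>L 'b::banach"
  assumes "positive_Schur TYPE('a)"
  shows "almost_Dunford_Pettis T"
  unfolding almost_Dunford_Pettis_def
proof (intro allI impI, elim conjE)
  fix x :: "nat \<Rightarrow> 'a"
  assume x: "disjoint_seq x" "weakly_null x"
  have "(\<lambda>n. norm \<bar>x n\<bar>) \<longlonglongrightarrow> 0"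
    using assms[unfolded positive_Schur_def, THEN spec, of "\<lambda>n. \<bar>x n\<bar>"] weakly_null_abs_disjoint[OF x]
    by simp
  then have "(\<lambda>n. T (x n)) \<longlonglongrightarrow> 0"
    using bounded_linear.tendsto_zero[OF blinfun.bounded_linear_right[of T]] tendsto_norm_zero_cancel by auto
  then show "(\<lambda>n. norm (T (x n))) \<longlonglongrightarrow> 0" by (rule tendsto_norm_zero)
qed

section \<open>A positive weak almost limited operator that is not almost Dunford-Pettis\<close>

lemma disjoint_vectors_in_interval:
  fixes g :: "nat \<Rightarrow> 'a::banach_lattice \<Rightarrow>\<^sub>L real"
  assumes pos: "\<And>n. 0 \<le> g n" and bound: "\<And>n. norm (g n) \<le> 1"
    and dj: "\<And>i j. i \<noteq> j \<Longrightarrow> perp (g i) (g j)" and u: "0 \<le> u" and e: "0 < e" and low: "\<And>n. e \<le> g n u"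
  obtains r :: "nat \<Rightarrow> nat" and x where "\<And>k. 0 \<le> x k" "\<And>n. (\<Sum>k<n. x k) \<le> u" "\<And>i j. i \<noteq> j \<Longrightarrow> inf (x i) (x j) = 0"
    "\<And>k. e / 2 \<le> g (r k) (x k)"
proof -
  have up: "g n u \<le> norm u" for n
    using norm_blinfun[of "g n" u] mult_right_mono[OF bound norm_ge_zero[of u], of n] by simp
  \<comment> \<open>\<open>splitting_sequence\<close> loses twice this amount, which leaves
    \<open>e / 2\<close>.\<close>
  have d: "0 < e / 4" using e by simp
  obtain r x w where "strict_mono r" and w0: "w 0 = u" and x: "\<And>k. 0 \<le> x k" and w: "\<And>k. 0 \<le> w k"
    and xw: "\<And>k. x k + w (Suc k) \<le> w k" and inf0: "\<And>k. inf (x k) (w (Suc k)) = 0"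
    and large: "\<And>k. e - 2 * (e / 4) \<le> g (r k) (x k)"
    and "\<And>k. g (r k) (w (Suc k)) \<le> e / 4 / 2 ^ Suc k"
    and "\<And>j k. k < j \<Longrightarrow> g (r j) (x k) \<le> e / 4 / 2 ^ Suc k"
    by (rule splitting_sequence[of g, OF pos dj u low up d]) (assumption | rule that; assumption)+
  show ?thesis
  proof (rule that[of x r])
    show "(\<Sum>k<n. x k) \<le> u" for n using sum_le_if_splitting_sequence[of w x, OF w xw] w0 by simp
    show "inf (x i) (x j) = 0" if "i \<noteq> j" for i j by (rule splitting_sequence_disjoint[of x w, OF x w xw inf0 that])
    show "e / 2 \<le> g (r k) (x k)" for k using large[of k] by simp
  qed (rule x)
qed

text \<open>Disjointifying the vectors requires later functionals to be small at earlier vectors,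
  which holds along a subsequence if \<open>g\<close> is weak* null. If instead \<open>g\<close>
  stays large at some \<open>u\<close>, it singles out disjoint pieces of \<open>u\<close>, which
  are weakly null because their sums are bounded by \<open>u\<close>.\<close>

lemma not_positive_Schur_disjoint:
  assumes "\<not> positive_Schur TYPE('a::banach_lattice)"
  obtains x :: "nat \<Rightarrow> 'a::banach_lattice" and f :: "nat \<Rightarrow> 'a \<Rightarrow>\<^sub>L real" and e where "0 < e" "\<And>n. 0 \<le> x n"
    "\<And>i j. i \<noteq> j \<Longrightarrow> inf (x i) (x j) = 0" "weakly_null x"
    "\<And>n. 0 \<le> f n" "\<And>n. norm (f n) \<le> 1" "\<And>n. e \<le> f n (x n)"
proof -
  obtain y0 :: "nat \<Rightarrow> 'a" where y0: "\<And>n. 0 \<le> y0 n" "weakly_null y0" "\<not> (\<lambda>n. norm (y0 n)) \<longlonglongrightarrow> 0"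
    using assms unfolding positive_Schur_def by blast
  obtain e and r :: "nat \<Rightarrow> nat" where e: "0 < e" and r: "strict_mono r" and low: "\<And>n. e \<le> \<bar>norm (y0 (r n))\<bar>"
    using not_tendsto_0_subseq[OF y0(3)] by metis
  have lowy: "e \<le> norm (y0 (r n))" for n using low[of n] by simp
  have ynull: "weakly_null (\<lambda>n. y0 (r n))" by (rule weakly_null_subseq[OF y0(2) r])
  obtain s :: "nat \<Rightarrow> nat" and g where s: "strict_mono s" and g: "\<And>k. 0 \<le> g k" "\<And>k. norm (g k) \<le> 1"
    and dj: "\<And>i j. i \<noteq> j \<Longrightarrow> perp (g i) (g j)" and large: "\<And>k. e / 2 \<le> blinfun_apply (g k) (y0 (r (s k)))"
    by (rule disjoint_functionals_of_weakly_null[of "\<lambda>n. y0 (r n)" e])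
      (rule y0(1) ynull e lowy | rule that; assumption)+
  define z where "z k = y0 (r (s k))" for k
  have znull: "weakly_null z" unfolding z_def by (rule weakly_null_subseq[OF ynull s])
  have z0: "0 \<le> z k" for k by (simp add: z_def y0)
  have zlarge: "e / 2 \<le> g k (z k)" for k using large by (simp add: z_def)
  show ?thesis
  proof (cases "weak_star_null g")
    case True
    obtain C where C: "0 < C" "\<And>n. norm (z n) \<le> C" using weakly_null_bounded[OF znull] by blast
    \<comment> \<open>Now \<open>2 * C * d = e / 8\<close>, and the predecessors cost another
      \<open>e / 8\<close> of the available \<open>e / 2\<close>.\<close>
    define d where "d = e / (16 * C)"
    have d: "0 < d" using e C by (simp add: d_def)
    define \<eta> where "\<eta> k = (e / 8) * d / 2 ^ k / (real k + 1)" for k :: nat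
    have \<eta>: "0 < \<eta> k" for k using e d by (simp add: \<eta>_def)
    have "\<exists>N. \<forall>n\<ge>N. g n (z i) \<le> \<eta> k" for k i
    proof -
      have "(\<lambda>n. g n (z i)) \<longlonglongrightarrow> 0" using True by (simp add: weak_star_null_iff)
      then have "\<forall>\<^sub>F n in sequentially. g n (z i) < \<eta> k" using \<eta>[of k] by (rule order_tendstoD(2))
      then show ?thesis by (auto simp: eventually_sequentially intro: less_imp_le)
    qed
    then obtain t where t: "strict_mono t" "\<And>i k. i < k \<Longrightarrow> g (t k) (z (t i)) \<le> \<eta> k"
      by (rule diagonal_subsequence[where P = "\<lambda>k i n. g n (z i) \<le> \<eta> k"]) blast
    obtain x where x: "\<And>n. 0 \<le> x n" "\<And>n. x n \<le> z (t n)" "\<And>i j. i \<noteq> j \<Longrightarrow> inf (x i) (x j) = 0"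
      "\<And>n g. 0 \<le> g \<Longrightarrow> norm g \<le> 1 \<Longrightarrow>
         blinfun_apply g (z (t n)) - (2 ^ n / d) * (\<Sum>i<n. g (z (t i))) - 2 * C * d \<le> g (x n)"
      by (rule disjointify_vectors[of "\<lambda>n. z (t n)" C d]) (rule z0 C(2) d | rule that; assumption)+
    have "e / 4 \<le> g (t n) (x n)" for n
    proof -
      have "(2 ^ n / d) * (\<Sum>i<n. g (t n) (z (t i))) \<le> e / 8"
        by (rule weighted_sum_le[OF d]) (use e t(2) in \<open>simp_all add: \<eta>_def\<close>)
      moreover have "2 * C * d = e / 8" using C by (simp add: d_def)
      ultimately show ?thesis using x(4)[OF g, of "t n" n] zlarge[of "t n"] by linarith
    qed
    moreover have "weakly_null x"
    proof (rule weakly_null_dominated)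
      show "weakly_null (\<lambda>n. z (t n))" by (rule weakly_null_subseq[OF znull t(1)])
      show "\<bar>x n\<bar> \<le> z (t n)" for n using x(1,2) by simp
    qed
    ultimately show ?thesis using that[of "e / 4" x "\<lambda>n. g (t n)"] x(1,3) g e by simp
  next
    case False
    then obtain u where u: "0 \<le> u" "\<not> (\<lambda>n. g n u) \<longlonglongrightarrow> 0" using weak_star_nullI[of g] by blast
    obtain c and q :: "nat \<Rightarrow> nat" where c: "0 < c" and q: "strict_mono q" and "\<And>n. c \<le> \<bar>g (q n) u\<bar>"
      using not_tendsto_0_subseq[OF u(2)] by metis
    then have low: "c \<le> g (q n) u" for n using blinfun_nonneg[OF g(1) u(1)] by (metis abs_of_nonneg)
    have dj': "perp (g (q i)) (g (q j))" if "i \<noteq> j" for i j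
      using dj strict_mono_eq[OF q] that by simp
    obtain p :: "nat \<Rightarrow> nat" and x where x: "\<And>k. 0 \<le> x k" "\<And>n. (\<Sum>k<n. x k) \<le> u" "\<And>i j. i \<noteq> j \<Longrightarrow> inf (x i) (x j) = 0"
      "\<And>k. c / 2 \<le> g (q (p k)) (x k)"
      by (rule disjoint_vectors_in_interval[of "\<lambda>n. g (q n)", OF g(1) g(2) dj' u(1) c low]) (assumption | rule that; assumption)+
    have "weakly_null x" by (rule weakly_null_bounded_sums[OF x(1,2)])
    then show ?thesis using that[of "c / 2" x "\<lambda>n. g (q (p n))"] x g c by simp
  qed
qed

text \<open>If all decreasing sequences in \<open>D\<close> were norm Cauchy, then \<open>D\<close> would converge in norm to its infimum.\<close>

lemma not_order_continuous_jumps: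
  fixes D :: "'a::banach_lattice set"
  assumes ne: "D \<noteq> {}" and dir: "\<And>x y. x \<in> D \<Longrightarrow> y \<in> D \<Longrightarrow> \<exists>z\<in>D. z \<le> x \<and> z \<le> y"
    and glb: "isGlb UNIV D 0" and e: "0 < e" and low: "\<And>x. x \<in> D \<Longrightarrow> e \<le> norm x"
  obtains c where "0 < c" "\<And>x. x \<in> D \<Longrightarrow> \<exists>y\<in>D. y \<le> x \<and> c \<le> norm (x - y)"
proof (rule ccontr)
  assume neg: "\<not> thesis"
  have "\<exists>x\<in>D. \<forall>y\<in>D. y \<le> x \<longrightarrow> norm (x - y) < 1 / real (Suc n)" for n
  proof (rule ccontr)
    assume "\<not> (\<exists>x\<in>D. \<forall>y\<in>D. y \<le> x \<longrightarrow> norm (x - y) < 1 / real (Suc n))"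
    then have "\<exists>y\<in>D. y \<le> x \<and> 1 / real (Suc n) \<le> norm (x - y)" if "x \<in> D" for x
      using that by (auto simp: not_less)
    then show False using neg that[of "1 / real (Suc n)"] by simp
  qed
  then obtain x where x: "\<And>n. x n \<in> D" "\<And>n y. y \<in> D \<Longrightarrow> y \<le> x n \<Longrightarrow> norm (x n - y) < 1 / real (Suc n)"
    by metis
  have "\<exists>z. z \<in> D \<and> z \<le> x 0" using x(1) by auto
  moreover have "\<exists>z'. (z' \<in> D \<and> z' \<le> x (Suc n)) \<and> z' \<le> z" if "z \<in> D \<and> z \<le> x n" for z n
    using dir[of z "x (Suc n)"] x(1) that by auto
  ultimately have "\<exists>z. \<forall>n. (z n \<in> D \<and> z n \<le> x n) \<and> z (Suc n) \<le> z n"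
    using dependent_nat_choice[of "\<lambda>n z. z \<in> D \<and> z \<le> x n" "\<lambda>n z z'. z' \<le> z"] by blast
  then obtain z where z: "\<And>n. z n \<in> D" "\<And>n. z n \<le> x n" "\<And>n. z (Suc n) \<le> z n" by blast
  \<comment> \<open>Both \<open>z n\<close> and \<open>y\<close> lie below \<open>x n\<close> and
    within \<open>1 / Suc n\<close> of it.\<close>
  have close: "norm (z n - y) < 2 / real (Suc n)" if "y \<in> D" "y \<le> z n" for n y
  proof -
    have "norm (z n - y) \<le> norm (x n - y) + norm (x n - z n)"
      using norm_triangle_ineq4[of "x n - y" "x n - z n"] by simp
    also have "\<dots> < 1 / real (Suc n) + 1 / real (Suc n)"
      using that z by (intro add_strict_mono x(2)) (auto intro: order_trans)
    finally show ?thesis by simp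
  qed
  have dec: "z n \<le> z m" if "m \<le> n" for m n by (rule lift_Suc_antimono_le[of z, OF z(3) that])
  have small: "\<exists>N. \<forall>n\<ge>N. 2 / real (Suc n) < r" if "0 < r" for r
  proof -
    have lim: "(\<lambda>n. 2 / real (Suc n)) \<longlonglongrightarrow> 0" by (intro tendsto_divide_0[OF tendsto_const]
      filterlim_at_top_imp_at_infinity filterlim_compose[OF filterlim_real_sequentially filterlim_Suc])
    show ?thesis using order_tendstoD(2)[OF lim that] unfolding eventually_sequentially .
  qed
  have "Cauchy z"
  proof (rule CauchyI')
    fix r :: real assume "0 < r"
    then obtain N where N: "\<And>n. N \<le> n \<Longrightarrow> 2 / real (Suc n) < r" using small by blast
    have "dist (z m) (z n) < r" if "N \<le> m" "m < n" for m n
      unfolding dist_norm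
      by (rule order_less_trans[OF close[OF z(1) dec[OF less_imp_le[OF that(2)]]] N[OF that(1)]])
    then show "\<exists>N. \<forall>m\<ge>N. \<forall>n>m. dist (z m) (z n) < r" by blast
  qed
  then obtain l where l: "z \<longlonglongrightarrow> l" using Cauchy_convergent_iff convergent_def by blast
  \<comment> \<open>\<open>d\<close> need not be comparable with the \<open>z n\<close>. Common
    lower bounds \<open>y n\<close> in \<open>D\<close> are norm close to \<open>z n\<close>, hence
    have the same limit, and they stay below \<open>d\<close>.\<close>
  have "l \<le> d" if d: "d \<in> D" for d
  proof -
    have "\<exists>y\<in>D. y \<le> d \<and> y \<le> z n" for n using dir[OF d z(1)] by blast
    then obtain y where y: "\<And>n. y n \<in> D" "\<And>n. y n \<le> d" "\<And>n. y n \<le> z n" by metis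
    have "(\<lambda>n. norm (z n - y n)) \<longlonglongrightarrow> 0"
    proof (rule LIMSEQ_I)
      fix r :: real assume "0 < r"
      then obtain N where N: "\<And>n. N \<le> n \<Longrightarrow> 2 / real (Suc n) < r" using small by blast
      have "norm (norm (z n - y n) - 0) < r" if "N \<le> n" for n
        using order_less_trans[OF close[OF y(1) y(3)] N[OF that]] by simp
      then show "\<exists>N. \<forall>n\<ge>N. norm (norm (z n - y n) - 0) < r" by blast
    qed
    then have "(\<lambda>n. z n - (z n - y n)) \<longlonglongrightarrow> l - 0" by (intro tendsto_diff l) (rule tendsto_norm_zero_cancel)
    then have "(\<lambda>n. d - y n) \<longlonglongrightarrow> d - l" by (intro tendsto_diff tendsto_const) simp
    then have "0 \<le> d - l" by (rule LIMSEQ_nonneg_lattice) (use y(2) in simp)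
    then show ?thesis by simp
  qed
  then have "l \<le> 0" by (intro isGlb_le_isLb[OF glb]) (simp add: isLb_def setge_def)
  moreover have "0 \<le> z n" for n using isGlb_isLb[OF glb] z(1) by (simp add: isLb_def setge_def)
  then have "0 \<le> l" by (rule LIMSEQ_nonneg_lattice[OF l])
  ultimately have "l = 0" by simp
  then have "(\<lambda>n. norm (z n)) \<longlonglongrightarrow> 0" using l tendsto_norm_zero by blast
  then have "e \<le> 0" by (intro LIMSEQ_le_const) (auto intro: low z)
  then show False using e by simp
qed

text \<open>The jumps along a decreasing sequence telescope, so they are weakly null while their
  norms stay above \<open>c\<close>. Their disjointified norming functionals are all large at
  \<open>d 0\<close> and split off disjoint pieces of it.\<close>

lemma not_order_continuous_disjoint:
  assumes "\<not> order_continuous_norm TYPE('a::banach_lattice)"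
  obtains x :: "nat \<Rightarrow> 'a::banach_lattice" and u e where "0 < e" "\<And>n. 0 \<le> x n" "\<And>n. x n \<le> u"
    "\<And>i j. i \<noteq> j \<Longrightarrow> inf (x i) (x j) = 0" "\<And>n. e \<le> norm (x n)"
proof -
  obtain D :: "'a set" and e where D: "D \<noteq> {}" "\<forall>x\<in>D. \<forall>y\<in>D. \<exists>z\<in>D. z \<le> x \<and> z \<le> y" "isGlb UNIV D 0"
    and e: "0 < e" "\<not> (\<exists>x\<in>D. \<forall>y\<in>D. y \<le> x \<longrightarrow> norm y < e)"
    using assms unfolding order_continuous_norm_def by blast
  have D0: "0 \<le> x" if "x \<in> D" for x using isGlb_isLb[OF D(3)] that by (simp add: isLb_def setge_def)
  have low: "e \<le> norm x" if x: "x \<in> D" for x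
  proof -
    obtain y where y: "y \<in> D" "y \<le> x" "\<not> norm y < e" using e(2) x by blast
    then show ?thesis using norm_mono_pos[OF D0[OF y(1)] y(2)] by linarith
  qed
  have dir: "\<exists>z\<in>D. z \<le> x \<and> z \<le> y" if "x \<in> D" "y \<in> D" for x y using D(2) that by blast
  obtain c where c: "0 < c" "\<And>x. x \<in> D \<Longrightarrow> \<exists>y\<in>D. y \<le> x \<and> c \<le> norm (x - y)"
    by (rule not_order_continuous_jumps[OF D(1) dir D(3) e(1) low]) (assumption | rule that; assumption)+
  have "\<exists>x. x \<in> D" using D(1) by blast
  then have "\<exists>d. \<forall>n. d n \<in> D \<and> (d (Suc n) \<le> d n \<and> c \<le> norm (d n - d (Suc n)))"
    using c(2) dependent_nat_choice[of "\<lambda>_ x. x \<in> D" "\<lambda>_ x y. y \<le> x \<and> c \<le> norm (x - y)"] by blast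
  then obtain d where d: "\<And>n. d n \<in> D" "\<And>n. d (Suc n) \<le> d n" "\<And>n. c \<le> norm (d n - d (Suc n))" by blast
  define y where "y n = d n - d (Suc n)" for n :: nat
  have y0: "0 \<le> y n" for n using d(2) by (simp add: y_def)
  have ysum: "(\<Sum>k<n. y k) \<le> d 0" for n
    using sum_lessThan_telescope'[of d n] D0[OF d(1)] by (simp add: y_def)
  have ynull: "weakly_null y" by (rule weakly_null_bounded_sums[OF y0 ysum])
  have lowy: "c \<le> norm (y n)" for n using d(3) by (simp add: y_def)
  obtain s :: "nat \<Rightarrow> nat" and g where s: "strict_mono s" and g: "\<And>k. 0 \<le> g k" "\<And>k. norm (g k) \<le> 1"
    and dj: "\<And>i j. i \<noteq> j \<Longrightarrow> perp (g i) (g j)" and large: "\<And>k. c / 2 \<le> blinfun_apply (g k) (y (s k))"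
    by (rule disjoint_functionals_of_weakly_null[of y c]) (rule y0 ynull c(1) lowy | rule that; assumption)+
  have yu: "y n \<le> d 0" for n
    using order_trans[OF _ ysum[of "Suc n"], of "y n"] y0 by (simp add: sum_nonneg)
  have c2: "0 < c / 2" using c(1) by simp
  have lowg: "c / 2 \<le> g n (d 0)" for n
    by (rule order_trans[OF large blinfun_mono_pos[OF g(1) yu]])
  obtain p :: "nat \<Rightarrow> nat" and x where x: "\<And>k. 0 \<le> x k" "\<And>n. (\<Sum>k<n. x k) \<le> d 0" "\<And>i j. i \<noteq> j \<Longrightarrow> inf (x i) (x j) = 0"
    "\<And>k. c / 2 / 2 \<le> g (p k) (x k)"
    by (rule disjoint_vectors_in_interval[of g, OF g(1) g(2) dj D0[OF d(1)] c2 lowg]) (assumption | rule that; assumption)+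
  show ?thesis
  proof (rule that[of "c / 2 / 2" x "d 0"])
    show "x n \<le> d 0" for n using order_trans[OF _ x(2)[of "Suc n"], of "x n"] x(1) by (simp add: sum_nonneg)
    show "c / 2 / 2 \<le> norm (x n)" for n
      using x(4)[of n] norm_blinfun[of "g (p n)" "x n"] mult_right_mono[OF g(2) norm_ge_zero[of "x n"], of "p n"]
      by simp
  qed (use c2 x in simp_all)
qed

text \<open>\<open>T\<close> is the composition of \<open>x \<mapsto> (f\<^sub>k x)\<^sub>k\<close> with the copy of \<open>\<ell>\<^sub>\<infinity>\<close> spanned by the disjoint \<open>u\<^sub>k\<close>.\<close>

lemma disjoint_sum_operator:
  fixes f :: "nat \<Rightarrow> 'a::banach_lattice \<Rightarrow>\<^sub>L real" and u :: "nat \<Rightarrow> 'b::banach_lattice"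
  assumes sdc: "sigma_Dedekind_complete TYPE('b)"
    and f: "\<And>k. 0 \<le> f k" "\<And>k. norm (f k) \<le> 1"
    and u: "\<And>k. 0 \<le> u k" "\<And>k. u k \<le> b" and dj: "\<And>i j. i \<noteq> j \<Longrightarrow> inf (u i) (u j) = 0"
  obtains T :: "'a \<Rightarrow>\<^sub>L 'b" where "\<And>x k. 0 \<le> x \<Longrightarrow> f k x *\<^sub>R u k \<le> T x" "\<And>x. 0 \<le> x \<Longrightarrow> T x \<le> norm x *\<^sub>R b"
proof -
  have fnn: "0 \<le> f k x" if "0 \<le> x" for k x by (rule blinfun_nonneg[OF f(1) that])
  have fle: "f k x \<le> norm x" for k x
    using norm_blinfun[of "f k" x] mult_right_mono[OF f(2) norm_ge_zero[of x], of k] by simp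
  have bnd: "f k x *\<^sub>R u k \<le> norm x *\<^sub>R b" if "0 \<le> x" for k x
    by (rule scaleR_mono[OF fle u(2) norm_ge_zero u(1)])
  define G where "G x = (SOME s. (\<forall>k. f k x *\<^sub>R u k \<le> s) \<and> (\<forall>c. (\<forall>k. f k x *\<^sub>R u k \<le> c) \<longrightarrow> s \<le> c))" for x
  have G: "(\<forall>k. f k x *\<^sub>R u k \<le> G x) \<and> (\<forall>c. (\<forall>k. f k x *\<^sub>R u k \<le> c) \<longrightarrow> G x \<le> c)" if x: "0 \<le> x" for x
    unfolding G_def
  proof (rule someI_ex)
    show "\<exists>s. (\<forall>k. f k x *\<^sub>R u k \<le> s) \<and> (\<forall>c. (\<forall>k. f k x *\<^sub>R u k \<le> c) \<longrightarrow> s \<le> c)"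
      by (rule sigma_Dedekind_complete_sup[OF sdc, of "\<lambda>k. f k x *\<^sub>R u k" "norm x *\<^sub>R b"]) (rule bnd[OF x], blast)
  qed
  have up: "f k x *\<^sub>R u k \<le> G x" if "0 \<le> x" for k x using G[OF that] by blast
  have least: "G x \<le> c" if "0 \<le> x" "\<And>k. f k x *\<^sub>R u k \<le> c" for x c using G[OF that(1)] that(2) by blast
  have Gnn: "0 \<le> G x" if "0 \<le> x" for x
    by (rule order_trans[OF scaleR_nonneg_nonneg[OF fnn[OF that] u(1)] up[OF that]])
  have Gadd: "G (x + y) = G x + G y" if xy: "0 \<le> x" "0 \<le> y" for x y
  proof (rule antisym)
    show "G (x + y) \<le> G x + G y"
    proof (rule least)
      show "f k (x + y) *\<^sub>R u k \<le> G x + G y" for k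
        using add_mono[OF up[OF xy(1), of k] up[OF xy(2), of k]] by (simp add: blinfun.add_right scaleR_left_distrib)
    qed (use xy in simp)
    have xy0: "0 \<le> x + y" using xy by simp
    \<comment> \<open>Superadditivity compares terms with different indices. Those are disjoint, so
      their sum is their supremum, and each is below \<open>G (x + y)\<close>.\<close>
    have both: "f k x *\<^sub>R u k + f m y *\<^sub>R u m \<le> G (x + y)" for k m
    proof (cases "k = m")
      case True
      then show ?thesis using up[OF xy0, of m] by (simp add: blinfun.add_right scaleR_left_distrib)
    next
      case False
      let ?a = "f k x *\<^sub>R u k" and ?c = "f m y *\<^sub>R u m"
      have "inf (u k) ?c = 0"
        using inf_eq_0_scaleR[OF dj[of m k] u(1) u(1) fnn[OF xy(2), of m]] False by (simp add: inf_commute)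
      then have "inf ?a ?c = 0"
        by (rule inf_eq_0_scaleR) (use u(1) fnn xy in \<open>simp_all add: scaleR_nonneg_nonneg\<close>)
      then have eq: "?a + ?c = sup ?a ?c" using add_eq_inf_sup[of ?a ?c] by simp
      have "?a \<le> f k (x + y) *\<^sub>R u k" "?c \<le> f m (x + y) *\<^sub>R u m"
        using fnn[OF xy(1)] fnn[OF xy(2)] u(1) by (auto simp: blinfun.add_right intro!: scaleR_right_mono)
      then have "?a \<le> G (x + y)" "?c \<le> G (x + y)" using up[OF xy0] order_trans by blast+
      then show ?thesis unfolding eq by (rule sup_least)
    qed
    have "G x \<le> G (x + y) - f m y *\<^sub>R u m" for m
      using both by (intro least[OF xy(1)]) (simp add: algebra_simps)
    then have "G y \<le> G (x + y) - G x"
      by (intro least[OF xy(2)]) (simp add: algebra_simps)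
    then show "G x + G y \<le> G (x + y)" by (simp add: algebra_simps)
  qed
  have Gscale_le: "G (c *\<^sub>R x) \<le> c *\<^sub>R G x" if "0 \<le> c" "0 \<le> x" for c x
  proof (rule least)
    show "f k (c *\<^sub>R x) *\<^sub>R u k \<le> c *\<^sub>R G x" for k
      using scaleR_left_mono[OF up[OF that(2), of k] that(1)] by (simp add: blinfun.scaleR_right)
  qed (use that in \<open>simp add: scaleR_nonneg_nonneg\<close>)
  obtain T :: "'a \<Rightarrow>\<^sub>L 'b" where T: "\<And>x. 0 \<le> x \<Longrightarrow> T x = G x"
  proof (rule cone_extension[of G])
    fix c :: real and x :: 'a assume cx: "0 \<le> c" "0 \<le> x"
    show "G (c *\<^sub>R x) = c *\<^sub>R G x"
    proof (rule antisym[OF Gscale_le[OF cx]])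
      show "c *\<^sub>R G x \<le> G (c *\<^sub>R x)"
      proof (cases "c = 0")
        case False
        then have "G (inverse c *\<^sub>R c *\<^sub>R x) \<le> inverse c *\<^sub>R G (c *\<^sub>R x)"
          using cx by (intro Gscale_le) (auto simp: scaleR_nonneg_nonneg)
        then have "c *\<^sub>R G x \<le> c *\<^sub>R (inverse c *\<^sub>R G (c *\<^sub>R x))"
          using False cx by (intro scaleR_left_mono) auto
        then show ?thesis using False by simp
      qed (simp add: Gnn)
    qed
  qed (use Gadd Gnn in blast)+
  show ?thesis
  proof (rule that[of T])
    show "f k x *\<^sub>R u k \<le> T x" if "0 \<le> x" for x k using up[OF that] T[OF that] by simp
    show "T x \<le> norm x *\<^sub>R b" if "0 \<le> x" for x using least[OF that bnd[OF that]] T[OF that] by simp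
  qed
qed

section \<open>Positive operators and the counterexample\<close>

lemma positive_op_mono:
  fixes T :: "'a::banach_lattice \<Rightarrow>\<^sub>L 'b::banach_lattice"
  assumes "positive_op T" "x \<le> y" shows "T x \<le> T y"
proof -
  have "0 \<le> T (y - x)" using assms unfolding positive_op_def by simp
  then show ?thesis by (simp add: blinfun.diff_right)
qed

lemma positive_op_abs_le:
  fixes T :: "'a::banach_lattice \<Rightarrow>\<^sub>L 'b::banach_lattice"
  assumes "positive_op T" shows "\<bar>T x\<bar> \<le> T \<bar>x\<bar>"
  using positive_op_mono[OF assms abs_ge_self[of x]] positive_op_mono[OF assms abs_ge_minus_self[of x]]
  by (intro abs_leI) (simp_all add: blinfun.minus_right)

lemma positive_op_order_bounded:
  fixes T :: "'a::banach_lattice \<Rightarrow>\<^sub>L 'b::banach_lattice"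
  assumes "positive_op T" shows "order_bounded_op T"
  unfolding order_bounded_op_def bdd_below_def bdd_above_def
proof (intro allI impI, elim conjE exE)
  fix A :: "'a set" and l h assume "\<forall>x\<in>A. l \<le> x" "\<forall>x\<in>A. x \<le> h"
  then show "(\<exists>m. \<forall>x\<in>T ` A. m \<le> x) \<and> (\<exists>M. \<forall>x\<in>T ` A. x \<le> M)"
    by (intro conjI exI[of _ "T l"] exI[of _ "T h"]) (auto intro: positive_op_mono[OF assms])
qed

theorem not_almost_Dunford_Pettis_witness:
  assumes sdc: "sigma_Dedekind_complete TYPE('b::banach_lattice)"
    and schur: "\<not> positive_Schur TYPE('a::banach_lattice)" and oc: "\<not> order_continuous_norm TYPE('b)"
  obtains T :: "'a::banach_lattice \<Rightarrow>\<^sub>L 'b::banach_lattice"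
  where "positive_op T" "weak_almost_limited T" "\<not> almost_Dunford_Pettis T"
proof -
  obtain x :: "nat \<Rightarrow> 'a" and f :: "nat \<Rightarrow> 'a \<Rightarrow>\<^sub>L real" and d where d: "0 < d" and x: "\<And>n. 0 \<le> x n"
    "\<And>i j. i \<noteq> j \<Longrightarrow> inf (x i) (x j) = 0" "weakly_null x"
    and f: "\<And>n. 0 \<le> f n" "\<And>n. norm (f n) \<le> 1" "\<And>n. d \<le> f n (x n)"
    by (rule not_positive_Schur_disjoint[OF schur]) (rule that; assumption)
  obtain u :: "nat \<Rightarrow> 'b" and b e where e: "0 < e" and u: "\<And>n. 0 \<le> u n" "\<And>n. u n \<le> b"
    "\<And>i j. i \<noteq> j \<Longrightarrow> inf (u i) (u j) = 0" "\<And>n. e \<le> norm (u n)"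
    by (rule not_order_continuous_disjoint[OF oc]) (rule that; assumption)
  obtain T :: "'a \<Rightarrow>\<^sub>L 'b" where T: "\<And>x k. 0 \<le> x \<Longrightarrow> f k x *\<^sub>R u k \<le> T x" "\<And>x. 0 \<le> x \<Longrightarrow> T x \<le> norm x *\<^sub>R b"
    by (rule disjoint_sum_operator[of f u b, OF sdc f(1,2) u(1,2,3)]) (assumption | rule that; assumption)+
  have pos: "positive_op T"
    unfolding positive_op_def
    using order_trans[OF scaleR_nonneg_nonneg[OF blinfun_nonneg[OF f(1)] u(1)] T(1)] by blast
  have b: "0 \<le> b" by (rule order_trans[OF u(1) u(2)])
  have wal: "weak_almost_limited T"
    unfolding weak_almost_limited_def
  proof (intro allI impI)
    fix A :: "'a set" assume "relatively_weakly_compact A"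
    then obtain B where B: "\<And>a. a \<in> A \<Longrightarrow> norm a \<le> B"
      using relatively_weakly_compact_bounded unfolding bounded_iff by blast
    show "almost_limited (T ` A)"
    proof (rule almost_limited_order_bounded[OF sdc])
      fix y assume "y \<in> T ` A"
      then obtain a where a: "a \<in> A" "y = T a" by blast
      have "\<bar>T a\<bar> \<le> T \<bar>a\<bar>" by (rule positive_op_abs_le[OF pos])
      also have "\<dots> \<le> norm a *\<^sub>R b" using T(2)[of "\<bar>a\<bar>"] by simp
      also have "\<dots> \<le> B *\<^sub>R b" by (rule scaleR_right_mono[OF B[OF a(1)] b])
      finally show "\<bar>y\<bar> \<le> B *\<^sub>R b" by (simp add: a)
    qed
  qed
  have "\<not> almost_Dunford_Pettis T"
  proof
    assume "almost_Dunford_Pettis T"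
    moreover have "disjoint_seq x" using x by (simp add: disjoint_seq_def)
    ultimately have lim: "(\<lambda>n. norm (T (x n))) \<longlonglongrightarrow> 0" using x(3) by (simp add: almost_Dunford_Pettis_def)
    have "d * e \<le> norm (T (x n))" for n
    proof -
      have "d * e \<le> f n (x n) * norm (u n)"
        using d e f(3) u(4) by (intro mult_mono) (auto intro: order_trans[OF less_imp_le])
      also have "\<dots> = norm (f n (x n) *\<^sub>R u n)" using blinfun_nonneg[OF f(1) x(1), of n n] by simp
      also have "\<dots> \<le> norm (T (x n))"
        by (rule norm_mono_pos[OF scaleR_nonneg_nonneg[OF blinfun_nonneg[OF f(1) x(1)] u(1)] T(1)[OF x(1)]])
      finally show ?thesis .
    qed
    then have "d * e \<le> 0" using lim by (intro LIMSEQ_le_const) auto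
    then show False using d e by (simp add: mult_le_0_iff)
  qed
  then show ?thesis using that pos wal by blast
qed

theorem theorem2p11:
  assumes "sigma_Dedekind_complete TYPE('f::banach_lattice)"
  shows "((\<forall>T :: 'e::banach_lattice \<Rightarrow>\<^sub>L 'f.
             order_bounded_op T \<and> weak_almost_limited T \<longrightarrow> almost_Dunford_Pettis T) \<longleftrightarrow>
          (\<forall>T :: 'e \<Rightarrow>\<^sub>L 'f.
             positive_op T \<and> weak_almost_limited T \<longrightarrow> almost_Dunford_Pettis T)) \<and>
         ((\<forall>T :: 'e \<Rightarrow>\<^sub>L 'f.
             positive_op T \<and> weak_almost_limited T \<longrightarrow> almost_Dunford_Pettis T) \<longleftrightarrow>
          positive_Schur TYPE('e) \<or> order_continuous_norm TYPE('f))"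
    (is "(?ob \<longleftrightarrow> ?pos) \<and> (?pos \<longleftrightarrow> ?sp)")
proof -
  have "?ob \<longrightarrow> ?pos" using positive_op_order_bounded by blast
  moreover have "?pos \<longrightarrow> ?sp" using not_almost_Dunford_Pettis_witness[OF assms] by metis
  moreover have "?sp \<longrightarrow> ?ob"
    using almost_Dunford_Pettis_if_order_continuous_norm[OF assms] almost_Dunford_Pettis_if_positive_Schur by metis
  ultimately show ?thesis by argo
qed

end
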